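(* Let $\Omega\subset\mathbb{R}^n$ be a bounded Lipschitz domain, let $\mathbf{b}\in L_\infty(\Omega)^n$ with $\operatorname{div}\mathbf{b}\in L_\infty(\Omega)$, let $c\in L_\infty(\Omega)$, and assume that $$\mathcal{B}:u\mapsto \mathbf{b}\cdot\nabla u+cu \quad\text{and}\quad \mathcal{B}^\ast: v\mapsto cv-\operatorname{div}(v\mathbf{b})$$ are boundedly invertible operators $\mathcal{B}:H_{0,\Gamma_-}(\mathbf{b};\Omega)\to L_2(\Omega)$ and $\mathcal{B}^\ast:H_{0,\Gamma_+}(\mathbf{b};\Omega)\to L_2(\Omega)$. Let $\Omega_h$ be any partition of $\Omega$ and set $$\mathbb{U}:=L_2(\Omega)\times H_{0,\Gamma_-}(\mathbf{b};\partial\Omega_h),\qquad \mathbb{V}:=H(\mathbf{b};\Omega_h),$$ where $\|(u,\theta)\|_{\mathbb{U}}^2=\|u\|_{L_2(\Omega)}^2+\|\theta\|^2_{H_{0,\Gamma_-}(\mathbf{b};\partial\Omega_h)}$. Define $\mathcal{B}_h:\mathbb{U}\to\mathbb{V}'$ by $$(\mathcal{B}_h(u,\theta))(v):=\int_\Omega (cv-\mathbf{b}\cdot\nabla_h v-v\operatorname{div}\mathbf{b})\,u\,d\mathbf{x}+\int_{\partial\Omega_h}\llbracket v\mathbf{b}\rrbracket\,\theta\,d\mathbf{s}.$$ Then $\mathcal{B}_h$ is a bounded linear bijection from $\mathbb{U}$ onto $\mathbb{V}'$ with bounded inverse, and $$\|\mathcal{B}_h\|_{\mathcal{L}(\mathbb{U},\mathbb{V}')}\le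 2+\|\operatorname{div}\mathbf{b}\|_{L_\infty(\Omega)}+\|c-\operatorname{div}\mathbf{b}\|_{L_\infty(\Omega)},$$ $$\|\mathcal{B}_h^{-1}\|_{\mathcal{L}(\mathbb{V}',\mathbb{U})}\le\sqrt{\|\mathcal{B}^{-\ast}\|^2+\tilde C_{\mathcal{B}}^2},$$ where $\tilde C_{\mathcal{B}}:=\bigl(1+\|\mathcal{B}^{-\ast}\|(1+\|c-\operatorname{div}\mathbf{b}\|_{L_\infty(\Omega)})\bigr)\,\|\mathcal{B}^{-1}\|\,\bigl(\|c-\operatorname{div}\mathbf{b}\|_{L_\infty(\Omega)}+1\bigr)$, $\|\mathcal{B}^{-1}\|$ is the norm of $\mathcal{B}^{-1}:L_2(\Omega)\to H_{0,\Gamma_-}(\mathbf{b};\Omega)$, and $\|\mathcal{B}^{-\ast}\|$ is the norm of $(\mathcal{B}^\ast)^{-1}:L_2(\Omega)\to H_{0,\Gamma_+}(\mathbf{b};\Omega)$.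
   Context: All spaces are real. $H(\mathbf{b};\Omega):=\{u\in L_2(\Omega):\mathbf{b}\cdot\nabla u\in L_2(\Omega)\}$ with $\|u\|_{H(\mathbf{b};\Omega)}^2:=\|u\|_{L_2(\Omega)}^2+\|\mathbf{b}\cdot\nabla u\|_{L_2(\Omega)}^2$ (derivatives in the weak sense, $\mathbf{b}\cdot\nabla u=\operatorname{div}(u\mathbf{b})-u\operatorname{div}\mathbf{b}$). Boundary portions (up to null sets): the characteristic boundary $\Gamma_0$ is the largest measurable subset of $\partial\Omega$ such that $\int_\Omega 2w\,\mathbf{b}\cdot\nabla w+w^2\operatorname{div}\mathbf{b}\,d\mathbf{x}=0$ for all $w\in H(\mathbf{b};\Omega)\cap C(\bar\Omega)$ that vanish on $\partial\Omega\setminus\Gamma_0$. The outflow boundary $\Gamma_+$ is the largest measurable subset of $\partial\Omega\setminus\Gamma_0$ such that $\int_\Omega 2w\,\mathbf{b}\cdot\nabla w+w^2\operatorname{div}\mathbf{b}\,d\mathbf{x}\ge 0$ for all $w\in H(\mathbf{b};\Omega)\cap C(\bar\Omega)$ that vanish on $(\partial\Omega\setminus\Gamma_0)\setminus\Gamma_+$. The inflow boundary is $\Gamma_-:=\partial\Omega\setminus(\Gamma_0\cup\Gamma_+)$. (For continuous $\mathbf{b}$: $\Gamma_0=\{\mathbf{b}\cdot\mathbf{n}=0\}$, $\Gamma_\pm=\{\pm\mathbf{b}\cdot\mathbf{n}>0\}$, with $\mathbf n$ the outward unit normal.) $H_{0,\Gamma_\pm}(\mathbf{b};\Omega)$ is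 the closure in $H(\mathbf{b};\Omega)$ of $\{u\in H(\mathbf{b};\Omega)\cap C(\bar\Omega):u=0\text{ on }\Gamma_\pm\}$, with the norm of $H(\mathbf{b};\Omega)$. A partition $\Omega_h$ of $\Omega$ is a (finite) collection of disjoint open Lipschitz domains $K$ with $\bar\Omega=\bigcup_{K\in\Omega_h}\bar K$. For each $K$, $\partial K=\partial K_0\cup\partial K_+\cup\partial K_-$ is the analogous splitting into characteristic, outflow and inflow parts, and $\partial\Omega_h:=\bigcup_{K\in\Omega_h}\partial K\setminus\partial K_0$ is the mesh skeleton. $\nabla_h$ is the piecewise (elementwise) gradient; $H(\mathbf{b};\Omega_h):=\{v\in L_2(\Omega):\mathbf{b}\cdot\nabla_h v\in L_2(\Omega)\}$ with $\|v\|_{H(\mathbf{b};\Omega_h)}^2:=\|v\|_{L_2(\Omega)}^2+\|\mathbf{b}\cdot\nabla_h v\|_{L_2(\Omega)}^2$. $H_{0,\Gamma_-}(\mathbf{b};\partial\Omega_h):=\{w|_{\partial\Omega_h}:w\in H_{0,\Gamma_-}(\mathbf{b};\Omega)\}$ with the quotient norm $\|\theta\|:=\inf\{\|w\|_{H(\mathbf{b};\Omega)}:\theta=w|_{\partial\Omega_h},\,w\in H_{0,\Gamma_-}(\mathbf{b};\Omega)\}$. Jump: $\llbracket v\mathbf{b}\rrbracket:=v\mathbf{b}|_K\cdot\mathbf{n}_K+v\mathbf{b}|_{K'}\cdot\mathbf{n}_{K'}$ on $\partial K\cap\partial K'$, and $\llbracket v\mathbf{b}\rrbracket:=v\mathbf{b}|_K\cdot\mathbf{n}_K$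 on $\partial K\cap\partial\Omega$. The skeleton integral is understood via piecewise integration by parts: for $v\in H(\mathbf{b};\Omega_h)$ and $w\in H_{0,\Gamma_-}(\mathbf{b};\Omega)$, $$\int_{\partial\Omega_h}\llbracket v\mathbf{b}\rrbracket\,w\,d\mathbf{s}=\sum_{K\in\Omega_h}\int_K(\mathbf{b}\cdot\nabla v)\,w+v(\mathbf{b}\cdot\nabla w+w\operatorname{div}\mathbf{b})\,d\mathbf{x},$$ and traces $w|_{\partial\Omega_h}$ are correspondingly understood weakly: $w_1|_{\partial\Omega_h}=w_2|_{\partial\Omega_h}$ iff $\int_{\partial\Omega_h}\llbracket v\mathbf{b}\rrbracket(w_1-w_2)\,d\mathbf{s}=0$ for all $v\in H(\mathbf{b};\Omega_h)$. $\mathbb{V}'$ denotes the normed dual. *)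

theory Defs
  imports "HOL-Analysis.Analysis" "HOL-Probability.Essential_Supremum"
begin

section \<open>Normed spaces of representatives\<close>

text \<open>The elements of the function spaces below are classes of functions. A space is given by
  its representatives, the equality of the elements they represent, the vector space operations
  and the norm on representatives. Linearity, injectivity, surjectivity and inverses are always
  understood with respect to \<open>ns_eq\<close>.\<close>

record 'x nspace =
  ns_elems :: "'x set"
  ns_eq :: "'x \<Rightarrow> 'x \<Rightarrow> bool"
  ns_add :: "'x \<Rightarrow> 'x \<Rightarrow> 'x"
  ns_scale :: "real \<Rightarrow> 'x \<Rightarrow> 'x"
  ns_norm :: "'x \<Rightarrow> real"

definition bounded_op :: "'x nspace \<Rightarrow> 'y nspace \<Rightarrow> ('x \<Rightarrow> 'y) \<Rightarrow> bool" where
  "bounded_op X Y T \<longleftrightarrow>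
     (\<forall>x\<in>ns_elems X. T x \<in> ns_elems Y) \<and>
     (\<forall>x\<in>ns_elems X. \<forall>x'\<in>ns_elems X. ns_eq X x x' \<longrightarrow> ns_eq Y (T x) (T x')) \<and>
     (\<forall>x\<in>ns_elems X. \<forall>x'\<in>ns_elems X. ns_eq Y (T (ns_add X x x')) (ns_add Y (T x) (T x'))) \<and>
     (\<forall>r. \<forall>x\<in>ns_elems X. ns_eq Y (T (ns_scale X r x)) (ns_scale Y r (T x))) \<and>
     (\<exists>C. \<forall>x\<in>ns_elems X. ns_norm Y (T x) \<le> C * ns_norm X x)"

definition op_norm :: "'x nspace \<Rightarrow> 'y nspace \<Rightarrow> ('x \<Rightarrow> 'y) \<Rightarrow> real" where
  "op_norm X Y T = Sup {ns_norm Y (T x) | x. x \<in> ns_elems X \<and> ns_norm X x \<le> 1}"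

definition bijective_op :: "'x nspace \<Rightarrow> 'y nspace \<Rightarrow> ('x \<Rightarrow> 'y) \<Rightarrow> bool" where
  "bijective_op X Y T \<longleftrightarrow>
     (\<forall>x\<in>ns_elems X. \<forall>x'\<in>ns_elems X. ns_eq Y (T x) (T x') \<longrightarrow> ns_eq X x x') \<and>
     (\<forall>y\<in>ns_elems Y. \<exists>x\<in>ns_elems X. ns_eq Y (T x) y)"

definition inverse_op :: "'x nspace \<Rightarrow> 'y nspace \<Rightarrow> ('x \<Rightarrow> 'y) \<Rightarrow> 'y \<Rightarrow> 'x" where
  "inverse_op X Y T y = (SOME x. x \<in> ns_elems X \<and> ns_eq Y (T x) y)"

definition boundedly_invertible :: "'x nspace \<Rightarrow> 'y nspace \<Rightarrow> ('x \<Rightarrow> 'y) \<Rightarrow> bool" where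
  "boundedly_invertible X Y T \<longleftrightarrow>
     bounded_op X Y T \<and> bijective_op X Y T \<and> bounded_op Y X (inverse_op X Y T)"

definition prod_space :: "'x nspace \<Rightarrow> 'y nspace \<Rightarrow> ('x \<times> 'y) nspace" where
  "prod_space X Y = \<lparr>
     ns_elems = ns_elems X \<times> ns_elems Y,
     ns_eq = (\<lambda>p q. ns_eq X (fst p) (fst q) \<and> ns_eq Y (snd p) (snd q)),
     ns_add = (\<lambda>p q. (ns_add X (fst p) (fst q), ns_add Y (snd p) (snd q))),
     ns_scale = (\<lambda>r p. (ns_scale X r (fst p), ns_scale Y r (snd p))),
     ns_norm = (\<lambda>p. sqrt ((ns_norm X (fst p))\<^sup>2 + (ns_norm Y (snd p))\<^sup>2))\<rparr>"

definition real_space :: "real nspace" where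
  "real_space = \<lparr>ns_elems = UNIV, ns_eq = (=), ns_add = (+), ns_scale = (*), ns_norm = abs\<rparr>"

definition dual_space :: "'x nspace \<Rightarrow> ('x \<Rightarrow> real) nspace" where
  "dual_space X = \<lparr>
     ns_elems = {f. bounded_op X real_space f},
     ns_eq = (\<lambda>f g. \<forall>x\<in>ns_elems X. f x = g x),
     ns_add = (\<lambda>f g x. f x + g x),
     ns_scale = (\<lambda>r f x. r * f x),
     ns_norm = op_norm X real_space\<rparr>"


section \<open>Lipschitz domains and partitions\<close>

text \<open>Near each boundary point, \<open>\<Omega>\<close> is the part above the graph of a Lipschitz function in the
  direction of a unit vector \<open>\<nu>\<close>. The function lives on the hyperplane orthogonal to \<open>\<nu>\<close>,
  and \<open>y - (y \<bullet> \<nu>) *\<^sub>R \<nu>\<close> is the projection of \<open>y\<close> to it.\<close>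

definition lipschitz_boundary :: "'a::euclidean_space set \<Rightarrow> bool" where
  "lipschitz_boundary \<Omega> \<longleftrightarrow>
     (\<forall>x\<in>frontier \<Omega>. \<exists>r>0. \<exists>\<nu> L g. norm \<nu> = 1 \<and> L-lipschitz_on {z. z \<bullet> \<nu> = 0} (g :: 'a \<Rightarrow> real) \<and>
        \<Omega> \<inter> ball x r = {y \<in> ball x r. g (y - (y \<bullet> \<nu>) *\<^sub>R \<nu>) < y \<bullet> \<nu>})"

definition bounded_lipschitz_domain :: "'a::euclidean_space set \<Rightarrow> bool" where
  "bounded_lipschitz_domain \<Omega> \<longleftrightarrow>
     open \<Omega> \<and> connected \<Omega> \<and> \<Omega> \<noteq> {} \<and> bounded \<Omega> \<and> lipschitz_boundary \<Omega>"

definition is_partition :: "'a::euclidean_space set \<Rightarrow> 'a set set \<Rightarrow> bool" where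
  "is_partition \<Omega> \<Omega>h \<longleftrightarrow>
     finite \<Omega>h \<and> (\<forall>K\<in>\<Omega>h. bounded_lipschitz_domain K) \<and> disjoint \<Omega>h \<and>
     closure \<Omega> = (\<Union>K\<in>\<Omega>h. closure K)"


section \<open>Lebesgue spaces and weak derivatives\<close>

text \<open>Functions are total; their values outside \<open>\<Omega>\<close> (outside its closure, where continuity up
  to the boundary is involved) are irrelevant.\<close>

definition L2_norm :: "'a::euclidean_space set \<Rightarrow> ('a \<Rightarrow> real) \<Rightarrow> real" where
  "L2_norm \<Omega> f = sqrt (LINT x|lebesgue_on \<Omega>. (f x)\<^sup>2)"

definition L2_space :: "'a::euclidean_space set \<Rightarrow> ('a \<Rightarrow> real) nspace" where
  "L2_space \<Omega> = \<lparr>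
     ns_elems = {f. f \<in> borel_measurable (lebesgue_on \<Omega>) \<and>
                    integrable (lebesgue_on \<Omega>) (\<lambda>x. (f x)\<^sup>2)},
     ns_eq = (\<lambda>f g. AE x in lebesgue_on \<Omega>. f x = g x),
     ns_add = (\<lambda>f g x. f x + g x),
     ns_scale = (\<lambda>r f x. r * f x),
     ns_norm = L2_norm \<Omega>\<rparr>"

abbreviation L2 :: "'a::euclidean_space set \<Rightarrow> ('a \<Rightarrow> real) set" where
  "L2 \<Omega> \<equiv> ns_elems (L2_space \<Omega>)"

definition Linf :: "'a::euclidean_space set \<Rightarrow> ('a \<Rightarrow> real) set" where
  "Linf \<Omega> = {f \<in> borel_measurable (lebesgue_on \<Omega>).
              esssup (lebesgue_on \<Omega>) (\<lambda>x. ereal \<bar>f x\<bar>) < \<infinity>}"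

definition Linf_norm :: "'a::euclidean_space set \<Rightarrow> ('a \<Rightarrow> real) \<Rightarrow> real" where
  "Linf_norm \<Omega> f = real_of_ereal (esssup (lebesgue_on \<Omega>) (\<lambda>x. ereal \<bar>f x\<bar>))"

primrec C_k :: "nat \<Rightarrow> ('a::euclidean_space \<Rightarrow> real) \<Rightarrow> bool" where
  "C_k 0 f \<longleftrightarrow> continuous_on UNIV f"
| "C_k (Suc k) f \<longleftrightarrow>
     (\<forall>x. f differentiable (at x)) \<and> (\<forall>i\<in>Basis. C_k k (\<lambda>x. frechet_derivative f (at x) i))"

definition test_functions :: "'a::euclidean_space set \<Rightarrow> ('a \<Rightarrow> real) set" where
  "test_functions \<Omega> =
     {\<phi>. (\<forall>k. C_k k \<phi>) \<and> (\<exists>C. compact C \<and> C \<subseteq> \<Omega> \<and> (\<forall>x. x \<notin> C \<longrightarrow> \<phi> x = 0))}"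

definition loc_integrable ::
  "'a::euclidean_space set \<Rightarrow> ('a \<Rightarrow> 'b::euclidean_space) \<Rightarrow> bool" where
  "loc_integrable \<Omega> f \<longleftrightarrow> (\<forall>C. compact C \<and> C \<subseteq> \<Omega> \<longrightarrow> set_integrable lebesgue C f)"

text \<open>\<open>frechet_derivative \<phi> (at x) (F x)\<close> is the product of \<open>F\<close> with the gradient of \<open>\<phi>\<close>.\<close>

definition has_weak_div ::
  "'a::euclidean_space set \<Rightarrow> ('a \<Rightarrow> 'a) \<Rightarrow> ('a \<Rightarrow> real) \<Rightarrow> bool" where
  "has_weak_div \<Omega> F g \<longleftrightarrow> loc_integrable \<Omega> F \<and> loc_integrable \<Omega> g \<and>
     (\<forall>\<phi>\<in>test_functions \<Omega>.
        (LINT x|lebesgue_on \<Omega>. frechet_derivative \<phi> (at x) (F x)) =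
        - (LINT x|lebesgue_on \<Omega>. g x * \<phi> x))"

definition weak_div :: "'a::euclidean_space set \<Rightarrow> ('a \<Rightarrow> 'a) \<Rightarrow> 'a \<Rightarrow> real" where
  "weak_div \<Omega> F = (SOME g. has_weak_div \<Omega> F g)"

text \<open>The derivative of \<open>u\<close> along \<open>b\<close>, that is, \<open>div (u b) - u div b\<close>.\<close>

definition bgrad ::
  "'a::euclidean_space set \<Rightarrow> ('a \<Rightarrow> 'a) \<Rightarrow> ('a \<Rightarrow> real) \<Rightarrow> 'a \<Rightarrow> real" where
  "bgrad \<Omega> b u = (\<lambda>x. weak_div \<Omega> (\<lambda>y. u y *\<^sub>R b y) x - u x * weak_div \<Omega> b x)"

definition has_bgrad :: "'a::euclidean_space set \<Rightarrow> ('a \<Rightarrow> 'a) \<Rightarrow> ('a \<Rightarrow> real) \<Rightarrow> bool" where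
  "has_bgrad \<Omega> b u \<longleftrightarrow> (\<exists>g. has_weak_div \<Omega> (\<lambda>y. u y *\<^sub>R b y) g)"

definition H_norm :: "'a::euclidean_space set \<Rightarrow> ('a \<Rightarrow> 'a) \<Rightarrow> ('a \<Rightarrow> real) \<Rightarrow> real" where
  "H_norm \<Omega> b u = sqrt ((L2_norm \<Omega> u)\<^sup>2 + (L2_norm \<Omega> (bgrad \<Omega> b u))\<^sup>2)"

definition H_space :: "'a::euclidean_space set \<Rightarrow> ('a \<Rightarrow> 'a) \<Rightarrow> ('a \<Rightarrow> real) nspace" where
  "H_space \<Omega> b = (L2_space \<Omega>)\<lparr>
     ns_elems := {u \<in> L2 \<Omega>. has_bgrad \<Omega> b u \<and> bgrad \<Omega> b u \<in> L2 \<Omega>},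
     ns_norm := H_norm \<Omega> b\<rparr>"

definition H_cont :: "'a::euclidean_space set \<Rightarrow> ('a \<Rightarrow> 'a) \<Rightarrow> ('a \<Rightarrow> real) set" where
  "H_cont \<Omega> b = {u \<in> ns_elems (H_space \<Omega> b). continuous_on (closure \<Omega>) u}"

definition H0_space ::
  "'a::euclidean_space set \<Rightarrow> ('a \<Rightarrow> 'a) \<Rightarrow> 'a set \<Rightarrow> ('a \<Rightarrow> real) nspace" where
  "H0_space \<Omega> b \<Gamma> = (H_space \<Omega> b)\<lparr>
     ns_elems := {u \<in> ns_elems (H_space \<Omega> b).
       \<forall>\<epsilon>>0. \<exists>w\<in>H_cont \<Omega> b. (\<forall>x\<in>\<Gamma>. w x = 0) \<and> H_norm \<Omega> b (\<lambda>x. u x - w x) < \<epsilon>}\<rparr>"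


section \<open>Boundary portions\<close>

text \<open>Hausdorff outer measure of dimension \<open>d\<close>, without the normalising constant, which affects
  neither null sets nor measurability. Surface measure is the case \<open>d = n - 1\<close>; for \<open>d = 0\<close> a
  nonempty set contributes \<open>0 ^ 0 = 1\<close>, so that it counts points.\<close>

definition hausdorff_outer :: "nat \<Rightarrow> 'a::euclidean_space set \<Rightarrow> ennreal" where
  "hausdorff_outer d A =
     (SUP \<delta>\<in>{0<..}. INF C\<in>{C :: nat \<Rightarrow> 'a set. A \<subseteq> (\<Union>i. C i) \<and>
                                  (\<forall>i. bounded (C i) \<and> diameter (C i) \<le> \<delta>)}.
        (\<Sum>i. if C i = {} then 0 else ennreal (diameter (C i) ^ d)))"

definition surface_measurable :: "'a::euclidean_space set \<Rightarrow> bool" where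
  "surface_measurable S \<longleftrightarrow>
     S \<in> lambda_system UNIV UNIV (hausdorff_outer (DIM('a) - 1))"

definition surface_null :: "'a::euclidean_space set \<Rightarrow> bool" where
  "surface_null S \<longleftrightarrow> hausdorff_outer (DIM('a) - 1) S = 0"

definition boundary_form ::
  "'a::euclidean_space set \<Rightarrow> ('a \<Rightarrow> 'a) \<Rightarrow> ('a \<Rightarrow> real) \<Rightarrow> real" where
  "boundary_form \<Omega> b w =
     (LINT x|lebesgue_on \<Omega>. 2 * w x * bgrad \<Omega> b w x + (w x)\<^sup>2 * weak_div \<Omega> b x)"

definition characteristic_part ::
  "'a::euclidean_space set \<Rightarrow> ('a \<Rightarrow> 'a) \<Rightarrow> 'a set \<Rightarrow> bool" where
  "characteristic_part \<Omega> b S \<longleftrightarrow> S \<subseteq> frontier \<Omega> \<and> surface_measurable S \<and>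
     (\<forall>w\<in>H_cont \<Omega> b. (\<forall>x\<in>frontier \<Omega> - S. w x = 0) \<longrightarrow> boundary_form \<Omega> b w = 0)"

definition outflow_part ::
  "'a::euclidean_space set \<Rightarrow> ('a \<Rightarrow> 'a) \<Rightarrow> 'a set \<Rightarrow> 'a set \<Rightarrow> bool" where
  "outflow_part \<Omega> b \<Gamma>0 S \<longleftrightarrow> S \<subseteq> frontier \<Omega> - \<Gamma>0 \<and> surface_measurable S \<and>
     (\<forall>w\<in>H_cont \<Omega> b. (\<forall>x\<in>(frontier \<Omega> - \<Gamma>0) - S. w x = 0) \<longrightarrow> boundary_form \<Omega> b w \<ge> 0)"

text \<open>The characteristic and the outflow boundary are the largest such sets, up to null sets.

  Taken literally, a largest set rarely exists in dimension at least two. If \<open>b\<close> is smooth, a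
  characteristic part stays one after adding a closed, nowhere dense subset of positive surface
  measure of the outflow boundary: a continuous function that vanishes off the added set vanishes
  on it as well. Subsets of this kind exhaust the outflow boundary up to a null set. Hence the
  predicates to use as hypotheses are \<open>characteristic_part\<close> and \<open>outflow_part\<close>: they cover the
  largest sets where these exist, by \<open>boundary_portions\<close>, and for smooth \<open>b\<close> the sets
  on which the product of \<open>b\<close> with the outward normal is zero, respectively positive.\<close>

definition characteristic_boundary ::
  "'a::euclidean_space set \<Rightarrow> ('a \<Rightarrow> 'a) \<Rightarrow> 'a set \<Rightarrow> bool" where
  "characteristic_boundary \<Omega> b \<Gamma>0 \<longleftrightarrow> characteristic_part \<Omega> b \<Gamma>0 \<and>
     (\<forall>S. characteristic_part \<Omega> b S \<longrightarrow> surface_null (S - \<Gamma>0))"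

definition outflow_boundary ::
  "'a::euclidean_space set \<Rightarrow> ('a \<Rightarrow> 'a) \<Rightarrow> 'a set \<Rightarrow> 'a set \<Rightarrow> bool" where
  "outflow_boundary \<Omega> b \<Gamma>0 \<Gamma>p \<longleftrightarrow> outflow_part \<Omega> b \<Gamma>0 \<Gamma>p \<and>
     (\<forall>S. outflow_part \<Omega> b \<Gamma>0 S \<longrightarrow> surface_null (S - \<Gamma>p))"

lemma boundary_portions:
  "characteristic_boundary \<Omega> b \<Gamma>0 \<Longrightarrow> characteristic_part \<Omega> b \<Gamma>0"
  "outflow_boundary \<Omega> b \<Gamma>0 \<Gamma>p \<Longrightarrow> outflow_part \<Omega> b \<Gamma>0 \<Gamma>p"
  by (simp_all add: characteristic_boundary_def outflow_boundary_def)


section \<open>Broken spaces and traces on the skeleton\<close>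

text \<open>On each cell \<open>K\<close> the piecewise derivative is the weak one on \<open>K\<close>; it is zero off the cells,
  that is, on a null set.\<close>

definition bgrad_h ::
  "'a::euclidean_space set set \<Rightarrow> ('a \<Rightarrow> 'a) \<Rightarrow> ('a \<Rightarrow> real) \<Rightarrow> 'a \<Rightarrow> real" where
  "bgrad_h \<Omega>h b v = (\<lambda>x. \<Sum>K\<in>\<Omega>h. indicator K x * bgrad K b v x)"

definition Hh_space ::
  "'a::euclidean_space set \<Rightarrow> 'a set set \<Rightarrow> ('a \<Rightarrow> 'a) \<Rightarrow> ('a \<Rightarrow> real) nspace" where
  "Hh_space \<Omega> \<Omega>h b = (L2_space \<Omega>)\<lparr>
     ns_elems := {v \<in> L2 \<Omega>. (\<forall>K\<in>\<Omega>h. has_bgrad K b v) \<and> bgrad_h \<Omega>h b v \<in> L2 \<Omega>},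
     ns_norm := (\<lambda>v. sqrt ((L2_norm \<Omega> v)\<^sup>2 + (L2_norm \<Omega> (bgrad_h \<Omega>h b v))\<^sup>2))\<rparr>"

text \<open>The integral over the skeleton of the jump of \<open>v b\<close> times the trace of \<open>w\<close>, in the sense of
  piecewise integration by parts.\<close>

definition skeleton_int ::
  "'a::euclidean_space set \<Rightarrow> 'a set set \<Rightarrow> ('a \<Rightarrow> 'a) \<Rightarrow> ('a \<Rightarrow> real) \<Rightarrow> ('a \<Rightarrow> real) \<Rightarrow> real" where
  "skeleton_int \<Omega> \<Omega>h b v w =
     (\<Sum>K\<in>\<Omega>h. LINT x|lebesgue_on K.
        bgrad K b v x * w x + v x * (bgrad \<Omega> b w x + w x * weak_div \<Omega> b x))"

definition same_trace ::
  "'a::euclidean_space set \<Rightarrow> 'a set set \<Rightarrow> ('a \<Rightarrow> 'a) \<Rightarrow> ('a \<Rightarrow> real) \<Rightarrow> ('a \<Rightarrow> real) \<Rightarrow> bool" where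
  "same_trace \<Omega> \<Omega>h b w1 w2 \<longleftrightarrow>
     (\<forall>v\<in>ns_elems (Hh_space \<Omega> \<Omega>h b). skeleton_int \<Omega> \<Omega>h b v (\<lambda>x. w1 x - w2 x) = 0)"

text \<open>The space of traces on the skeleton of the functions in \<open>H0_space \<Omega> b \<Gamma>\<close>, with the quotient
  norm. A trace is represented by any function it is the trace of.\<close>

definition trace_space ::
  "'a::euclidean_space set \<Rightarrow> 'a set set \<Rightarrow> ('a \<Rightarrow> 'a) \<Rightarrow> 'a set \<Rightarrow> ('a \<Rightarrow> real) nspace" where
  "trace_space \<Omega> \<Omega>h b \<Gamma> = (H0_space \<Omega> b \<Gamma>)\<lparr>
     ns_eq := same_trace \<Omega> \<Omega>h b,
     ns_norm := (\<lambda>\<theta>. Inf {H_norm \<Omega> b w | w.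
                    w \<in> ns_elems (H0_space \<Omega> b \<Gamma>) \<and> same_trace \<Omega> \<Omega>h b \<theta> w})\<rparr>"


section \<open>The operators\<close>

definition B_op ::
  "'a::euclidean_space set \<Rightarrow> ('a \<Rightarrow> 'a) \<Rightarrow> ('a \<Rightarrow> real) \<Rightarrow> ('a \<Rightarrow> real) \<Rightarrow> 'a \<Rightarrow> real" where
  "B_op \<Omega> b c u = (\<lambda>x. bgrad \<Omega> b u x + c x * u x)"

definition B_star ::
  "'a::euclidean_space set \<Rightarrow> ('a \<Rightarrow> 'a) \<Rightarrow> ('a \<Rightarrow> real) \<Rightarrow> ('a \<Rightarrow> real) \<Rightarrow> 'a \<Rightarrow> real" where
  "B_star \<Omega> b c v = (\<lambda>x. c x * v x - weak_div \<Omega> (\<lambda>y. v y *\<^sub>R b y) x)"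

definition Bh_op ::
  "'a::euclidean_space set \<Rightarrow> 'a set set \<Rightarrow> ('a \<Rightarrow> 'a) \<Rightarrow> ('a \<Rightarrow> real) \<Rightarrow>
     ('a \<Rightarrow> real) \<times> ('a \<Rightarrow> real) \<Rightarrow> ('a \<Rightarrow> real) \<Rightarrow> real" where
  "Bh_op \<Omega> \<Omega>h b c = (\<lambda>(u, \<theta>) v.
     (LINT x|lebesgue_on \<Omega>. (c x * v x - bgrad_h \<Omega>h b v x - v x * weak_div \<Omega> b x) * u x) +
     skeleton_int \<Omega> \<Omega>h b v \<theta>)"

end

theory Submission
  imports Defs
begin

text \<open>Let \<open>D\<close> be the derivative along \<open>b\<close>, \<open>D\<^sub>h\<close> the piecewise one and \<open>d\<close> the divergence of \<open>b\<close>.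
  The skeleton term vanishes when \<open>v\<close> satisfies the outflow condition and \<open>\<theta>\<close> the inflow condition,
  so that testing with \<open>v = B\<^sup>-\<^sup>* u\<close> bounds \<open>u\<close>, and Riesz representation of
  \<open>q \<mapsto> f (B\<^sup>-\<^sup>* q)\<close> provides \<open>u\<close>. It remains to write a functional \<open>g\<close> on the broken space that vanishes
  on the domain of the adjoint as the skeleton term of some \<open>w\<close>. With the Riesz representative \<open>r\<close> of \<open>g\<close>,
  the choice is \<open>w = D\<^sub>h r\<close>: vanishing of \<open>g\<close> on test functions gives \<open>D w = r - d w\<close>, vanishing on the
  domain of the adjoint gives the inflow condition, and \<open>B w = r + (c - d) w\<close> gives the bound.

  For the skeleton term to vanish, a product rule is needed, which is not available for a bounded
  field \<open>b\<close>. It is read off from the defining property of the characteristic part.\<close>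

section \<open>Semi-inner products and the Riesz representation\<close>

text \<open>The identity that defines the characteristic part is quadratic, and it concerns
  functions that vanish on all of \<open>frontier \<Omega> - \<Gamma>0\<close>. In the skeleton term
  one factor vanishes on the outflow part and the other on the inflow part, so that only their
  product \<open>p\<close> is known to vanish on both. Polarisation does not reach such a pair
  directly, and a square root of \<open>p\<close> may leave the space. Hence \<open>p\<close> is
  split once more, into \<open>p\<close> and a polynomial in \<open>p\<close> that vanishes wherever
  \<open>p\<close> does. The product rule for \<open>p\<close> itself is again polarisation, for
  factors cut off inside \<open>\<Omega>\<close>.

  Boundedness and existence share one lift: for a given solution, the lifted \<open>w\<close>
  represents the same trace as \<open>\<theta>\<close>, so that its norm bounds the quotient norm.
  In the constant of the inverse, \<open>1 + m\<close> with \<open>m\<close> the norm of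
  \<open>c - div b\<close> occurs twice: in the residual \<open>f - \<integral> (A v) u\<close>,
  where \<open>u\<close> is bounded through the inverse adjoint, and in
  \<open>B w = r + (c - d) w\<close>, where \<open>r\<close> and \<open>w\<close> are both bounded
  by the graph norm of \<open>r\<close>. The square root merely combines the bounds for the two
  components.\<close>

lemma quadratic_nonneg_imp:
  fixes A B C :: real
  assumes "\<And>t. A + 2 * t * B + t\<^sup>2 * C \<ge> 0"
  shows "B\<^sup>2 \<le> A * C"
proof (cases "C = 0")
  case True
  have "B = 0"
  proof (rule ccontr)
    assume "B \<noteq> 0"
    then show False using assms[of "- (A + 1) / (2 * B)"] True by (simp add: field_simps)
  qed
  then show ?thesis using True by simp
next
  case False
  have C: "C > 0"
  proof (rule ccontr)
    assume "\<not> C > 0"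
    then have "C < 0" using False by simp
    \<comment> \<open>Large enough for the negative quadratic term to dominate. The final summand 1
      gives \<open>t \<ge> 1\<close>, so that \<open>t\<close> may be replaced by 1 in front of a
      negative factor.\<close>
    define t where "t = (\<bar>A\<bar> + 2 * \<bar>B\<bar> + 1) / (- C) + 1"
    have t: "t \<ge> 1" "t * (- C) = \<bar>A\<bar> + 2 * \<bar>B\<bar> + 1 - C"
      using \<open>C < 0\<close> by (auto simp: t_def field_simps)
    have "A + 2 * t * B + t\<^sup>2 * C = A + t * (2 * B - (t * (- C)))"
      by (simp add: power2_eq_square algebra_simps)
    also have "\<dots> = A + t * (2 * B - (\<bar>A\<bar> + 2 * \<bar>B\<bar> + 1 - C))" using t by simp
    also have "\<dots> \<le> A + 1 * (2 * B - (\<bar>A\<bar> + 2 * \<bar>B\<bar> + 1 - C))"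
      using t \<open>C < 0\<close> by (intro add_left_mono mult_right_mono_neg) auto
    also have "\<dots> < 0" using \<open>C < 0\<close> by auto
    finally show False using assms[of t] by simp
  qed
  have "A + 2 * (- B / C) * B + (- B / C)\<^sup>2 * C = A - B\<^sup>2 / C"
    using C by (simp add: field_simps power2_eq_square)
  then have "B\<^sup>2 / C \<le> A" using assms[of "- B / C"] by simp
  then show ?thesis using C by (simp add: field_simps)
qed

text \<open>Elements are representatives, so the form is only semidefinite: a function that is zero
  almost everywhere has norm 0. The explicit carrier lets the same results serve \<open>L2\<close>
  spaces and graph spaces of weak derivatives.\<close>

locale semi_inner_space =
  fixes S :: "('a \<Rightarrow> real) set" and ip :: "('a \<Rightarrow> real) \<Rightarrow> ('a \<Rightarrow> real) \<Rightarrow> real"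
  assumes zero: "(\<lambda>x. 0) \<in> S"
    and add: "f \<in> S \<Longrightarrow> g \<in> S \<Longrightarrow> (\<lambda>x. f x + g x) \<in> S"
    and scale: "f \<in> S \<Longrightarrow> (\<lambda>x. r * f x) \<in> S"
    and ip_sym: "f \<in> S \<Longrightarrow> g \<in> S \<Longrightarrow> ip f g = ip g f"
    and ip_add: "f \<in> S \<Longrightarrow> g \<in> S \<Longrightarrow> h \<in> S \<Longrightarrow> ip (\<lambda>x. f x + g x) h = ip f h + ip g h"
    and ip_scale: "f \<in> S \<Longrightarrow> h \<in> S \<Longrightarrow> ip (\<lambda>x. r * f x) h = r * ip f h"
    and ip_nonneg: "f \<in> S \<Longrightarrow> ip f f \<ge> 0"
begin

definition nrm :: "('a \<Rightarrow> real) \<Rightarrow> real" where "nrm f = sqrt (ip f f)"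

lemma diff: "f \<in> S \<Longrightarrow> g \<in> S \<Longrightarrow> (\<lambda>x. f x - g x) \<in> S"
  using add[of f "\<lambda>x. (-1) * g x"] scale[of g "-1"] by simp

lemma ip_add_right:
  "f \<in> S \<Longrightarrow> g \<in> S \<Longrightarrow> h \<in> S \<Longrightarrow> ip h (\<lambda>x. f x + g x) = ip h f + ip h g"
  by (simp add: ip_sym[of h] add ip_add)

lemma ip_scale_right: "f \<in> S \<Longrightarrow> h \<in> S \<Longrightarrow> ip h (\<lambda>x. r * f x) = r * ip h f"
  by (simp add: ip_sym[of h] scale ip_scale)

lemma ip_diff: "f \<in> S \<Longrightarrow> g \<in> S \<Longrightarrow> h \<in> S \<Longrightarrow> ip (\<lambda>x. f x - g x) h = ip f h - ip g h"
  using ip_add[of f "\<lambda>x. (-1) * g x" h] ip_scale[of g h "-1"] scale[of g "-1"] by simp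

lemma ip_diff_right:
  "f \<in> S \<Longrightarrow> g \<in> S \<Longrightarrow> h \<in> S \<Longrightarrow> ip h (\<lambda>x. f x - g x) = ip h f - ip h g"
  by (simp add: ip_sym[of h] diff ip_diff)

lemma nrm_nonneg [simp]: "f \<in> S \<Longrightarrow> nrm f \<ge> 0"
  by (simp add: nrm_def ip_nonneg)

lemma nrm_sq: "f \<in> S \<Longrightarrow> (nrm f)\<^sup>2 = ip f f"
  by (simp add: nrm_def ip_nonneg)

lemma nrm_scale: "f \<in> S \<Longrightarrow> nrm (\<lambda>x. r * f x) = \<bar>r\<bar> * nrm f"
  by (simp add: nrm_def scale ip_scale ip_scale_right real_sqrt_mult flip: mult.assoc)

lemma nrm_zero: "nrm (\<lambda>x. 0) = 0"
  using nrm_scale[OF zero, of 0] by simp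

lemma ip_combination:
  assumes "f \<in> S" "g \<in> S"
  shows "ip (\<lambda>x. f x + t * g x) (\<lambda>x. f x + t * g x) = ip f f + 2 * t * ip f g + t\<^sup>2 * ip g g"
proof -
  have tg: "(\<lambda>x. t * g x) \<in> S" by (rule scale) fact
  show ?thesis
    using assms tg
    by (simp add: ip_add ip_add_right ip_scale ip_scale_right add ip_sym[of g f]
        power2_eq_square algebra_simps)
qed

lemma Cauchy_Schwarz: "f \<in> S \<Longrightarrow> g \<in> S \<Longrightarrow> \<bar>ip f g\<bar> \<le> nrm f * nrm g"
proof -
  assume fg: "f \<in> S" "g \<in> S"
  have "(ip f g)\<^sup>2 \<le> ip f f * ip g g"
  proof (rule quadratic_nonneg_imp)
    fix t
    have "(\<lambda>x. f x + t * g x) \<in> S" using fg by (intro add scale)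
    from ip_nonneg[OF this] show "0 \<le> ip f f + 2 * t * ip f g + t\<^sup>2 * ip g g"
      by (simp add: ip_combination fg)
  qed
  then have "(ip f g)\<^sup>2 \<le> (nrm f * nrm g)\<^sup>2"
    by (simp add: power_mult_distrib nrm_sq fg)
  then have "\<bar>ip f g\<bar> \<le> \<bar>nrm f * nrm g\<bar>" by (simp only: abs_le_square_iff)
  then show ?thesis using fg by (simp add: abs_mult)
qed

lemma triangle: "f \<in> S \<Longrightarrow> g \<in> S \<Longrightarrow> nrm (\<lambda>x. f x + g x) \<le> nrm f + nrm g"
proof -
  assume fg: "f \<in> S" "g \<in> S"
  have "(nrm (\<lambda>x. f x + g x))\<^sup>2 = ip f f + 2 * ip f g + ip g g"
    using ip_combination[OF fg, of 1] by (simp add: nrm_sq add fg)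
  also have "\<dots> \<le> ip f f + 2 * (nrm f * nrm g) + ip g g"
    using Cauchy_Schwarz[OF fg] by simp
  also have "\<dots> = (nrm f + nrm g)\<^sup>2"
    by (simp add: power2_sum nrm_sq fg)
  finally show ?thesis
    by (rule power2_le_imp_le) (use fg in simp)
qed

lemma triangle_diff: "f \<in> S \<Longrightarrow> g \<in> S \<Longrightarrow> nrm (\<lambda>x. f x - g x) \<le> nrm f + nrm g"
  using triangle[of f "\<lambda>x. (-1) * g x"] nrm_scale[of g "-1"] scale[of g "-1"] by simp

text \<open>Expanding around the limits, instead of changing one argument after the other, leaves
  only the fixed norms of \<open>l\<close> and \<open>m\<close> in the estimate, so that no bound
  for the sequences is required.\<close>

lemma tendsto_ip:
  assumes u: "\<And>n. u n \<in> S" "l \<in> S" and v: "\<And>n. v n \<in> S" "m \<in> S"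
    and ul: "(\<lambda>n. nrm (\<lambda>x. u n x - l x)) \<longlonglongrightarrow> 0"
    and vm: "(\<lambda>n. nrm (\<lambda>x. v n x - m x)) \<longlonglongrightarrow> 0"
  shows "(\<lambda>n. ip (u n) (v n)) \<longlonglongrightarrow> ip l m"
proof -
  define p where "p n = nrm (\<lambda>x. u n x - l x)" for n
  define q where "q n = nrm (\<lambda>x. v n x - m x)" for n
  have "\<bar>ip (u n) (v n) - ip l m\<bar> \<le> p n * q n + p n * nrm m + nrm l * q n" for n
  proof -
    have "ip (u n) (v n) - ip l m = ip (\<lambda>x. u n x - l x) (\<lambda>x. v n x - m x)
        + ip (\<lambda>x. u n x - l x) m + ip l (\<lambda>x. v n x - m x)"
      using u v by (simp add: ip_diff ip_diff_right diff)
    then show ?thesis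
      using Cauchy_Schwarz[of "\<lambda>x. u n x - l x" "\<lambda>x. v n x - m x"]
        Cauchy_Schwarz[of "\<lambda>x. u n x - l x" m] Cauchy_Schwarz[of l "\<lambda>x. v n x - m x"] u v
      by (auto simp: diff p_def q_def)
  qed
  then have "\<forall>\<^sub>F n in sequentially. norm (ip (u n) (v n) - ip l m)
      \<le> p n * q n + p n * nrm m + nrm l * q n"
    by simp
  moreover have "(\<lambda>n. p n * q n + p n * nrm m + nrm l * q n) \<longlonglongrightarrow> 0 * 0 + 0 * nrm m + nrm l * 0"
    using ul vm unfolding p_def q_def by (intro tendsto_intros)
  then have "(\<lambda>n. p n * q n + p n * nrm m + nrm l * q n) \<longlonglongrightarrow> 0" by simp
  ultimately have "(\<lambda>n. ip (u n) (v n) - ip l m) \<longlonglongrightarrow> 0"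
    by (rule Lim_null_comparison)
  then show ?thesis by (simp add: LIM_zero_iff)
qed

end

text \<open>Riesz representation, by minimising \<open>v \<mapsto> ip v v - 2 f v\<close>: the parallelogram law
  makes a minimising sequence a Cauchy sequence.\<close>

locale semi_hilbert_space = semi_inner_space +
  assumes complete:
    "\<And>u. (\<And>n. u n \<in> S) \<Longrightarrow>
       (\<And>e. e > 0 \<Longrightarrow> \<exists>N. \<forall>m\<ge>N. \<forall>n\<ge>N. ip (\<lambda>x. u m x - u n x) (\<lambda>x. u m x - u n x) < e) \<Longrightarrow>
       \<exists>l\<in>S. (\<lambda>n. ip (\<lambda>x. u n x - l x) (\<lambda>x. u n x - l x)) \<longlonglongrightarrow> 0"
begin

theorem Riesz:
  assumes f_add: "\<And>u v. u \<in> S \<Longrightarrow> v \<in> S \<Longrightarrow> f (\<lambda>x. u x + v x) = f u + f v"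
    and f_scale: "\<And>r u. u \<in> S \<Longrightarrow> f (\<lambda>x. r * u x) = r * f u"
    and f_bound: "\<And>u. u \<in> S \<Longrightarrow> \<bar>f u\<bar> \<le> C * nrm u"
  shows "\<exists>w\<in>S. \<forall>v\<in>S. f v = ip w v"
proof -
  define J where "J v = ip v v - 2 * f v" for v
  have J_lower: "J v \<ge> - C\<^sup>2" if "v \<in> S" for v
  proof -
    have "J v \<ge> (nrm v)\<^sup>2 - 2 * (C * nrm v)"
      using f_bound[OF that] by (auto simp: J_def nrm_sq that)
    moreover have "(nrm v)\<^sup>2 - 2 * (C * nrm v) + C\<^sup>2 = (nrm v - C)\<^sup>2"
      by (simp add: power2_diff)
    ultimately show ?thesis by (smt (verit) zero_le_power2)
  qed
  define I where "I = Inf (J ` S)"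
  have bdd: "bdd_below (J ` S)" using J_lower by (auto intro!: bdd_belowI)
  have I: "I \<le> J v" if "v \<in> S" for v
    unfolding I_def using bdd that by (auto intro: cInf_lower)
  have "\<exists>v\<in>S. J v < I + 1 / real (Suc n)" for n
  proof -
    have "J ` S \<noteq> {}" using zero by blast
    moreover have "Inf (J ` S) < I + 1 / real (Suc n)" by (simp add: I_def)
    ultimately show ?thesis using cInf_lessD[of "J ` S" "I + 1 / real (Suc n)"] by auto
  qed
  then obtain u where u: "\<And>n. u n \<in> S" "\<And>n. J (u n) < I + 1 / real (Suc n)" by metis
  \<comment> \<open>By the parallelogram law the difference of the two sides is four times the
    excess of \<open>J\<close> over its infimum at the midpoint, which is nonnegative.\<close>
  have cauchy: "ip (\<lambda>x. v x - w x) (\<lambda>x. v x - w x) \<le> 2 * (J v - I) + 2 * (J w - I)"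
    if vw: "v \<in> S" "w \<in> S" for v w
  proof -
    have s: "(\<lambda>x. v x + w x) \<in> S" using vw by (rule add)
    have ms: "(\<lambda>x. (1/2) * (v x + w x)) \<in> S" using s by (rule scale)
    have 1: "J (\<lambda>x. (1/2) * (v x + w x)) = (ip v v + 2 * ip v w + ip w w) / 4 - (f v + f w)"
      unfolding J_def using vw s ms ip_combination[OF vw, of 1]
      by (simp only: ip_scale ip_scale_right f_scale f_add) (simp add: field_simps)
    have "ip (\<lambda>x. v x - w x) (\<lambda>x. v x - w x) = ip v v - 2 * ip v w + ip w w"
      using ip_combination[OF vw, of "-1"] by simp
    moreover have "2 * (J v - I) + 2 * (J w - I) - (ip v v - 2 * ip v w + ip w w)
        = 4 * (J (\<lambda>x. (1/2) * (v x + w x)) - I)"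
      unfolding 1 J_def by (simp add: field_simps)
    moreover have "0 \<le> 4 * (J (\<lambda>x. (1/2) * (v x + w x)) - I)" using I[OF ms] by simp
    ultimately show ?thesis by linarith
  qed
  have "\<exists>l\<in>S. (\<lambda>n. ip (\<lambda>x. u n x - l x) (\<lambda>x. u n x - l x)) \<longlonglongrightarrow> 0"
  proof (rule complete)
    show "u n \<in> S" for n by (rule u)
  next
    fix e :: real assume "e > 0"
    then obtain N where N: "1 / real (Suc N) < e / 4"
      by (metis divide_pos_pos nat_approx_posE zero_less_numeral)
    have *: "J (u n) - I < e / 4" if "n \<ge> N" for n
    proof -
      have "1 / real (Suc n) \<le> 1 / real (Suc N)" using that by (simp add: field_simps)
      then show ?thesis using u(2)[of n] N by linarith
    qed
    show "\<exists>N. \<forall>m\<ge>N. \<forall>n\<ge>N. ip (\<lambda>x. u m x - u n x) (\<lambda>x. u m x - u n x) < e"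
    proof (intro exI allI impI)
      fix m n assume mn: "m \<ge> N" "n \<ge> N"
      show "ip (\<lambda>x. u m x - u n x) (\<lambda>x. u m x - u n x) < e"
      proof (rule le_less_trans)
        show "ip (\<lambda>x. u m x - u n x) (\<lambda>x. u m x - u n x) \<le> 2 * (J (u m) - I) + 2 * (J (u n) - I)"
          by (rule cauchy) (rule u)+
        show "2 * (J (u m) - I) + 2 * (J (u n) - I) < e"
          using *[OF mn(1)] *[OF mn(2)] by (simp add: field_simps)
      qed
    qed
  qed
  then obtain l where l: "l \<in> S" and lim: "(\<lambda>n. ip (\<lambda>x. u n x - l x) (\<lambda>x. u n x - l x)) \<longlonglongrightarrow> 0"
    by blast
  have nlim: "(\<lambda>n. nrm (\<lambda>x. u n x - l x)) \<longlonglongrightarrow> 0"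
    using tendsto_real_sqrt[OF lim] by (simp add: nrm_def)
  have "f v = ip l v" if v: "v \<in> S" for v
  proof -
    \<comment> \<open>The error \<open>1 / Suc n\<close> of the minimising sequence disappears in
      the limit. The constant term of the quadratic is then 0, and the discriminant criterion forces
      the linear coefficient, the Euler equation, to vanish.\<close>
    have "0 + 2 * t * (ip l v - f v) + t\<^sup>2 * ip v v \<ge> 0" for t
    proof -
      have nonneg: "2 * t * (ip (u n) v - f v) + t\<^sup>2 * ip v v + 1 / real (Suc n) \<ge> 0" for n
      proof -
        have tv: "(\<lambda>x. t * v x) \<in> S" using v by (rule scale)
        have "(\<lambda>x. u n x + t * v x) \<in> S" using u(1) tv by (rule add)
        from I[OF this] u(2)[of n]
        show ?thesis
          unfolding J_def using ip_combination[OF u(1)[of n] v, of t] f_add[OF u(1)[of n] tv] f_scale[OF v, of t]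
          by (simp add: algebra_simps)
      qed
      have "(\<lambda>n. ip (u n) v) \<longlonglongrightarrow> ip l v"
        using u l v nlim by (intro tendsto_ip) (simp_all add: nrm_zero)
      then have "(\<lambda>n. 2 * t * (ip (u n) v - f v) + t\<^sup>2 * ip v v + 1 / real (Suc n))
          \<longlonglongrightarrow> 2 * t * (ip l v - f v) + t\<^sup>2 * ip v v + 0"
        by (intro tendsto_intros lim_1_over_n LIMSEQ_Suc[OF lim_1_over_n])
      from LIMSEQ_le_const[OF this, of 0] nonneg show ?thesis by simp
    qed
    then have "(ip l v - f v)\<^sup>2 \<le> 0 * ip v v" by (rule quadratic_nonneg_imp)
    then show ?thesis by simp
  qed
  with l show ?thesis by blast
qed

end

section \<open>Square integrable functions\<close>

definition square_integrable :: "'a measure \<Rightarrow> ('a \<Rightarrow> real) set" where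
  "square_integrable M = {f \<in> borel_measurable M. integrable M (\<lambda>x. (f x)\<^sup>2)}"

lemma L2_eq_square_integrable: "L2 \<Omega> = square_integrable (lebesgue_on \<Omega>)"
  by (auto simp: L2_space_def square_integrable_def)

lemma square_integrable_measurable: "f \<in> square_integrable M \<Longrightarrow> f \<in> borel_measurable M"
  by (simp add: square_integrable_def)

lemma integrable_mult_square_integrable:
  assumes "f \<in> square_integrable M" "g \<in> square_integrable M"
  shows "integrable M (\<lambda>x. f x * g x)"
proof (rule Bochner_Integration.integrable_bound)
  show "integrable M (\<lambda>x. (f x)\<^sup>2 + (g x)\<^sup>2)" using assms by (auto simp: square_integrable_def)
  show "(\<lambda>x. f x * g x) \<in> borel_measurable M" using assms by (auto simp: square_integrable_def)
  have "\<bar>a * b\<bar> \<le> a\<^sup>2 + b\<^sup>2" for a b :: real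
  proof -
    have "2 * (\<bar>a\<bar> * \<bar>b\<bar>) \<le> a\<^sup>2 + b\<^sup>2"
      using sum_squares_bound[of "\<bar>a\<bar>" "\<bar>b\<bar>"] by simp
    moreover have "0 \<le> \<bar>a\<bar> * \<bar>b\<bar>" by simp
    ultimately show ?thesis unfolding abs_mult by linarith
  qed
  then show "AE x in M. norm (f x * g x) \<le> norm ((f x)\<^sup>2 + (g x)\<^sup>2)" by auto
qed

lemma square_integrable_scale:
  "f \<in> square_integrable M \<Longrightarrow> (\<lambda>x. r * f x) \<in> square_integrable M"
  by (auto simp: square_integrable_def power_mult_distrib)

lemma square_integrable_add:
  assumes "f \<in> square_integrable M" "g \<in> square_integrable M"
  shows "(\<lambda>x. f x + g x) \<in> square_integrable M"
  using assms integrable_mult_square_integrable[OF assms]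
  by (auto simp: square_integrable_def power2_sum mult.assoc)

lemma square_integrable_diff:
  assumes "f \<in> square_integrable M" "g \<in> square_integrable M"
  shows "(\<lambda>x. f x - g x) \<in> square_integrable M"
  using square_integrable_add[OF assms(1) square_integrable_scale[OF assms(2), of "-1"]] by simp

lemma square_integrable_AE:
  assumes "f \<in> square_integrable M" "g \<in> borel_measurable M" "AE x in M. f x = g x"
  shows "g \<in> square_integrable M"
proof -
  have "integrable M (\<lambda>x. (f x)\<^sup>2)" "f \<in> borel_measurable M"
    using assms by (auto simp: square_integrable_def)
  then have "integrable M (\<lambda>x. (g x)\<^sup>2)"
    by (rule_tac integrable_cong_AE_imp[where g="\<lambda>x. (f x)\<^sup>2"]) (use assms in auto)
  then show ?thesis using assms by (simp add: square_integrable_def)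
qed

lemma square_integrable_bounded_mult:
  assumes f: "f \<in> square_integrable M" and g: "g \<in> borel_measurable M"
    and C: "AE x in M. \<bar>g x\<bar> \<le> C"
  shows "(\<lambda>x. g x * f x) \<in> square_integrable M"
    and "(LINT x|M. (g x * f x)\<^sup>2) \<le> C\<^sup>2 * (LINT x|M. (f x)\<^sup>2)"
proof -
  have fi: "integrable M (\<lambda>x. (f x)\<^sup>2)" and fm: "f \<in> borel_measurable M"
    using f by (auto simp: square_integrable_def)
  have le: "AE x in M. (g x * f x)\<^sup>2 \<le> C\<^sup>2 * (f x)\<^sup>2"
    using C by eventually_elim (auto simp: power_mult_distrib abs_le_square_iff[symmetric] intro!: mult_right_mono)
  have "integrable M (\<lambda>x. (g x * f x)\<^sup>2)"
  proof (rule Bochner_Integration.integrable_bound)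
    show "integrable M (\<lambda>x. C\<^sup>2 * (f x)\<^sup>2)" using fi by simp
    show "AE x in M. norm ((g x * f x)\<^sup>2) \<le> norm (C\<^sup>2 * (f x)\<^sup>2)"
      using le by eventually_elim simp
  qed (use fm g in measurable)
  then show "(\<lambda>x. g x * f x) \<in> square_integrable M"
    using g fm by (auto simp: square_integrable_def)
  have "(LINT x|M. (g x * f x)\<^sup>2) \<le> (LINT x|M. C\<^sup>2 * (f x)\<^sup>2)"
    using \<open>integrable M (\<lambda>x. (g x * f x)\<^sup>2)\<close> fi le by (intro integral_mono_AE) auto
  then show "(LINT x|M. (g x * f x)\<^sup>2) \<le> C\<^sup>2 * (LINT x|M. (f x)\<^sup>2)" by simp
qed

lemma (in finite_measure) square_integrable_bounded:
  assumes "g \<in> borel_measurable M" "AE x in M. \<bar>g x\<bar> \<le> C"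
  shows "g \<in> square_integrable M"
proof -
  have "(\<lambda>x. 1) \<in> square_integrable M" by (simp add: square_integrable_def)
  from square_integrable_bounded_mult(1)[OF this assms] show ?thesis by simp
qed

lemma (in finite_measure) square_integrable_integrable:
  assumes "f \<in> square_integrable M" shows "integrable M f"
  using integrable_mult_square_integrable[OF assms square_integrable_bounded[of "\<lambda>x. 1" 1]] by simp

interpretation L2: semi_inner_space "square_integrable M" "\<lambda>f g. LINT x|M. f x * g x" for M
proof
  show "(\<lambda>x. 0) \<in> square_integrable M" by (simp add: square_integrable_def)
  fix f g :: "_ \<Rightarrow> real"
  show "(LINT x|M. f x * g x) = (LINT x|M. g x * f x)" by (simp add: mult.commute)
qed (simp_all add: square_integrable_add square_integrable_scale mult.assoc distrib_right
    integrable_mult_square_integrable)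

abbreviation "l2norm M \<equiv> semi_inner_space.nrm (\<lambda>f g. LINT x|M. f x * g x)"

lemma L2_norm_eq: "L2_norm \<Omega> f = l2norm (lebesgue_on \<Omega>) f"
  by (simp add: L2_norm_def L2.nrm_def power2_eq_square)

lemma l2norm_AE_cong:
  assumes "f \<in> borel_measurable M" "g \<in> borel_measurable M" "AE x in M. f x = g x"
  shows "l2norm M f = l2norm M g"
proof -
  have "(LINT x|M. f x * f x) = (LINT x|M. g x * g x)"
    by (rule integral_cong_AE) (use assms in auto)
  then show ?thesis by (simp add: L2.nrm_def)
qed

lemma l2norm_bounded_mult:
  assumes f: "f \<in> square_integrable M" and g: "g \<in> borel_measurable M"
    and C: "AE x in M. \<bar>g x\<bar> \<le> C" "0 \<le> C"
  shows "l2norm M (\<lambda>x. g x * f x) \<le> C * l2norm M f"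
proof -
  have "sqrt (LINT x|M. (g x * f x)\<^sup>2) \<le> sqrt (C\<^sup>2 * (LINT x|M. (f x)\<^sup>2))"
    using square_integrable_bounded_mult(2)[OF f g C(1)] by simp
  then show ?thesis using C(2) by (simp add: L2.nrm_def real_sqrt_mult power2_eq_square)
qed

lemma l2norm_zero_imp_AE:
  assumes "f \<in> square_integrable M" "(LINT x|M. f x * f x) = 0"
  shows "AE x in M. f x = 0"
proof -
  have "AE x in M. (f x)\<^sup>2 = 0"
    using assms by (subst integral_nonneg_eq_0_iff_AE[symmetric])
      (auto simp: square_integrable_def power2_eq_square)
  then show ?thesis by simp
qed

lemma (in finite_measure) integral_abs_le_l2norm:
  assumes "f \<in> square_integrable M"
  shows "(LINT x|M. \<bar>f x\<bar>) \<le> l2norm M f * l2norm M (\<lambda>x. 1)"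
proof -
  have a: "(\<lambda>x. \<bar>f x\<bar>) \<in> square_integrable M" using assms by (auto simp: square_integrable_def)
  have one: "(\<lambda>x. 1) \<in> square_integrable M" by (simp add: square_integrable_def)
  have "l2norm M (\<lambda>x. \<bar>f x\<bar>) = l2norm M f" by (simp add: L2.nrm_def)
  then show ?thesis using L2.Cauchy_Schwarz[OF a one] by simp
qed

text \<open>On a finite measure space an \<open>L2\<close> Cauchy sequence is Cauchy in
  \<open>L1\<close>, hence has a subsequence that converges almost everywhere. Fatou's lemma turns
  this pointwise limit into the \<open>L2\<close> limit.\<close>

theorem (in finite_measure) square_integrable_complete:
  assumes u: "\<And>n. u n \<in> square_integrable M"
    and cauchy: "\<And>e. e > 0 \<Longrightarrow> \<exists>N. \<forall>m\<ge>N. \<forall>n\<ge>N. (LINT x|M. (u m x - u n x) * (u m x - u n x)) < e"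
  shows "\<exists>l\<in>square_integrable M. (\<lambda>n. LINT x|M. (u n x - l x) * (u n x - l x)) \<longlonglongrightarrow> 0"
proof -
  have [measurable]: "u n \<in> borel_measurable M" for n
    using u by (simp add: square_integrable_def)
  obtain r where r: "strict_mono r" "AE x in M. Cauchy (\<lambda>i. u (r i) x)"
  proof (rule cauchy_L1_AE_cauchy_subseq)
    show "integrable M (u n)" for n using u by (rule square_integrable_integrable)
    fix e :: real assume e: "e > 0"
    \<comment> \<open>The summand 1 keeps the divisor positive even on a null space.\<close>
    define c where "c = l2norm M (\<lambda>x. 1) + 1"
    have c: "c > 0"
    proof -
      have "(\<lambda>x. 1) \<in> square_integrable M" by (simp add: square_integrable_def)
      from L2.nrm_nonneg[OF this] show ?thesis by (simp add: c_def)
    qed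
    obtain N where N: "\<And>m n. m \<ge> N \<Longrightarrow> n \<ge> N \<Longrightarrow>
        (LINT x|M. (u m x - u n x) * (u m x - u n x)) < (e / c)\<^sup>2"
      using cauchy[of "(e / c)\<^sup>2"] e c by auto
    have "(LINT x|M. norm (u i x - u j x)) < e" if "i \<ge> N" "j \<ge> N" for i j
    proof -
      have d: "(\<lambda>x. u i x - u j x) \<in> square_integrable M" using u u by (rule square_integrable_diff)
      have "l2norm M (\<lambda>x. u i x - u j x) < e / c"
        unfolding L2.nrm_def using N[OF that] e c by (intro real_less_lsqrt) auto
      then have "l2norm M (\<lambda>x. u i x - u j x) * c < e" using c by (simp add: field_simps)
      moreover have "l2norm M (\<lambda>x. u i x - u j x) * l2norm M (\<lambda>x. 1) \<le> l2norm M (\<lambda>x. u i x - u j x) * c"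
        using L2.nrm_nonneg[OF d] by (intro mult_left_mono) (auto simp: c_def)
      ultimately show ?thesis using integral_abs_le_l2norm[OF d] by simp
    qed
    then show "\<exists>N. \<forall>i\<ge>N. \<forall>j\<ge>N. (LINT x|M. norm (u i x - u j x)) < e" by blast
  qed
  define l where "l x = lim (\<lambda>i. u (r i) x)" for x
  have lm [measurable]: "l \<in> borel_measurable M" unfolding l_def by measurable
  have conv: "AE x in M. (\<lambda>i. u (r i) x) \<longlonglongrightarrow> l x"
    using r(2) by eventually_elim (simp add: l_def Cauchy_convergent_iff convergent_LIMSEQ_iff)
  \<comment> \<open>Fatou's lemma, used twice below: with \<open>e = 1\<close> it shows that the
    limit is square integrable, with small \<open>e\<close> that the whole sequence
    converges.\<close>
  have *: "integrable M (\<lambda>x. (u n x - l x)\<^sup>2) \<and> (LINT x|M. (u n x - l x) * (u n x - l x)) \<le> e"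
    if N: "\<And>m. m \<ge> N \<Longrightarrow> (LINT x|M. (u m x - u n x) * (u m x - u n x)) \<le> e" and e: "e > 0" for n N e
  proof -
    have "(\<integral>\<^sup>+x. ennreal ((u n x - l x)\<^sup>2) \<partial>M) = (\<integral>\<^sup>+x. liminf (\<lambda>i. ennreal ((u (r i) x - u n x)\<^sup>2)) \<partial>M)"
    proof (rule nn_integral_cong_AE)
      show "AE x in M. ennreal ((u n x - l x)\<^sup>2) = liminf (\<lambda>i. ennreal ((u (r i) x - u n x)\<^sup>2))"
        using conv
      proof eventually_elim
        case (elim x)
        have "(\<lambda>i. ennreal ((u (r i) x - u n x)\<^sup>2)) \<longlonglongrightarrow> ennreal ((l x - u n x)\<^sup>2)"
          using elim by (intro tendsto_ennrealI tendsto_intros)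
        then show ?case using lim_imp_Liminf[OF sequentially_bot] by (metis power2_commute)
      qed
    qed
    also have "\<dots> \<le> liminf (\<lambda>i. \<integral>\<^sup>+x. ennreal ((u (r i) x - u n x)\<^sup>2) \<partial>M)"
      by (rule nn_integral_liminf) simp
    also have "\<dots> \<le> liminf (\<lambda>i. ennreal e)"
    proof (rule Liminf_mono, rule eventually_sequentiallyI[of N])
      fix i assume "i \<ge> N"
      then have "r i \<ge> N" using seq_suble[OF r(1), of i] by simp
      have d: "(\<lambda>x. u (r i) x - u n x) \<in> square_integrable M" using u u by (rule square_integrable_diff)
      have "(\<integral>\<^sup>+x. ennreal ((u (r i) x - u n x)\<^sup>2) \<partial>M) = ennreal (LINT x|M. (u (r i) x - u n x)\<^sup>2)"
        using d by (intro nn_integral_eq_integral) (auto simp: square_integrable_def)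
      also have "\<dots> \<le> ennreal e"
        using N[OF \<open>r i \<ge> N\<close>] by (intro ennreal_leI) (simp add: power2_eq_square)
      finally show "(\<integral>\<^sup>+x. ennreal ((u (r i) x - u n x)\<^sup>2) \<partial>M) \<le> ennreal e" .
    qed
    also have "\<dots> = ennreal e" by (simp add: Liminf_const)
    finally have le: "(\<integral>\<^sup>+x. ennreal ((u n x - l x)\<^sup>2) \<partial>M) \<le> ennreal e" .
    then have int: "integrable M (\<lambda>x. (u n x - l x)\<^sup>2)"
      by (intro integrableI_nonneg) (auto simp: top.not_eq_extremum intro: le_less_trans)
    have "ennreal (LINT x|M. (u n x - l x)\<^sup>2) \<le> ennreal e"
      using le nn_integral_eq_integral[OF int] by simp
    then show ?thesis using int e by (simp add: power2_eq_square)
  qed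
  obtain N0 where N0: "\<And>m n. m \<ge> N0 \<Longrightarrow> n \<ge> N0 \<Longrightarrow> (LINT x|M. (u m x - u n x) * (u m x - u n x)) < 1"
    using cauchy[of 1] by auto
  have "(\<lambda>x. u N0 x - l x) \<in> square_integrable M"
    using *[of N0 N0 1] N0 by (force simp: square_integrable_def)
  from square_integrable_diff[OF u this, of N0] have l: "l \<in> square_integrable M" by simp
  have "(\<lambda>n. LINT x|M. (u n x - l x) * (u n x - l x)) \<longlonglongrightarrow> 0"
  proof (rule LIMSEQ_I)
    fix e :: real assume e: "e > 0"
    obtain N where N: "\<And>m n. m \<ge> N \<Longrightarrow> n \<ge> N \<Longrightarrow> (LINT x|M. (u m x - u n x) * (u m x - u n x)) < e / 2"
      using cauchy[of "e / 2"] e by auto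
    have "norm ((LINT x|M. (u n x - l x) * (u n x - l x)) - 0) < e" if "n \<ge> N" for n
    proof -
      have "(LINT x|M. (u n x - l x) * (u n x - l x)) \<le> e / 2"
        using *[of N n "e / 2"] N that e by (force simp: less_imp_le)
      moreover have "0 \<le> (LINT x|M. (u n x - l x) * (u n x - l x))" by simp
      ultimately show ?thesis using e by simp
    qed
    then show "\<exists>N. \<forall>n\<ge>N. norm ((LINT x|M. (u n x - l x) * (u n x - l x)) - 0) < e" by blast
  qed
  with l show ?thesis by blast
qed

lemma (in finite_measure) semi_hilbert_square_integrable:
  "semi_hilbert_space (square_integrable M) (\<lambda>f g. LINT x|M. f x * g x)"
  using square_integrable_complete by unfold_locales auto

section \<open>Graph norms of derivatives determined up to null sets\<close>

locale graph_space =
  fixes M :: "'a measure" and S :: "('a \<Rightarrow> real) set" and D :: "('a \<Rightarrow> real) \<Rightarrow> 'a \<Rightarrow> real"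
  assumes S_zero: "(\<lambda>x. 0) \<in> S"
    and S_add: "f \<in> S \<Longrightarrow> g \<in> S \<Longrightarrow> (\<lambda>x. f x + g x) \<in> S"
    and S_scale: "f \<in> S \<Longrightarrow> (\<lambda>x. r * f x) \<in> S"
    and S_sq: "f \<in> S \<Longrightarrow> f \<in> square_integrable M"
    and D_sq: "f \<in> S \<Longrightarrow> D f \<in> square_integrable M"
    and D_add: "f \<in> S \<Longrightarrow> g \<in> S \<Longrightarrow> AE x in M. D (\<lambda>x. f x + g x) x = D f x + D g x"
    and D_scale: "f \<in> S \<Longrightarrow> AE x in M. D (\<lambda>x. r * f x) x = r * D f x"
begin

definition gip :: "('a \<Rightarrow> real) \<Rightarrow> ('a \<Rightarrow> real) \<Rightarrow> real" where
  "gip f g = (LINT x|M. f x * g x) + (LINT x|M. D f x * D g x)"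

text \<open>A weak derivative is some chosen representative, so \<open>D\<close> is linear only
  almost everywhere. The form is nevertheless exactly bilinear, since integrals do not see null
  sets.\<close>

sublocale semi_inner_space S gip
proof
  note [measurable] = D_sq[THEN square_integrable_measurable]
  fix f g h and r :: real
  assume f: "f \<in> S" and h: "h \<in> S"
  show "gip f f \<ge> 0" by (simp add: gip_def)
  have "(LINT x|M. D (\<lambda>x. r * f x) x * D h x) = (LINT x|M. r * D f x * D h x)"
    by (rule integral_cong_AE) (use f h S_scale D_scale[OF f, of r] in auto)
  then show "gip (\<lambda>x. r * f x) h = r * gip f h" by (simp add: gip_def mult.assoc distrib_left)
  assume g: "g \<in> S"
  show "gip f g = gip g f" by (simp add: gip_def mult.commute)
  have "(LINT x|M. D (\<lambda>x. f x + g x) x * D h x) = (LINT x|M. (D f x + D g x) * D h x)"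
    by (rule integral_cong_AE) (use f g h S_add D_add[OF f g] in auto)
  then show "gip (\<lambda>x. f x + g x) h = gip f h + gip g h"
    using f g h by (simp add: gip_def distrib_right integrable_mult_square_integrable S_sq D_sq)
qed (simp_all add: S_zero S_add S_scale)

lemma D_diff:
  assumes "f \<in> S" "g \<in> S"
  shows "AE x in M. D (\<lambda>x. f x - g x) x = D f x - D g x"
  using D_add[OF assms(1) S_scale[OF assms(2), of "-1"]] D_scale[OF assms(2), of "-1"] by auto

lemma nrm_eq: "nrm f = sqrt ((l2norm M f)\<^sup>2 + (l2norm M (D f))\<^sup>2)"
  by (simp add: nrm_def gip_def L2.nrm_def)

lemma l2norm_le_nrm: "l2norm M f \<le> nrm f"
  unfolding nrm_eq by (rule real_le_rsqrt) simp

lemma l2norm_D_le_nrm: "l2norm M (D f) \<le> nrm f"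
  unfolding nrm_eq by (rule real_le_rsqrt) simp

end

section \<open>Smooth functions and cutoffs\<close>

lemma C_k_SucI:
  assumes "\<And>x. (f has_derivative f' x) (at x)" "\<And>i. i \<in> Basis \<Longrightarrow> C_k k (\<lambda>x. f' x i)"
  shows "C_k (Suc k) f"
proof -
  have "frechet_derivative f (at x) = f' x" for x
    using frechet_derivative_at[OF assms(1)] by simp
  then show ?thesis using assms by (auto simp: differentiable_def)
qed

lemma C_k_Suc_has_derivative:
  "C_k (Suc k) f \<Longrightarrow> (f has_derivative frechet_derivative f (at x)) (at x)"
  by (simp add: frechet_derivative_works[symmetric])

lemma C_k_Suc_partial:
  "C_k (Suc k) f \<Longrightarrow> i \<in> Basis \<Longrightarrow> C_k k (\<lambda>x. frechet_derivative f (at x) i)"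
  by simp

lemma C_k_Suc_imp: "C_k (Suc k) f \<Longrightarrow> C_k k f"
proof (induction k arbitrary: f)
  case 0
  then show ?case
    by (auto intro!: continuous_at_imp_continuous_on differentiable_imp_continuous_within)
next
  case (Suc k)
  show ?case
    by (rule C_k_SucI[OF C_k_Suc_has_derivative[OF Suc.prems]])
      (rule Suc.IH, rule C_k_Suc_partial[OF Suc.prems])
qed

lemma C_k_const: "C_k k (\<lambda>x. c)"
proof (induction k arbitrary: c)
  case (Suc k)
  show ?case by (rule C_k_SucI[where f'="\<lambda>_ _. 0"]) (use Suc.IH in auto)
qed simp

lemma C_k_inner: "C_k k (\<lambda>x. x \<bullet> v)"
proof (cases k)
  case 0
  then show ?thesis by (auto intro!: continuous_intros)
next
  case (Suc k)
  show ?thesis unfolding Suc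
    by (rule C_k_SucI[where f'="\<lambda>_ h. h \<bullet> v"]) (auto intro!: derivative_eq_intros C_k_const)
qed

lemma C_k_add: "C_k k f \<Longrightarrow> C_k k g \<Longrightarrow> C_k k (\<lambda>x. f x + g x)"
proof (induction k arbitrary: f g)
  case 0
  then show ?case by (auto intro!: continuous_intros)
next
  case (Suc k)
  show ?case
  proof (rule C_k_SucI)
    show "((\<lambda>x. f x + g x) has_derivative
        (\<lambda>h. frechet_derivative f (at x) h + frechet_derivative g (at x) h)) (at x)" for x
      using Suc.prems by (intro has_derivative_add C_k_Suc_has_derivative)
    show "C_k k (\<lambda>x. frechet_derivative f (at x) i + frechet_derivative g (at x) i)"
      if "i \<in> Basis" for i
      using Suc.prems that by (intro Suc.IH C_k_Suc_partial)
  qed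
qed

lemma C_k_mult: "C_k k f \<Longrightarrow> C_k k g \<Longrightarrow> C_k k (\<lambda>x. f x * g x)"
proof (induction k arbitrary: f g)
  case 0
  then show ?case by (auto intro!: continuous_intros)
next
  case (Suc k)
  show ?case
  proof (rule C_k_SucI)
    show "((\<lambda>x. f x * g x) has_derivative
        (\<lambda>h. f x * frechet_derivative g (at x) h + frechet_derivative f (at x) h * g x)) (at x)" for x
      using Suc.prems by (intro has_derivative_mult C_k_Suc_has_derivative)
    show "C_k k (\<lambda>x. f x * frechet_derivative g (at x) i + frechet_derivative f (at x) i * g x)"
      if "i \<in> Basis" for i
      by (intro C_k_add Suc.IH)
        (rule Suc.prems[THEN C_k_Suc_imp] Suc.prems[THEN C_k_Suc_partial] that)+
  qed
qed

lemma C_k_cmult: "C_k k f \<Longrightarrow> C_k k (\<lambda>x. c * f x)"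
  by (intro C_k_mult C_k_const)

lemma C_k_diff: "C_k k f \<Longrightarrow> C_k k g \<Longrightarrow> C_k k (\<lambda>x. f x - g x)"
  using C_k_add[of k f "\<lambda>x. (-1) * g x"] C_k_cmult[of k g "-1"] by simp

lemma C_k_sum: "(\<And>i. i \<in> I \<Longrightarrow> C_k k (f i)) \<Longrightarrow> C_k k (\<lambda>x. \<Sum>i\<in>I. f i x)"
proof (induction I rule: infinite_finite_induct)
  case (insert i I)
  have "C_k k (\<lambda>x. f i x + (\<Sum>i\<in>I. f i x))"
    by (rule C_k_add) (use insert in auto)
  then show ?case using insert by simp
qed (simp_all add: C_k_const)

lemma C_k_inverse:
  assumes "\<And>x. f x \<noteq> 0" shows "C_k k f \<Longrightarrow> C_k k (\<lambda>x. inverse (f x))"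
proof (induction k)
  case 0
  then show ?case using assms by (auto intro!: continuous_intros)
next
  case (Suc k)
  show ?case
  proof (rule C_k_SucI)
    show "((\<lambda>x. inverse (f x)) has_derivative
        (\<lambda>h. - (inverse (f x) * frechet_derivative f (at x) h * inverse (f x)))) (at x)" for x
      using Suc.prems assms by (intro Deriv.has_derivative_inverse C_k_Suc_has_derivative)
    have "C_k k (\<lambda>x. (-1) * (inverse (f x) * frechet_derivative f (at x) i * inverse (f x)))"
      if "i \<in> Basis" for i
      by (intro C_k_cmult C_k_mult Suc.IH)
        (rule Suc.prems[THEN C_k_Suc_imp] C_k_Suc_partial[OF Suc.prems] that)+
    then show "C_k k (\<lambda>x. - (inverse (f x) * frechet_derivative f (at x) i * inverse (f x)))"
      if "i \<in> Basis" for i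
      using that by simp
  qed
qed

text \<open>The derivative of \<open>bump j\<close> is a combination of \<open>bump (j + 2)\<close> and \<open>bump (j + 1)\<close>, so that
  the family is closed under differentiation.\<close>

definition bump :: "nat \<Rightarrow> real \<Rightarrow> real" where
  "bump j t = (if t > 0 then inverse t ^ j * exp (- inverse t) else 0)"

lemma bump_0_pos: "bump 0 t > 0 \<longleftrightarrow> t > 0" and bump_0_nonneg: "bump 0 t \<ge> 0"
  and bump_0_eq: "t \<le> 0 \<Longrightarrow> bump 0 t = 0"
  by (auto simp: bump_def)

lemma bump_tendsto_0: "(bump j \<longlongrightarrow> 0) (at 0)"
proof -
  have "((\<lambda>t. inverse t ^ j / exp (inverse t)) \<longlongrightarrow> (0::real)) (at_right 0)"
    using filterlim_compose[OF tendsto_power_div_exp_0 filterlim_inverse_at_top_right] .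
  moreover have "\<forall>\<^sub>F t in at_right 0. inverse t ^ j / exp (inverse t) = bump j t"
    by (rule eventually_at_right_less[THEN eventually_mono])
      (auto simp: bump_def exp_minus divide_inverse)
  ultimately have r: "(bump j \<longlongrightarrow> 0) (at_right 0)"
    by (rule Lim_transform_eventually)
  have "\<forall>\<^sub>F t in at_left 0. 0 = bump j t"
    unfolding eventually_at_filter by (simp add: bump_def)
  then have "(bump j \<longlongrightarrow> 0) (at_left 0)"
    by (rule Lim_transform_eventually[OF tendsto_const])
  with r show ?thesis by (simp add: filterlim_split_at)
qed

lemma bump_has_derivative:
  "(bump j has_real_derivative bump (j + 2) t - real j * bump (j + 1) t) (at t)"
proof (cases t "0 :: real" rule: linorder_cases)
  case less
  have "((\<lambda>_. 0) has_real_derivative 0) (at t)" by simp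
  moreover have "\<forall>\<^sub>F s in nhds t. 0 = bump j s"
    using less by (intro eventually_mono[OF eventually_nhds_in_open[of "{..<0}"]]) (auto simp: bump_def)
  ultimately show ?thesis using less
    by (subst (asm) DERIV_cong_ev[OF refl _ refl]) (auto simp: bump_def)
next
  case equal
  \<comment> \<open>The difference quotient of \<open>bump j\<close> at 0 is
    \<open>bump (Suc j)\<close>, so that differentiability at 0 reduces to the limit already
    known.\<close>
  have "((\<lambda>h. (bump j (0 + h) - bump j 0) / h) \<longlongrightarrow> 0) (at 0)"
  proof (rule Lim_transform_eventually[OF bump_tendsto_0[of "Suc j"]])
    show "\<forall>\<^sub>F h in at 0. bump (Suc j) h = (bump j (0 + h) - bump j 0) / h"
      by (auto simp: bump_def field_simps eventually_at_filter)
  qed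
  then show ?thesis using equal by (simp add: DERIV_def bump_def)
next
  case greater
  have "((\<lambda>s. inverse s ^ j * exp (- inverse s)) has_real_derivative
      bump (j + 2) t - real j * bump (j + 1) t) (at t)"
    using greater
    by (auto intro!: derivative_eq_intros simp: bump_def field_simps power2_eq_square)
      (metis Suc_pred neq0_conv power_Suc)
  moreover have "\<forall>\<^sub>F s in nhds t. inverse s ^ j * exp (- inverse s) = bump j s"
    using greater by (intro eventually_mono[OF eventually_nhds_in_open[of "{0<..}"]]) (auto simp: bump_def)
  ultimately show ?thesis
    by (subst (asm) DERIV_cong_ev[OF refl _ refl]) auto
qed

lemma C_k_bump_compose:
  assumes "\<And>k. C_k k S"
  shows "C_k k (\<lambda>x. bump j (S x))"
proof (induction k arbitrary: j)
  case 0
  have "continuous_on UNIV (bump j)"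
    using bump_has_derivative by (intro continuous_at_imp_continuous_on) (blast intro: DERIV_isCont)
  then show ?case using assms[of 0] by (auto intro: continuous_on_compose2)
next
  case (Suc k)
  show ?case
  proof (rule C_k_SucI)
    show "((\<lambda>x. bump j (S x)) has_derivative
        (\<lambda>h. (bump (j + 2) (S x) - real j * bump (j + 1) (S x)) * frechet_derivative S (at x) h)) (at x)" for x
      using has_derivative_compose[OF C_k_Suc_has_derivative[OF assms]
          bump_has_derivative[unfolded has_field_derivative_def]] by simp
    show "C_k k (\<lambda>x. (bump (j + 2) (S x) - real j * bump (j + 1) (S x)) * frechet_derivative S (at x) i)"
      if "i \<in> Basis" for i
      by (intro C_k_mult C_k_diff C_k_cmult Suc.IH C_k_Suc_partial assms that)
  qed
qed

lemma C_k_norm_square: "C_k k (\<lambda>x. (x - a) \<bullet> (x - a))"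
proof -
  have "(x - a) \<bullet> (x - a) = (\<Sum>i\<in>Basis. (x \<bullet> i - a \<bullet> i) * (x \<bullet> i - a \<bullet> i))" for x
    by (subst euclidean_inner) (simp add: inner_diff_left)
  then show ?thesis by (simp only:) (intro C_k_sum C_k_mult C_k_diff C_k_inner C_k_const)
qed

section \<open>Test functions and cutoffs\<close>

lemma test_functionsI:
  "(\<And>k. C_k k \<phi>) \<Longrightarrow> compact C \<Longrightarrow> C \<subseteq> \<Omega> \<Longrightarrow> (\<And>x. x \<notin> C \<Longrightarrow> \<phi> x = 0) \<Longrightarrow> \<phi> \<in> test_functions \<Omega>"
  by (auto simp: test_functions_def)

lemma test_functions_C_k: "\<phi> \<in> test_functions \<Omega> \<Longrightarrow> C_k k \<phi>"
  by (auto simp: test_functions_def)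

lemma test_functionsE:
  assumes "\<phi> \<in> test_functions \<Omega>"
  obtains C where "compact C" "C \<subseteq> \<Omega>" "\<And>x. x \<notin> C \<Longrightarrow> \<phi> x = 0"
  using assms by (auto simp: test_functions_def)

lemma test_functions_outside: "\<phi> \<in> test_functions \<Omega> \<Longrightarrow> x \<notin> \<Omega> \<Longrightarrow> \<phi> x = 0"
  by (auto simp: test_functions_def)

lemma test_functions_mono: "K \<subseteq> \<Omega> \<Longrightarrow> test_functions K \<subseteq> test_functions \<Omega>"
  by (auto simp: test_functions_def)

lemma test_functions_mult:
  assumes "\<phi> \<in> test_functions \<Omega>" "\<And>k. C_k k \<psi>"
  shows "(\<lambda>x. \<phi> x * \<psi> x) \<in> test_functions \<Omega>"
proof -
  obtain C where C: "compact C" "C \<subseteq> \<Omega>" "\<And>x. x \<notin> C \<Longrightarrow> \<phi> x = 0"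
    using assms(1) by (rule test_functionsE) blast
  show ?thesis
    by (rule test_functionsI[OF _ C(1,2)]) (auto intro: C_k_mult test_functions_C_k[OF assms(1)] assms(2) simp: C(3))
qed

text \<open>A finite sum \<open>S\<close> of radial bumps is positive on \<open>C\<close> and
  vanishes off a compact part of \<open>U\<close>. The quotient of \<open>bump 0 (S x)\<close> by
  \<open>bump 0 (S x) + bump 0 (\<delta> - S x)\<close> then flattens it to the value 1 wherever
  \<open>S \<ge> \<delta>\<close>.\<close>

theorem cutoff_function:
  fixes C U :: "'a::euclidean_space set"
  assumes C: "compact C" and U: "open U" and CU: "C \<subseteq> U"
  obtains \<eta> where "\<eta> \<in> test_functions U" "\<And>x. x \<in> C \<Longrightarrow> \<eta> x = 1" "\<And>x. 0 \<le> \<eta> x" "\<And>x. \<eta> x \<le> 1"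
proof (cases "C = {}")
  case True
  have "(\<lambda>x. 0) \<in> test_functions U"
    by (rule test_functionsI[of _ "{}"]) (auto simp: C_k_const)
  then show ?thesis using that[of "\<lambda>x. 0"] True by simp
next
  case False
  have "\<exists>r>0. cball a r \<subseteq> U" if "a \<in> C" for a
    using U CU that open_contains_cball by blast
  then obtain r where r: "\<And>a. a \<in> C \<Longrightarrow> r a > 0" "\<And>a. a \<in> C \<Longrightarrow> cball a (r a) \<subseteq> U" by metis
  obtain T where T: "T \<subseteq> C" "finite T" "C \<subseteq> (\<Union>a\<in>T. ball a (r a))"
  proof (rule compactE_image[OF C])
    show "C \<subseteq> (\<Union>a\<in>C. ball a (r a))" using r(1) by force
  qed auto
  define q where "q a x = (r a)\<^sup>2 - (x - a) \<bullet> (x - a)" for a x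
  define S where "S x = (\<Sum>a\<in>T. bump 0 (q a x))" for x
  have smS: "C_k k S" for k
    unfolding S_def q_def by (intro C_k_sum C_k_bump_compose C_k_diff C_k_const C_k_norm_square)
  have q_pos: "q a x > 0 \<longleftrightarrow> x \<in> ball a (r a)" if "a \<in> T" for a x
  proof -
    have "r a > 0" using that T r by auto
    have "q a x > 0 \<longleftrightarrow> (norm (x - a))\<^sup>2 < (r a)\<^sup>2" by (simp add: q_def power2_norm_eq_inner)
    also have "\<dots> \<longleftrightarrow> norm (x - a) < r a"
      using \<open>r a > 0\<close> by (metis less_imp_le norm_ge_zero power2_less_imp_less power_strict_mono zero_less_numeral)
    finally show ?thesis by (simp add: dist_norm norm_minus_commute)
  qed
  have S_nonneg: "S x \<ge> 0" for x unfolding S_def by (intro sum_nonneg bump_0_nonneg)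
  have S_pos: "S x > 0" if xC: "x \<in> C" for x
  proof -
    obtain a where a: "a \<in> T" "x \<in> ball a (r a)" using T xC by blast
    then have "bump 0 (q a x) > 0" using q_pos by (simp add: bump_0_pos)
    also have "bump 0 (q a x) \<le> S x"
      unfolding S_def using T a by (intro member_le_sum bump_0_nonneg) auto
    finally show ?thesis .
  qed
  have S_zero: "S x = 0" if "x \<notin> (\<Union>a\<in>T. cball a (r a))" for x
    unfolding S_def
  proof (rule sum.neutral, rule ballI)
    fix a assume "a \<in> T"
    with that q_pos[OF this, of x] show "bump 0 (q a x) = 0" by (auto intro!: bump_0_eq simp: not_less)
  qed
  have "continuous_on C S" using smS[of 0] continuous_on_subset by auto
  then obtain x0 where x0: "x0 \<in> C" "\<And>x. x \<in> C \<Longrightarrow> S x0 \<le> S x"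
    using continuous_attains_inf[OF C False] by blast
  \<comment> \<open>The minimum of \<open>S\<close> on \<open>C\<close>. As it is positive,
    \<open>S x\<close> and \<open>\<delta> - S x\<close> are never both nonpositive, and the
    denominator has no zero.\<close>
  define \<delta> where "\<delta> = S x0"
  have \<delta>: "\<delta> > 0" "\<And>x. x \<in> C \<Longrightarrow> \<delta> \<le> S x" using S_pos x0 by (auto simp: \<delta>_def)
  define den where "den x = bump 0 (S x) + bump 0 (\<delta> - S x)" for x
  have den: "den x > 0" for x
  proof (cases "S x > 0")
    case True
    then show ?thesis using bump_0_pos[of "S x"] bump_0_nonneg[of "\<delta> - S x"] by (simp add: den_def)
  next
    case False
    then show ?thesis using bump_0_pos[of "\<delta> - S x"] bump_0_nonneg[of "S x"] \<delta> by (simp add: den_def)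
  qed
  have smden: "C_k k den" for k
    unfolding den_def by (intro C_k_add C_k_bump_compose C_k_diff C_k_const smS)
  show ?thesis
  proof (rule that[of "\<lambda>x. bump 0 (S x) * inverse (den x)"])
    show "(\<lambda>x. bump 0 (S x) * inverse (den x)) \<in> test_functions U"
    proof (rule test_functionsI)
      show "C_k k (\<lambda>x. bump 0 (S x) * inverse (den x))" for k
        using den by (intro C_k_mult C_k_inverse C_k_bump_compose smS smden) (metis less_irrefl)
      show "compact (\<Union>a\<in>T. cball a (r a))" using T by (intro compact_UN) auto
      show "(\<Union>a\<in>T. cball a (r a)) \<subseteq> U" using T r by blast
      show "bump 0 (S x) * inverse (den x) = 0" if "x \<notin> (\<Union>a\<in>T. cball a (r a))" for x
        using S_zero[OF that] by (simp add: bump_0_eq)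
    qed
    show "bump 0 (S x) * inverse (den x) = 1" if "x \<in> C" for x
      using \<delta>(2)[OF that] den[of x] by (simp add: den_def bump_0_eq[of "\<delta> - S x"])
    show "0 \<le> bump 0 (S x) * inverse (den x)" for x
      using bump_0_nonneg[of "S x"] den[of x] by simp
    show "bump 0 (S x) * inverse (den x) \<le> 1" for x
      using bump_0_nonneg[of "\<delta> - S x"] den[of x] by (simp add: field_simps) (simp add: den_def)
  qed
qed

lemma test_functions_continuous: "\<phi> \<in> test_functions \<Omega> \<Longrightarrow> continuous_on A \<phi>"
  using test_functions_C_k[of \<phi> \<Omega> 0] continuous_on_subset by auto

lemma bounded_continuous_compact_support:
  fixes f :: "'a::euclidean_space \<Rightarrow> real"
  assumes "continuous_on UNIV f" "compact C" "\<And>x. x \<notin> C \<Longrightarrow> f x = 0"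
  obtains B where "\<And>x. \<bar>f x\<bar> \<le> B" "B \<ge> 0"
proof -
  have "bounded (f ` C)"
    using assms by (intro compact_imp_bounded compact_continuous_image) (auto intro: continuous_on_subset)
  then obtain B where B: "B > 0" "\<forall>y\<in>f ` C. norm y \<le> B" using bounded_pos by metis
  have "\<bar>f x\<bar> \<le> B" for x using B assms(3)[of x] by (cases "x \<in> C") auto
  then show ?thesis using B that[of B] by auto
qed

lemma test_functions_bounded:
  assumes "\<phi> \<in> test_functions \<Omega>" obtains B where "\<And>x. \<bar>\<phi> x\<bar> \<le> B" "B \<ge> 0"
  using assms bounded_continuous_compact_support[OF test_functions_continuous] by (metis test_functionsE)

lemma frechet_derivative_zero_outside:
  fixes \<phi> :: "'a::euclidean_space \<Rightarrow> real"
  assumes "open W" "x \<in> W" "\<And>y. y \<in> W \<Longrightarrow> \<phi> y = c"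
  shows "frechet_derivative \<phi> (at x) = (\<lambda>_. 0)"
proof -
  have "((\<lambda>_. c) has_derivative (\<lambda>_. 0)) (at x)" by simp
  then have "(\<phi> has_derivative (\<lambda>_. 0)) (at x)"
    by (rule has_derivative_transform_within_open[OF _ assms(1,2)]) (simp add: assms(3))
  then show ?thesis using frechet_derivative_at by metis
qed

lemma test_functions_derivative_sum:
  assumes "\<phi> \<in> test_functions \<Omega>"
  shows "frechet_derivative \<phi> (at x) v = (\<Sum>i\<in>Basis. (v \<bullet> i) * frechet_derivative \<phi> (at x) i)"
proof -
  have "(\<phi> has_derivative frechet_derivative \<phi> (at x)) (at x)"
    using C_k_Suc_has_derivative test_functions_C_k[OF assms] by blast
  then have l: "linear (frechet_derivative \<phi> (at x))"
    using has_derivative_linear by blast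
  have "frechet_derivative \<phi> (at x) v = frechet_derivative \<phi> (at x) (\<Sum>i\<in>Basis. (v \<bullet> i) *\<^sub>R i)"
    by (simp add: euclidean_representation)
  also have "\<dots> = (\<Sum>i\<in>Basis. (v \<bullet> i) *\<^sub>R frechet_derivative \<phi> (at x) i)"
    by (simp add: linear_sum[OF l] linear_scale[OF l])
  finally show ?thesis by simp
qed

lemma test_functions_derivative_scaleR:
  "\<phi> \<in> test_functions \<Omega> \<Longrightarrow> frechet_derivative \<phi> (at x) (r *\<^sub>R v) = r * frechet_derivative \<phi> (at x) v"
  by (subst (1 2) test_functions_derivative_sum) (auto simp: sum_distrib_left mult.assoc)

lemma test_functions_partial_continuous:
  "\<phi> \<in> test_functions \<Omega> \<Longrightarrow> i \<in> Basis \<Longrightarrow> continuous_on UNIV (\<lambda>x. frechet_derivative \<phi> (at x) i)"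
  using C_k_Suc_partial[OF test_functions_C_k[of \<phi> \<Omega> "Suc 0"]] by simp

lemma test_functions_derivative_bounded:
  assumes \<phi>: "\<phi> \<in> test_functions \<Omega>"
  obtains B where "\<And>x v. \<bar>frechet_derivative \<phi> (at x) v\<bar> \<le> B * norm v" "B \<ge> 0"
proof -
  obtain C where C: "compact C" "C \<subseteq> \<Omega>" "\<And>x. x \<notin> C \<Longrightarrow> \<phi> x = 0"
    using \<phi> by (rule test_functionsE) blast
  have zero: "frechet_derivative \<phi> (at x) = (\<lambda>_. 0)" if "x \<notin> C" for x
    using that C by (intro frechet_derivative_zero_outside[of "- C"]) (auto intro: compact_imp_closed)
  have "\<exists>B. (\<forall>x. \<bar>frechet_derivative \<phi> (at x) i\<bar> \<le> B) \<and> B \<ge> 0" if "i \<in> Basis" for i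
    using bounded_continuous_compact_support[OF test_functions_partial_continuous[OF \<phi> that] C(1)] zero
    by (metis (full_types))
  then obtain B where B: "\<And>i x. i \<in> Basis \<Longrightarrow> \<bar>frechet_derivative \<phi> (at x) i\<bar> \<le> B i"
      "\<And>i. i \<in> Basis \<Longrightarrow> B i \<ge> 0" by metis
  show ?thesis
  proof (rule that[of "\<Sum>i\<in>Basis. B i"])
    show "(\<Sum>i\<in>Basis. B i) \<ge> 0" by (intro sum_nonneg B(2))
    fix x v
    have "\<bar>frechet_derivative \<phi> (at x) v\<bar> \<le> (\<Sum>i\<in>Basis. \<bar>(v \<bullet> i) * frechet_derivative \<phi> (at x) i\<bar>)"
      unfolding test_functions_derivative_sum[OF \<phi>, of x v] by (rule sum_abs)
    also have "\<dots> \<le> (\<Sum>i\<in>Basis. B i * norm v)"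
      by (rule sum_mono) (auto simp: abs_mult mult.commute[of "B _"] intro!: mult_mono B Basis_le_norm)
    finally show "\<bar>frechet_derivative \<phi> (at x) v\<bar> \<le> (\<Sum>i\<in>Basis. B i) * norm v"
      by (simp add: sum_distrib_right)
  qed
qed

lemma frechet_derivative_mult:
  assumes "\<And>k. C_k k \<phi>" "\<And>k. C_k k \<psi>"
  shows "frechet_derivative (\<lambda>x. \<phi> x * \<psi> x) (at x) v
    = \<phi> x * frechet_derivative \<psi> (at x) v + frechet_derivative \<phi> (at x) v * \<psi> x"
proof -
  have "((\<lambda>x. \<phi> x * \<psi> x) has_derivative (\<lambda>h. \<phi> x * frechet_derivative \<psi> (at x) h
      + frechet_derivative \<phi> (at x) h * \<psi> x)) (at x)"
    by (intro has_derivative_mult C_k_Suc_has_derivative assms)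
  from frechet_derivative_at[OF this] show ?thesis by metis
qed

section \<open>The fundamental lemma and Lipschitz domains\<close>

text \<open>Local integrability gives measurability on compact subsets only; a compact exhaustion of
  \<open>U\<close> passes it on to \<open>U\<close>. This is how chosen weak divergences become
  measurable.\<close>

lemma loc_integrable_measurable:
  fixes f :: "'a::euclidean_space \<Rightarrow> 'b::euclidean_space"
  assumes U: "open U" and f: "loc_integrable U f"
  shows "f \<in> borel_measurable (lebesgue_on U)"
proof -
  obtain C :: "nat \<Rightarrow> 'a set" where C: "\<And>n. compact (C n)" "\<And>n. C n \<subseteq> U" "\<Union>(range C) = U"
      "\<And>K. compact K \<Longrightarrow> K \<subseteq> U \<Longrightarrow> \<exists>N. \<forall>n\<ge>N. K \<subseteq> C n"
    using open_Union_compact_subsets[OF U] by metis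
  have U_meas: "U \<in> sets lebesgue" using U by (simp add: borel_open)
  have "(\<lambda>x. indicator (C n) x *\<^sub>R f x) \<in> borel_measurable lebesgue" for n
    using f C(1,2)[of n] borel_measurable_integrable
    unfolding loc_integrable_def set_integrable_def by blast
  moreover have "(\<lambda>n. indicator (C n) x *\<^sub>R f x) \<longlonglongrightarrow> indicator U x *\<^sub>R f x" for x
  proof (cases "x \<in> U")
    case True
    then obtain N where "\<And>n. n \<ge> N \<Longrightarrow> x \<in> C n" using C(4)[of "{x}"] by auto
    then have "\<forall>\<^sub>F n in sequentially. indicator (C n) x *\<^sub>R f x = indicator U x *\<^sub>R f x"
      using True by (auto simp: eventually_sequentially indicator_def)
    then show ?thesis by (rule tendsto_eventually)
  next
    case False
    then have "x \<notin> C n" for n using C(2) by blast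
    then show ?thesis using False by simp
  qed
  ultimately have "(\<lambda>x. indicator U x *\<^sub>R f x) \<in> borel_measurable lebesgue"
    by (rule borel_measurable_LIMSEQ_metric)
  then show ?thesis
    using U_meas by (simp add: borel_measurable_restrict_space_iff)
qed

lemma integrable_imp_loc_integrable:
  assumes "U \<in> sets lebesgue" "integrable (lebesgue_on U) f"
  shows "loc_integrable U f"
  unfolding loc_integrable_def
proof (intro allI impI)
  fix C assume C: "compact C \<and> C \<subseteq> U"
  have "set_integrable lebesgue U f"
    using assms by (simp add: integrable_restrict_space set_integrable_def)
  then show "set_integrable lebesgue C f"
    by (rule set_integrable_subset) (use C in \<open>auto simp: borel_compact\<close>)
qed

text \<open>The indicator of \<open>C\<close> is the pointwise limit of cutoffs
  \<open>\<psi> n\<close> with supports shrinking to \<open>C\<close>. These neighbourhoods need not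
  lie in \<open>U\<close>; the fixed factor \<open>\<eta>\<close> makes the products admissible and
  confines them to one compact set \<open>C0\<close>, on which \<open>g\<close> is integrable and
  dominates.\<close>

lemma compact_integral_zero:
  fixes g :: "'a::euclidean_space \<Rightarrow> real"
  assumes U: "open U" and g: "loc_integrable U g"
    and zero: "\<And>\<phi>. \<phi> \<in> test_functions U \<Longrightarrow> (LINT x|lebesgue_on U. g x * \<phi> x) = 0"
    and C: "compact C" "C \<subseteq> U"
  shows "(LINT x|lebesgue. indicator C x * g x) = 0"
proof -
  have U_meas: "U \<in> sets lebesgue" using U by (simp add: borel_open)
  obtain \<eta> where \<eta>: "\<eta> \<in> test_functions U" "\<And>x. x \<in> C \<Longrightarrow> \<eta> x = 1" "\<And>x. 0 \<le> \<eta> x" "\<And>x. \<eta> x \<le> 1"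
    using cutoff_function[OF C(1) U C(2)] by blast
  obtain C0 where C0: "compact C0" "C0 \<subseteq> U" "\<And>x. x \<notin> C0 \<Longrightarrow> \<eta> x = 0"
    using \<eta>(1) by (rule test_functionsE) blast
  define V where "V n = (\<Union>a\<in>C. ball a (1 / real (Suc n)))" for n
  have "\<exists>\<psi>. \<psi> \<in> test_functions (V n) \<and> (\<forall>x\<in>C. \<psi> x = 1) \<and> (\<forall>x. 0 \<le> \<psi> x) \<and> (\<forall>x. \<psi> x \<le> 1)" for n
    by (rule cutoff_function[OF C(1), of "V n"]) (auto simp: V_def)
  then obtain \<psi> where \<psi>: "\<And>n. \<psi> n \<in> test_functions (V n)" "\<And>n x. x \<in> C \<Longrightarrow> \<psi> n x = 1"
      "\<And>n x. 0 \<le> \<psi> n x" "\<And>n x. \<psi> n x \<le> 1"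
    by metis
  have lim: "(\<lambda>n. g x * (\<eta> x * \<psi> n x)) \<longlonglongrightarrow> indicator C x * g x" for x
  proof (cases "x \<in> C")
    case True
    then show ?thesis using \<eta> \<psi> by simp
  next
    case False
    then obtain e where e: "e > 0" "\<And>a. a \<in> C \<Longrightarrow> dist x a \<ge> e"
      using separate_point_closed[OF compact_imp_closed[OF C(1)]] by metis
    obtain N where N: "1 / real (Suc N) < e" by (rule nat_approx_posE[OF e(1)])
    have "\<psi> n x = 0" if "n \<ge> N" for n
    proof -
      have "1 / real (Suc n) \<le> 1 / real (Suc N)" using that by (simp add: field_simps)
      then have "dist a x \<ge> 1 / real (Suc n)" if "a \<in> C" for a
        using e(2)[OF that] N by (simp add: dist_commute)
      then have "x \<notin> V n" by (force simp: V_def)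
      then show ?thesis using \<psi>(1) test_functions_outside by blast
    qed
    then have "\<forall>\<^sub>F n in sequentially. g x * (\<eta> x * \<psi> n x) = indicator C x * g x"
      using False by (auto simp: eventually_sequentially)
    then show ?thesis by (rule tendsto_eventually)
  qed
  have gi: "integrable lebesgue (\<lambda>x. indicator C0 x * g x)"
    using g C0 by (simp add: loc_integrable_def set_integrable_def)
  have gC: "integrable lebesgue (\<lambda>x. indicator C x * g x)"
    using g C by (simp add: loc_integrable_def set_integrable_def)
  have meas: "(\<lambda>x. g x * (\<eta> x * \<psi> n x)) \<in> borel_measurable lebesgue" for n
  proof -
    have "(\<lambda>x. \<eta> x * \<psi> n x) \<in> borel_measurable lebesgue"
      using test_functions_continuous[OF \<eta>(1), of UNIV] test_functions_continuous[OF \<psi>(1), of UNIV]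
      by (intro borel_measurable_times measurable_completion)
        (auto intro: borel_measurable_continuous_onI)
    then have "(\<lambda>x. indicator C0 x * g x * (\<eta> x * \<psi> n x)) \<in> borel_measurable lebesgue"
      by (rule borel_measurable_times[OF borel_measurable_integrable[OF gi]])
    moreover have "(\<lambda>x. indicator C0 x * g x * (\<eta> x * \<psi> n x)) = (\<lambda>x. g x * (\<eta> x * \<psi> n x))"
      using C0(3) by (force simp: fun_eq_iff indicator_def)
    ultimately show ?thesis by simp
  qed
  have "(\<lambda>n. LINT x|lebesgue. g x * (\<eta> x * \<psi> n x)) \<longlonglongrightarrow> (LINT x|lebesgue. indicator C x * g x)"
  proof (rule integral_dominated_convergence[where w="\<lambda>x. norm (indicator C0 x * g x)"])
    show "integrable lebesgue (\<lambda>x. norm (indicator C0 x * g x))" using gi by (rule integrable_norm)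
    show "AE x in lebesgue. norm (g x * (\<eta> x * \<psi> n x)) \<le> norm (indicator C0 x * g x)" for n
    proof (rule AE_I2)
      fix x
      have "\<bar>\<eta> x * \<psi> n x\<bar> \<le> indicator C0 x"
        using \<eta>(3,4)[of x] \<psi>(3,4)[where n=n and x=x] C0(3)[of x]
        by (auto simp: indicator_def mult_le_one)
      then have "\<bar>g x\<bar> * \<bar>\<eta> x * \<psi> n x\<bar> \<le> \<bar>g x\<bar> * indicator C0 x" by (rule mult_left_mono) simp
      then show "norm (g x * (\<eta> x * \<psi> n x)) \<le> norm (indicator C0 x * g x)"
        by (simp add: abs_mult mult.commute)
    qed
  qed (use meas gC lim in auto)
  moreover have "(LINT x|lebesgue. g x * (\<eta> x * \<psi> n x)) = 0" for n
  proof -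
    have "(\<lambda>x. \<eta> x * \<psi> n x) \<in> test_functions U"
      by (rule test_functions_mult[OF \<eta>(1)]) (rule test_functions_C_k[OF \<psi>(1)])
    from zero[OF this] have "(LINT x|lebesgue. indicator U x * (g x * (\<eta> x * \<psi> n x))) = 0"
      using U_meas by (simp add: integral_restrict_space)
    moreover have "(\<lambda>x. indicator U x * (g x * (\<eta> x * \<psi> n x))) = (\<lambda>x. g x * (\<eta> x * \<psi> n x))"
      using C0(2,3) by (force simp: fun_eq_iff indicator_def)
    ultimately show ?thesis by simp
  qed
  ultimately show ?thesis by (simp add: LIMSEQ_const_iff)
qed

text \<open>On a compact part of \<open>{g > 0}\<close> a positive function has integral 0, so that
  part is a null set. Inner regularity of Lebesgue measure extends this to the whole set.\<close>

lemma AE_nonpos_of_compact_integrals: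
  fixes g :: "'a::euclidean_space \<Rightarrow> real"
  assumes U: "open U" and g: "loc_integrable U g"
    and zero: "\<And>C. compact C \<Longrightarrow> C \<subseteq> U \<Longrightarrow> (LINT x|lebesgue. indicator C x * g x) = 0"
  shows "AE x in lebesgue_on U. g x \<le> 0"
proof -
  have U_meas [simp]: "U \<in> sets lebesgue" using U by (simp add: borel_open)
  define A where "A = {x \<in> U. g x > 0}"
  have "{x \<in> space (lebesgue_on U). g x > 0} \<in> sets (lebesgue_on U)"
    using loc_integrable_measurable[OF U g] by measurable
  then have A: "A \<in> sets lebesgue"
    unfolding A_def using U_meas by (simp add: sets_restrict_space_iff)
  have compact_null: "C \<in> null_sets lebesgue" if C: "compact C" "C \<subseteq> A" for C
  proof -
    have CU: "C \<subseteq> U" using C(2) by (auto simp: A_def)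
    have int: "integrable lebesgue (\<lambda>x. indicator C x * g x)"
      using g C(1) CU by (simp add: loc_integrable_def set_integrable_def)
    have pos: "0 \<le> indicator C x * g x" for x using C(2) by (auto simp: A_def indicator_def)
    have "AE x in lebesgue. indicator C x * g x = 0"
      using integral_nonneg_eq_0_iff_AE[OF int] pos zero[OF C(1) CU] by simp
    then have "AE x in lebesgue. x \<notin> C"
      by eventually_elim (use C(2) in \<open>auto simp: A_def indicator_def\<close>)
    then show ?thesis using C(1) by (subst AE_iff_null_sets) (auto simp: borel_compact)
  qed
  have small: "emeasure lebesgue A < ennreal e" if e: "e > 0" for e
  proof -
    obtain T where T: "closed T" "T \<subseteq> A" "A - T \<in> lmeasurable" "emeasure lebesgue (A - T) < ennreal e"
      using sets_lebesgue_inner_closed[OF A e] by blast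
    \<comment> \<open>Inner approximation yields a closed set; intersecting with balls makes it a
      countable union of compact sets.\<close>
    have "T = (\<Union>n. T \<inter> cball 0 (real n))" using real_arch_simple by auto
    moreover have "(\<Union>n. T \<inter> cball 0 (real n)) \<in> null_sets lebesgue"
      by (rule null_sets_UN) (use T in \<open>auto intro!: compact_null closed_Int_compact\<close>)
    ultimately have "T \<in> null_sets lebesgue" by simp
    then have "emeasure lebesgue ((A - T) \<union> T) = emeasure lebesgue (A - T)"
      by (rule emeasure_Un_null_set[rotated]) (use T in auto)
    moreover have "(A - T) \<union> T = A" using T(2) by auto
    ultimately show ?thesis using T(4) by simp
  qed
  have "emeasure lebesgue A = 0"
  proof (rule ccontr)
    assume nz: "emeasure lebesgue A \<noteq> 0"
    have "emeasure lebesgue A < ennreal 1" by (rule small) simp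
    then obtain r where r: "emeasure lebesgue A = ennreal r" "r \<ge> 0"
      by (cases "emeasure lebesgue A") auto
    then have "r > 0" using nz by (cases "r = 0") auto
    then show False using small[of r] r by simp
  qed
  then have "AE x in lebesgue. x \<notin> A" using A by (subst AE_iff_null_sets[symmetric]) auto
  then show ?thesis
    unfolding A_def by (subst AE_restrict_space_iff) (auto elim!: eventually_mono)
qed

theorem fundamental_lemma_calculus_of_variations:
  fixes g :: "'a::euclidean_space \<Rightarrow> real"
  assumes U: "open U" and g: "loc_integrable U g"
    and zero: "\<And>\<phi>. \<phi> \<in> test_functions U \<Longrightarrow> (LINT x|lebesgue_on U. g x * \<phi> x) = 0"
  shows "AE x in lebesgue_on U. g x = 0"
proof -
  have C: "(LINT x|lebesgue. indicator C x * g x) = 0" if "compact C" "C \<subseteq> U" for C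
    using compact_integral_zero[OF U g zero] that by blast
  have "AE x in lebesgue_on U. g x \<le> 0"
    by (rule AE_nonpos_of_compact_integrals[OF U g C])
  moreover have "AE x in lebesgue_on U. - g x \<le> 0"
  proof (rule AE_nonpos_of_compact_integrals[OF U])
    show "loc_integrable U (\<lambda>x. - g x)"
      using g by (simp add: loc_integrable_def set_integrable_def)
  qed (use C in simp)
  ultimately show ?thesis by eventually_elim simp
qed

section \<open>Boundaries of Lipschitz domains\<close>

lemma lipschitz_graph_local:
  assumes dom: "bounded_lipschitz_domain K" and x: "x \<in> frontier K"
  obtains r \<nu> L g where "r > 0" "norm \<nu> = 1" "L-lipschitz_on {z. z \<bullet> \<nu> = 0} (g :: 'a::euclidean_space \<Rightarrow> real)"
    "K \<inter> ball x r = {y \<in> ball x r. g (y - (y \<bullet> \<nu>) *\<^sub>R \<nu>) < y \<bullet> \<nu>}"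
    "\<And>y. y \<in> frontier K \<Longrightarrow> y \<in> ball x r \<Longrightarrow> g (y - (y \<bullet> \<nu>) *\<^sub>R \<nu>) = y \<bullet> \<nu>"
    "\<And>y. y \<in> ball x r \<Longrightarrow> y \<bullet> \<nu> < g (y - (y \<bullet> \<nu>) *\<^sub>R \<nu>) \<Longrightarrow> y \<notin> closure K"
proof -
  have "\<forall>x\<in>frontier K. \<exists>r>0. \<exists>\<nu> L g. norm \<nu> = 1 \<and> L-lipschitz_on {z. z \<bullet> \<nu> = 0} (g :: 'a \<Rightarrow> real) \<and>
      K \<inter> ball x r = {y \<in> ball x r. g (y - (y \<bullet> \<nu>) *\<^sub>R \<nu>) < y \<bullet> \<nu>}"
    using dom by (simp add: bounded_lipschitz_domain_def lipschitz_boundary_def)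
  from bspec[OF this x] obtain r \<nu> L g where
    *: "r > 0" "norm \<nu> = 1" "L-lipschitz_on {z. z \<bullet> \<nu> = 0} (g :: 'a \<Rightarrow> real)"
      "K \<inter> ball x r = {y \<in> ball x r. g (y - (y \<bullet> \<nu>) *\<^sub>R \<nu>) < y \<bullet> \<nu>}"
    by (elim exE conjE) (rule that)
  have open_K: "open K" using dom by (simp add: bounded_lipschitz_domain_def)
  have proj: "(y - (y \<bullet> \<nu>) *\<^sub>R \<nu>) \<bullet> \<nu> = 0" for y
    using *(2) by (simp add: inner_diff_left norm_eq_1)
  have cont: "continuous_on UNIV (\<lambda>y. g (y - (y \<bullet> \<nu>) *\<^sub>R \<nu>))"
    by (rule continuous_on_compose2[OF lipschitz_on_continuous_on[OF *(3)]])
      (auto intro!: continuous_intros simp: proj)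
  \<comment> \<open>The points below the graph form an open set that misses \<open>K\<close>, hence
    it misses the closure as well.\<close>
  have below: "y \<notin> closure K" if y: "y \<in> ball x r" "y \<bullet> \<nu> < g (y - (y \<bullet> \<nu>) *\<^sub>R \<nu>)" for y
  proof -
    let ?W = "ball x r \<inter> {y. y \<bullet> \<nu> < g (y - (y \<bullet> \<nu>) *\<^sub>R \<nu>)}"
    have "open ?W" using cont by (intro open_Int open_ball open_Collect_less continuous_intros)
    moreover have "?W \<inter> K = {}" using *(4) by force
    ultimately have "?W \<inter> closure K = {}" by (simp add: open_Int_closure_eq_empty)
    then show ?thesis using y by blast
  qed
  have "g (y - (y \<bullet> \<nu>) *\<^sub>R \<nu>) = y \<bullet> \<nu>" if y: "y \<in> frontier K" "y \<in> ball x r" for y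
  proof -
    have "y \<notin> K" "y \<in> closure K" using y open_K by (auto simp: frontier_def interior_open)
    then show ?thesis using below[OF y(2)] *(4) y(2) by force
  qed
  with * below show ?thesis using that by blast
qed

text \<open>Locally the frontier is the image of a hyperplane, a null set, under the Lipschitz map
  that lifts a point to the graph. Compactness leaves finitely many such pieces.\<close>

lemma negligible_lipschitz_frontier:
  fixes K :: "'a::euclidean_space set"
  assumes dom: "bounded_lipschitz_domain K"
  shows "negligible (frontier K)"
proof -
  have loc: "\<exists>r>0. negligible (frontier K \<inter> ball x r)" if x: "x \<in> frontier K" for x
  proof -
    obtain r \<nu> L g where *: "r > 0" "norm \<nu> = 1" "L-lipschitz_on {z. z \<bullet> \<nu> = 0} (g :: 'a \<Rightarrow> real)"
      and "K \<inter> ball x r = {y \<in> ball x r. g (y - (y \<bullet> \<nu>) *\<^sub>R \<nu>) < y \<bullet> \<nu>}"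
      and g: "\<And>y. y \<in> frontier K \<Longrightarrow> y \<in> ball x r \<Longrightarrow> g (y - (y \<bullet> \<nu>) *\<^sub>R \<nu>) = y \<bullet> \<nu>"
      and "\<And>y. y \<in> ball x r \<Longrightarrow> y \<bullet> \<nu> < g (y - (y \<bullet> \<nu>) *\<^sub>R \<nu>) \<Longrightarrow> y \<notin> closure K"
      by (rule lipschitz_graph_local[OF dom x]) (rule that)
    let ?P = "{z :: 'a. z \<bullet> \<nu> = 0}" and ?f = "\<lambda>z. z + g z *\<^sub>R \<nu>"
    have "negligible ?P"
      using negligible_hyperplane[of \<nu> 0] *(2) by (force simp: inner_commute)
    then have "negligible (?f ` ?P)"
    proof (rule negligible_locally_Lipschitz_image[rotated])
      fix z assume z: "z \<in> ?P"
      have "norm (?f y - ?f z) \<le> (1 + L) * norm (y - z)" if y: "y \<in> ?P" for y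
      proof -
        have "norm (?f y - ?f z) = norm ((y - z) + (g y - g z) *\<^sub>R \<nu>)" by (simp add: algebra_simps)
        also have "\<dots> \<le> norm (y - z) + \<bar>g y - g z\<bar>"
          using norm_triangle_ineq[of "y - z" "(g y - g z) *\<^sub>R \<nu>"] *(2) by simp
        also have "\<bar>g y - g z\<bar> \<le> L * norm (y - z)"
          using lipschitz_onD[OF *(3), of y z] y z by (simp add: dist_norm)
        finally show ?thesis by (simp add: algebra_simps)
      qed
      then show "\<exists>T B. open T \<and> z \<in> T \<and> (\<forall>y \<in> ?P \<inter> T. norm (?f y - ?f z) \<le> B * norm (y - z))"
        by (intro exI[of _ UNIV] exI[of _ "1 + L"]) auto
    qed simp
    moreover have "frontier K \<inter> ball x r \<subseteq> ?f ` ?P"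
    proof
      fix y assume y: "y \<in> frontier K \<inter> ball x r"
      have "y = ?f (y - (y \<bullet> \<nu>) *\<^sub>R \<nu>)" using g y by simp
      moreover have "y - (y \<bullet> \<nu>) *\<^sub>R \<nu> \<in> ?P" using *(2) by (simp add: inner_diff_left norm_eq_1)
      ultimately show "y \<in> ?f ` ?P" by blast
    qed
    ultimately show ?thesis using *(1) negligible_subset by blast
  qed
  then obtain r where r: "\<And>x. x \<in> frontier K \<Longrightarrow> r x > 0"
      "\<And>x. x \<in> frontier K \<Longrightarrow> negligible (frontier K \<inter> ball x (r x))" by metis
  have "compact (frontier K)"
    using dom by (auto simp: bounded_lipschitz_domain_def compact_frontier_bounded)
  then obtain T where T: "T \<subseteq> frontier K" "finite T" "frontier K \<subseteq> (\<Union>x\<in>T. ball x (r x))"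
  proof (rule compactE_image)
    show "frontier K \<subseteq> (\<Union>x\<in>frontier K. ball x (r x))" using r(1) by force
  qed auto
  have "negligible (\<Union>x\<in>T. frontier K \<inter> ball x (r x))"
    using T r(2) by (intro negligible_Union) auto
  then show ?thesis by (rule negligible_subset) (use T(3) in blast)
qed

text \<open>Below the graph there are exterior points arbitrarily close to each boundary point, so
  that a Lipschitz domain has no slits.\<close>

lemma interior_closure_lipschitz:
  fixes K :: "'a::euclidean_space set"
  assumes dom: "bounded_lipschitz_domain K"
  shows "interior (closure K) = K"
proof
  have open_K: "open K" using dom by (simp add: bounded_lipschitz_domain_def)
  then show "K \<subseteq> interior (closure K)" by (simp add: closure_subset interior_maximal)
  show "interior (closure K) \<subseteq> K"
  proof
    fix x assume x: "x \<in> interior (closure K)"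
    show "x \<in> K"
    proof (rule ccontr)
      assume "x \<notin> K"
      then have xf: "x \<in> frontier K"
        using x open_K interior_subset by (auto simp: frontier_def interior_open)
      obtain r \<nu> L g where *: "r > 0" "norm \<nu> = 1" "L-lipschitz_on {z. z \<bullet> \<nu> = 0} (g :: 'a \<Rightarrow> real)"
        and "K \<inter> ball x r = {y \<in> ball x r. g (y - (y \<bullet> \<nu>) *\<^sub>R \<nu>) < y \<bullet> \<nu>}"
        and on_graph: "\<And>y. y \<in> frontier K \<Longrightarrow> y \<in> ball x r \<Longrightarrow> g (y - (y \<bullet> \<nu>) *\<^sub>R \<nu>) = y \<bullet> \<nu>"
        and below: "\<And>y. y \<in> ball x r \<Longrightarrow> y \<bullet> \<nu> < g (y - (y \<bullet> \<nu>) *\<^sub>R \<nu>) \<Longrightarrow> y \<notin> closure K"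
        by (rule lipschitz_graph_local[OF dom xf]) (rule that)
      have g: "g (x - (x \<bullet> \<nu>) *\<^sub>R \<nu>) = x \<bullet> \<nu>" using on_graph[OF xf] *(1) by simp
      obtain e where e: "e > 0" "ball x e \<subseteq> closure K"
        using x by (meson mem_interior)
      \<comment> \<open>Moving by \<open>t\<close> against \<open>\<nu>\<close> keeps the projection
        to the hyperplane, so that the new point lies below the graph, and it stays in both
        balls.\<close>
      define t where "t = min e r / 2"
      have t: "t > 0" "t < e" "t < r" using e *(1) by (auto simp: t_def)
      let ?y = "x - t *\<^sub>R \<nu>"
      have nn: "\<nu> \<bullet> \<nu> = 1" using *(2) by (simp add: norm_eq_1)
      have "?y - (?y \<bullet> \<nu>) *\<^sub>R \<nu> = x - (x \<bullet> \<nu>) *\<^sub>R \<nu>"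
        by (simp add: inner_diff_left nn algebra_simps)
      then have "?y \<bullet> \<nu> < g (?y - (?y \<bullet> \<nu>) *\<^sub>R \<nu>)"
        using t(1) g by (simp only:) (simp add: inner_diff_left nn)
      then have "?y \<notin> closure K"
        using t *(2) by (intro below) (auto simp: dist_norm)
      moreover have "?y \<in> ball x e" using t *(2) by (simp add: dist_norm)
      ultimately show False using e by blast
    qed
  qed
qed

text \<open>A partition is specified through closures alone. That cells lie inside
  \<open>\<Omega>\<close> follows since \<open>\<Omega>\<close> is the interior of its closure, and
  what the cells leave uncovered consists of frontier points.\<close>

lemma partition_cells:
  fixes \<Omega> :: "'a::euclidean_space set"
  assumes dom: "bounded_lipschitz_domain \<Omega>" and part: "is_partition \<Omega> \<Omega>h"
  shows "K \<in> \<Omega>h \<Longrightarrow> open K" "K \<in> \<Omega>h \<Longrightarrow> K \<subseteq> \<Omega>" "negligible (\<Omega> - \<Union>\<Omega>h)"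
proof -
  show op: "open K" if "K \<in> \<Omega>h" for K
    using part that by (auto simp: is_partition_def bounded_lipschitz_domain_def)
  show "K \<subseteq> \<Omega>" if K: "K \<in> \<Omega>h" for K
  proof -
    have "K \<subseteq> closure \<Omega>" using part K closure_subset by (fastforce simp: is_partition_def)
    then have "K \<subseteq> interior (closure \<Omega>)" using op[OF K] by (rule interior_maximal)
    then show ?thesis using interior_closure_lipschitz[OF dom] by simp
  qed
  have "negligible (\<Union>K\<in>\<Omega>h. frontier K)"
    using part by (intro negligible_Union) (auto simp: is_partition_def intro: negligible_lipschitz_frontier)
  moreover have "\<Omega> - \<Union>\<Omega>h \<subseteq> (\<Union>K\<in>\<Omega>h. frontier K)"
  proof
    fix x assume x: "x \<in> \<Omega> - \<Union>\<Omega>h"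
    then have "x \<in> closure \<Omega>" using closure_subset by blast
    then have "x \<in> (\<Union>K\<in>\<Omega>h. closure K)" using part by (simp add: is_partition_def)
    then show "x \<in> (\<Union>K\<in>\<Omega>h. frontier K)" using x op by (auto simp: frontier_def interior_open)
  qed
  ultimately show "negligible (\<Omega> - \<Union>\<Omega>h)" by (rule negligible_subset)
qed

section \<open>Weak derivatives along a vector field\<close>

text \<open>A negative essential supremum occurs only over a null space, where it is
  \<open>-\<infinity>\<close> and \<open>real_of_ereal\<close> returns 0.\<close>

lemma Linf_norm_nonneg: "0 \<le> Linf_norm \<Omega> f"
proof (cases "0 \<le> esssup (lebesgue_on \<Omega>) (\<lambda>x. ereal \<bar>f x\<bar>)")
  case True
  then show ?thesis by (simp add: Linf_norm_def real_of_ereal_pos)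
next
  case False
  have "AE x in lebesgue_on \<Omega>. False"
    using esssup_AE[of "\<lambda>x. ereal \<bar>f x\<bar>" "lebesgue_on \<Omega>"]
  proof eventually_elim
    case (elim x)
    have "0 \<le> ereal \<bar>f x\<bar>" by simp
    also note elim
    finally show False using False by simp
  qed
  then have "emeasure (lebesgue_on \<Omega>) (space (lebesgue_on \<Omega>)) = 0"
    by (metis ae_filter_eq_bot_iff eventually_False)
  moreover have "(\<lambda>x. ereal \<bar>f x\<bar>) \<in> borel_measurable (lebesgue_on \<Omega>)"
    using False esssup_non_measurable[of "\<lambda>x. ereal \<bar>f x\<bar>" "lebesgue_on \<Omega>"] by fastforce
  ultimately have "esssup (lebesgue_on \<Omega>) (\<lambda>x. ereal \<bar>f x\<bar>) = - \<infinity>"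
    by (rule esssup_zero_space)
  then show ?thesis by (simp add: Linf_norm_def)
qed

lemma Linf_AE:
  assumes "f \<in> Linf \<Omega>" shows "AE x in lebesgue_on \<Omega>. \<bar>f x\<bar> \<le> Linf_norm \<Omega> f"
proof -
  let ?e = "esssup (lebesgue_on \<Omega>) (\<lambda>x. ereal \<bar>f x\<bar>)"
  have "?e < \<infinity>" using assms by (simp add: Linf_def)
  moreover have "AE x in lebesgue_on \<Omega>. ereal \<bar>f x\<bar> \<le> ?e" by (rule esssup_AE)
  ultimately show ?thesis
    by (cases ?e) (auto simp: Linf_norm_def)
qed

lemma LinfI:
  assumes [measurable]: "f \<in> borel_measurable (lebesgue_on \<Omega>)" and "AE x in lebesgue_on \<Omega>. \<bar>f x\<bar> \<le> C"
  shows "f \<in> Linf \<Omega>"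
proof -
  have "esssup (lebesgue_on \<Omega>) (\<lambda>x. ereal \<bar>f x\<bar>) \<le> ereal C"
    using assms by (intro esssup_I) auto
  also have "\<dots> < \<infinity>" by simp
  finally show ?thesis by (simp add: Linf_def)
qed

lemma Linf_measurable: "f \<in> Linf \<Omega> \<Longrightarrow> f \<in> borel_measurable (lebesgue_on \<Omega>)"
  by (simp add: Linf_def)

lemma Linf_diff:
  assumes "f \<in> Linf \<Omega>" "g \<in> Linf \<Omega>" shows "(\<lambda>x. f x - g x) \<in> Linf \<Omega>"
proof (rule LinfI)
  show "AE x in lebesgue_on \<Omega>. \<bar>f x - g x\<bar> \<le> Linf_norm \<Omega> f + Linf_norm \<Omega> g"
    using Linf_AE[OF assms(1)] Linf_AE[OF assms(2)] by eventually_elim auto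
qed (intro borel_measurable_diff Linf_measurable assms)

section \<open>Weak divergences: uniqueness and restriction\<close>

lemma test_functions_derivative_outside:
  assumes "\<phi> \<in> test_functions K" "x \<notin> K"
  shows "frechet_derivative \<phi> (at x) = (\<lambda>_. 0)"
proof -
  obtain C where C: "compact C" "C \<subseteq> K" "\<And>x. x \<notin> C \<Longrightarrow> \<phi> x = 0"
    using assms(1) by (rule test_functionsE) blast
  show ?thesis
    by (rule frechet_derivative_zero_outside[of "- C"]) (use C assms in \<open>auto intro: compact_imp_closed\<close>)
qed

lemma integrable_loc_integrable_test:
  assumes U: "open U" and g: "loc_integrable U g" and \<phi>: "\<phi> \<in> test_functions U"
  shows "integrable (lebesgue_on U) (\<lambda>x. g x * \<phi> x)"
proof -
  obtain C where C: "compact C" "C \<subseteq> U" "\<And>x. x \<notin> C \<Longrightarrow> \<phi> x = 0"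
    using \<phi> by (rule test_functionsE) blast
  obtain B where B: "\<And>x. \<bar>\<phi> x\<bar> \<le> B" "B \<ge> 0" using test_functions_bounded[OF \<phi>] by blast
  have gi: "integrable lebesgue (\<lambda>x. indicator C x * g x)"
    using g C by (simp add: loc_integrable_def set_integrable_def)
  have [measurable]: "\<phi> \<in> borel_measurable lebesgue"
    using borel_measurable_continuous_onI[OF test_functions_continuous[OF \<phi>, of UNIV]]
    by (auto intro: measurable_completion)
  have "integrable lebesgue (\<lambda>x. \<phi> x * (indicator C x * g x))"
  proof (rule Bochner_Integration.integrable_bound)
    show "integrable lebesgue (\<lambda>x. B * (indicator C x * g x))"
      using gi by (rule integrable_mult_right)
    show "(\<lambda>x. \<phi> x * (indicator C x * g x)) \<in> borel_measurable lebesgue"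
      using borel_measurable_integrable[OF gi] by measurable
    show "AE x in lebesgue. norm (\<phi> x * (indicator C x * g x)) \<le> norm (B * (indicator C x * g x))"
    proof (rule AE_I2)
      fix x
      have "\<bar>\<phi> x\<bar> * \<bar>indicator C x * g x\<bar> \<le> \<bar>B\<bar> * \<bar>indicator C x * g x\<bar>"
        using B by (intro mult_right_mono) auto
      then show "norm (\<phi> x * (indicator C x * g x)) \<le> norm (B * (indicator C x * g x))"
        by (simp add: abs_mult)
    qed
  qed
  moreover have "(\<lambda>x. \<phi> x * (indicator C x * g x)) = (\<lambda>x. indicator U x *\<^sub>R (g x * \<phi> x))"
    using C by (force simp: fun_eq_iff indicator_def)
  ultimately show ?thesis using U by (simp add: integrable_restrict_space borel_open)
qed

lemma loc_integrable_subset: "loc_integrable \<Omega> f \<Longrightarrow> K \<subseteq> \<Omega> \<Longrightarrow> loc_integrable K f"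
  unfolding loc_integrable_def by blast

lemma has_weak_div_unique:
  assumes U: "open U" and "has_weak_div U F g" "has_weak_div U F h"
  shows "AE x in lebesgue_on U. g x = h x"
proof -
  have g: "loc_integrable U g" and h: "loc_integrable U h"
    using assms by (auto simp: has_weak_div_def)
  have "AE x in lebesgue_on U. g x - h x = 0"
  proof (rule fundamental_lemma_calculus_of_variations[OF U])
    show "loc_integrable U (\<lambda>x. g x - h x)"
      using g h by (simp add: loc_integrable_def set_integrable_def right_diff_distrib)
    show "(LINT x|lebesgue_on U. (g x - h x) * \<phi> x) = 0" if \<phi>: "\<phi> \<in> test_functions U" for \<phi>
      using assms \<phi> integrable_loc_integrable_test[OF U g \<phi>] integrable_loc_integrable_test[OF U h \<phi>]
      by (simp add: has_weak_div_def left_diff_distrib)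
  qed
  then show ?thesis by simp
qed

lemma has_weak_div_weak_div: "has_weak_div U F g \<Longrightarrow> has_weak_div U F (weak_div U F)"
  unfolding weak_div_def by (rule someI[of "has_weak_div U F"])

lemma integral_lebesgue_on_eq:
  fixes f :: "'a::euclidean_space \<Rightarrow> real"
  assumes "K \<in> sets lebesgue" "U \<in> sets lebesgue" "K \<subseteq> U" "\<And>x. x \<in> U - K \<Longrightarrow> f x = 0"
  shows "(LINT x|lebesgue_on K. f x) = (LINT x|lebesgue_on U. f x)"
proof -
  have "(\<lambda>x. indicator K x *\<^sub>R f x) = (\<lambda>x. indicator U x *\<^sub>R f x)"
    using assms(3,4) by (force simp: fun_eq_iff indicator_def)
  then show ?thesis using assms(1,2) by (simp add: integral_restrict_space)
qed

lemma has_weak_div_subset: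
  assumes op: "open K" "open U" and KU: "K \<subseteq> U" and F: "has_weak_div U F g"
  shows "has_weak_div K F g"
  unfolding has_weak_div_def
proof (intro conjI ballI)
  show "loc_integrable K F" "loc_integrable K g"
    using F KU by (auto simp: has_weak_div_def intro: loc_integrable_subset)
  fix \<phi> assume \<phi>: "\<phi> \<in> test_functions K"
  then have "\<phi> \<in> test_functions U" using test_functions_mono[OF KU] by blast
  then have "(LINT x|lebesgue_on U. frechet_derivative \<phi> (at x) (F x)) = - (LINT x|lebesgue_on U. g x * \<phi> x)"
    using F by (simp add: has_weak_div_def)
  moreover have "(LINT x|lebesgue_on K. frechet_derivative \<phi> (at x) (F x)) = (LINT x|lebesgue_on U. frechet_derivative \<phi> (at x) (F x))"
    using op KU by (intro integral_lebesgue_on_eq) (auto simp: borel_open test_functions_derivative_outside[OF \<phi>])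
  moreover have "(LINT x|lebesgue_on K. g x * \<phi> x) = (LINT x|lebesgue_on U. g x * \<phi> x)"
    using op KU by (intro integral_lebesgue_on_eq) (auto simp: borel_open test_functions_outside[OF \<phi>])
  ultimately show "(LINT x|lebesgue_on K. frechet_derivative \<phi> (at x) (F x)) = - (LINT x|lebesgue_on K. g x * \<phi> x)"
    by simp
qed

lemma has_weak_div_AE_cong:
  assumes U: "open U" and "has_weak_div U F g" "loc_integrable U h" "AE x in lebesgue_on U. g x = h x"
  shows "has_weak_div U F h"
  unfolding has_weak_div_def
proof (intro conjI ballI)
  fix \<phi> assume \<phi>: "\<phi> \<in> test_functions U"
  have g: "loc_integrable U g" using assms by (auto simp: has_weak_div_def)
  have "(LINT x|lebesgue_on U. g x * \<phi> x) = (LINT x|lebesgue_on U. h x * \<phi> x)"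
    using integrable_loc_integrable_test[OF U g \<phi>] integrable_loc_integrable_test[OF U assms(3) \<phi>] assms(4)
    by (intro integral_cong_AE) auto
  then show "(LINT x|lebesgue_on U. frechet_derivative \<phi> (at x) (F x)) = - (LINT x|lebesgue_on U. h x * \<phi> x)"
    using assms \<phi> by (auto simp: has_weak_div_def)
qed (use assms in \<open>auto simp: has_weak_div_def\<close>)

section \<open>Calculus along a bounded field\<close>

locale transport =
  fixes \<Omega> :: "'a::euclidean_space set" and b :: "'a \<Rightarrow> 'a" and B :: real
  assumes open_\<Omega>: "open \<Omega>" and bounded_\<Omega>: "bounded \<Omega>"
    and b_meas: "b \<in> borel_measurable (lebesgue_on \<Omega>)"
    and b_bound: "AE x in lebesgue_on \<Omega>. norm (b x) \<le> B"
    and ex_div: "\<exists>d\<in>Linf \<Omega>. has_weak_div \<Omega> b d"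
begin

abbreviation "M \<equiv> lebesgue_on \<Omega>"
abbreviation "d \<equiv> weak_div \<Omega> b"

lemma \<Omega>_meas [simp, measurable]: "\<Omega> \<in> sets lebesgue"
  using open_\<Omega> by (simp add: borel_open)

sublocale finite_measure M
proof
  have "emeasure lebesgue \<Omega> < \<infinity>"
    using bounded_\<Omega> by (intro fmeasurableD2[THEN top.not_eq_extremum[THEN iffD1], unfolded infinity_ennreal_def[symmetric]])
      (simp add: bounded_set_imp_lmeasurable)
  then show "emeasure M (space M) \<noteq> \<infinity>"
    by (simp add: space_restrict_space emeasure_restrict_space)
qed

lemma has_div: "has_weak_div \<Omega> b d"
  using ex_div has_weak_div_weak_div by blast

text \<open>\<open>weak_div\<close> chooses some divergence, not necessarily the bounded one of the
  hypothesis; uniqueness almost everywhere transfers the bound.\<close>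

lemma d_Linf: "d \<in> Linf \<Omega>"
proof -
  obtain \<delta> where \<delta>: "\<delta> \<in> Linf \<Omega>" "has_weak_div \<Omega> b \<delta>" using ex_div by blast
  have "AE x in M. d x = \<delta> x" by (rule has_weak_div_unique[OF open_\<Omega> has_div \<delta>(2)])
  then have "AE x in M. \<bar>d x\<bar> \<le> Linf_norm \<Omega> \<delta>"
    using Linf_AE[OF \<delta>(1)] by eventually_elim simp
  moreover have "d \<in> borel_measurable M"
    using has_div by (intro loc_integrable_measurable[OF open_\<Omega>]) (simp add: has_weak_div_def)
  ultimately show ?thesis by (intro LinfI)
qed

lemma d_meas [measurable]: "d \<in> borel_measurable M"
  using d_Linf by (rule Linf_measurable)

lemma sq_Linf_mult: "f \<in> Linf \<Omega> \<Longrightarrow> v \<in> square_integrable M \<Longrightarrow> (\<lambda>x. f x * v x) \<in> square_integrable M"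
  by (rule square_integrable_bounded_mult(1)[OF _ Linf_measurable Linf_AE])

definition pd :: "('a \<Rightarrow> real) \<Rightarrow> 'a \<Rightarrow> real" where
  "pd \<phi> x = frechet_derivative \<phi> (at x) (b x)"

lemma test_meas: "\<phi> \<in> test_functions K \<Longrightarrow> \<phi> \<in> borel_measurable M"
  using borel_measurable_continuous_onI[OF test_functions_continuous[of \<phi> K UNIV]]
  by (auto intro!: measurable_restrict_space1 measurable_completion)

lemma test_sq: "\<phi> \<in> test_functions K \<Longrightarrow> \<phi> \<in> square_integrable M"
  using test_functions_bounded[of \<phi> K] by (metis AE_I2 square_integrable_bounded test_meas)

lemma pd_meas:
  assumes \<phi>: "\<phi> \<in> test_functions K" shows "pd \<phi> \<in> borel_measurable M"
proof -
  have "(\<lambda>x. frechet_derivative \<phi> (at x) i) \<in> borel_measurable M" if "i \<in> Basis" for i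
    using borel_measurable_continuous_onI[OF test_functions_partial_continuous[OF \<phi> that]]
    by (auto intro!: measurable_restrict_space1 measurable_completion)
  moreover have "pd \<phi> = (\<lambda>x. \<Sum>i\<in>Basis. (b x \<bullet> i) * frechet_derivative \<phi> (at x) i)"
    unfolding pd_def by (rule ext) (rule test_functions_derivative_sum[OF \<phi>])
  ultimately show ?thesis using b_meas by (auto intro!: borel_measurable_sum borel_measurable_times)
qed

lemma pd_bounded:
  assumes \<phi>: "\<phi> \<in> test_functions K" obtains C where "AE x in M. \<bar>pd \<phi> x\<bar> \<le> C"
proof -
  obtain C where C: "\<And>x v. \<bar>frechet_derivative \<phi> (at x) v\<bar> \<le> C * norm v" "C \<ge> 0"
    using test_functions_derivative_bounded[OF \<phi>] by blast
  have "AE x in M. \<bar>pd \<phi> x\<bar> \<le> C * B"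
    using b_bound
  proof eventually_elim
    case (elim x)
    have "\<bar>pd \<phi> x\<bar> \<le> C * norm (b x)" unfolding pd_def by (rule C(1))
    also have "\<dots> \<le> C * B" using elim C(2) by (rule mult_left_mono)
    finally show ?case .
  qed
  then show ?thesis by (rule that)
qed

lemma pd_sq: "\<phi> \<in> test_functions K \<Longrightarrow> pd \<phi> \<in> square_integrable M"
  by (metis pd_bounded pd_meas square_integrable_bounded)

lemma pd_mult:
  assumes "\<phi> \<in> test_functions K" "\<psi> \<in> test_functions K'"
  shows "pd (\<lambda>x. \<phi> x * \<psi> x) x = \<phi> x * pd \<psi> x + pd \<phi> x * \<psi> x"
  unfolding pd_def by (rule frechet_derivative_mult) (use assms test_functions_C_k in blast)+

lemma pd_outside: "\<phi> \<in> test_functions K \<Longrightarrow> x \<notin> K \<Longrightarrow> pd \<phi> x = 0"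
  by (simp add: pd_def test_functions_derivative_outside)

text \<open>\<open>adj \<phi>\<close> is the divergence of \<open>\<phi> b\<close>. In \<open>weak \<K> v h\<close>, the function \<open>h\<close> is the derivative of \<open>v\<close>
  along \<open>b\<close> on each cell; the integrals extend over \<open>\<Omega>\<close>, as test functions vanish off their cell.\<close>

definition adj :: "('a \<Rightarrow> real) \<Rightarrow> 'a \<Rightarrow> real" where "adj \<phi> x = pd \<phi> x + d x * \<phi> x"

lemma adj_sq: "\<phi> \<in> test_functions K \<Longrightarrow> adj \<phi> \<in> square_integrable M"
  unfolding adj_def[abs_def] by (intro square_integrable_add pd_sq sq_Linf_mult d_Linf test_sq)

definition weak :: "'a set set \<Rightarrow> ('a \<Rightarrow> real) \<Rightarrow> ('a \<Rightarrow> real) \<Rightarrow> bool" where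
  "weak \<K> v h \<longleftrightarrow> v \<in> square_integrable M \<and> h \<in> square_integrable M \<and>
     (\<forall>K\<in>\<K>. \<forall>\<phi>\<in>test_functions K. (LINT x|M. v x * adj \<phi> x) + (LINT x|M. h x * \<phi> x) = 0)"

text \<open>Local integrability holds as \<open>v b\<close> and \<open>h + v d\<close> are
  integrable over the bounded set \<open>\<Omega>\<close>. The term \<open>v d\<close> moves from
  the divergence into \<open>adj \<phi>\<close>, which leaves \<open>h\<close> as the derivative
  along \<open>b\<close>.\<close>

lemma has_weak_div_iff:
  assumes K: "open K" "K \<subseteq> \<Omega>" and v: "v \<in> square_integrable M" and h: "h \<in> square_integrable M"
  shows "has_weak_div K (\<lambda>x. v x *\<^sub>R b x) (\<lambda>x. h x + v x * d x) \<longleftrightarrow>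
    (\<forall>\<phi>\<in>test_functions K. (LINT x|M. v x * adj \<phi> x) + (LINT x|M. h x * \<phi> x) = 0)"
proof -
  have [measurable]: "v \<in> borel_measurable M" using v by (rule square_integrable_measurable)
  have vi: "integrable M v" using v by (rule square_integrable_integrable)
  have "integrable M (\<lambda>x. v x *\<^sub>R b x)"
  proof (rule Bochner_Integration.integrable_bound)
    show "integrable M (\<lambda>x. B * v x)" using vi by simp
    show "AE x in M. norm (v x *\<^sub>R b x) \<le> norm (B * v x)"
      using b_bound
    proof eventually_elim
      case (elim x)
      have "norm (b x) * \<bar>v x\<bar> \<le> \<bar>B\<bar> * \<bar>v x\<bar>" using elim by (intro mult_right_mono) auto
      then show ?case by (simp add: abs_mult mult.commute)
    qed
  qed (use b_meas in measurable)
  then have 1: "loc_integrable K (\<lambda>x. v x *\<^sub>R b x)"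
    by (rule loc_integrable_subset[OF integrable_imp_loc_integrable[OF \<Omega>_meas] K(2)])
  have hs: "(\<lambda>x. h x + v x * d x) \<in> square_integrable M"
    using square_integrable_add[OF h sq_Linf_mult[OF d_Linf v]] by (simp add: mult.commute)
  then have 2: "loc_integrable K (\<lambda>x. h x + v x * d x)"
    by (rule loc_integrable_subset[OF integrable_imp_loc_integrable[OF \<Omega>_meas
            square_integrable_integrable] K(2)])
  have "((LINT x|lebesgue_on K. frechet_derivative \<phi> (at x) (v x *\<^sub>R b x))
        = - (LINT x|lebesgue_on K. (h x + v x * d x) * \<phi> x)) \<longleftrightarrow>
      ((LINT x|M. v x * adj \<phi> x) + (LINT x|M. h x * \<phi> x) = 0)"
    if \<phi>: "\<phi> \<in> test_functions K" for \<phi>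
  proof -
    have "(LINT x|lebesgue_on K. frechet_derivative \<phi> (at x) (v x *\<^sub>R b x)) = (LINT x|lebesgue_on K. v x * pd \<phi> x)"
      by (simp add: test_functions_derivative_scaleR[OF \<phi>] pd_def)
    also have "\<dots> = (LINT x|M. v x * pd \<phi> x)"
      using K by (intro integral_lebesgue_on_eq) (auto simp: borel_open pd_outside[OF \<phi>])
    finally have i1: "(LINT x|lebesgue_on K. frechet_derivative \<phi> (at x) (v x *\<^sub>R b x)) = (LINT x|M. v x * pd \<phi> x)" .
    have i2: "(LINT x|lebesgue_on K. (h x + v x * d x) * \<phi> x) = (LINT x|M. (h x + v x * d x) * \<phi> x)"
      using K by (intro integral_lebesgue_on_eq) (auto simp: borel_open test_functions_outside[OF \<phi>])
    have "(LINT x|M. v x * adj \<phi> x) + (LINT x|M. h x * \<phi> x) = (LINT x|M. v x * adj \<phi> x + h x * \<phi> x)"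
      using v h adj_sq[OF \<phi>] test_sq[OF \<phi>]
      by (simp add: integrable_mult_square_integrable)
    also have "\<dots> = (LINT x|M. v x * pd \<phi> x + (h x + v x * d x) * \<phi> x)"
      by (simp add: adj_def algebra_simps)
    also have "\<dots> = (LINT x|M. v x * pd \<phi> x) + (LINT x|M. (h x + v x * d x) * \<phi> x)"
      using v hs pd_sq[OF \<phi>] test_sq[OF \<phi>]
      by (intro Bochner_Integration.integral_add integrable_mult_square_integrable)
    finally show ?thesis unfolding i1 i2 by auto
  qed
  then show ?thesis using 1 2 by (auto simp: has_weak_div_def)
qed

lemma weakD:
  assumes "weak \<K> v h"
  shows "v \<in> square_integrable M" "h \<in> square_integrable M"
    "K \<in> \<K> \<Longrightarrow> \<phi> \<in> test_functions K \<Longrightarrow> (LINT x|M. v x * adj \<phi> x) + (LINT x|M. h x * \<phi> x) = 0"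
  using assms by (auto simp: weak_def)

lemma weak_add:
  assumes vh: "weak \<K> v h" and wk: "weak \<K> w k"
  shows "weak \<K> (\<lambda>x. v x + w x) (\<lambda>x. h x + k x)"
  unfolding weak_def
proof (intro conjI ballI square_integrable_add weakD(1,2)[OF vh] weakD(1,2)[OF wk])
  fix K \<phi> assume K: "K \<in> \<K>" and \<phi>: "\<phi> \<in> test_functions K"
  show "(LINT x|M. (v x + w x) * adj \<phi> x) + (LINT x|M. (h x + k x) * \<phi> x) = 0"
    using weakD[OF vh] weakD[OF wk] weakD(3)[OF vh K \<phi>] weakD(3)[OF wk K \<phi>] adj_sq[OF \<phi>] test_sq[OF \<phi>]
    by (simp add: distrib_right integrable_mult_square_integrable)
qed

lemma weak_scale: "weak \<K> v h \<Longrightarrow> weak \<K> (\<lambda>x. r * v x) (\<lambda>x. r * h x)"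
  unfolding weak_def
  by (auto simp: square_integrable_scale mult.assoc simp flip: distrib_left)

lemma weak_diff: "weak \<K> v h \<Longrightarrow> weak \<K> w k \<Longrightarrow> weak \<K> (\<lambda>x. v x - w x) (\<lambda>x. h x - k x)"
  using weak_add[of \<K> v h "\<lambda>x. (-1) * w x" "\<lambda>x. (-1) * k x"] weak_scale[of \<K> w k "-1"] by simp

lemma weak_zero: "weak \<K> (\<lambda>x. 0) (\<lambda>x. 0)"
  by (simp add: weak_def L2.zero)

lemma weak_AE:
  assumes "weak \<K> v h" "v' \<in> borel_measurable M" "AE x in M. v x = v' x"
    "h' \<in> borel_measurable M" "AE x in M. h x = h' x"
  shows "weak \<K> v' h'"
  unfolding weak_def
proof (intro conjI ballI)
  have vh: "v \<in> square_integrable M" "h \<in> square_integrable M" using assms by (auto simp: weak_def)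
  note [measurable] = vh[THEN square_integrable_measurable] assms(2,4)
  show "v' \<in> square_integrable M" "h' \<in> square_integrable M"
    using square_integrable_AE vh assms by blast+
  fix K \<phi> assume K: "K \<in> \<K>" and \<phi>: "\<phi> \<in> test_functions K"
  have [measurable]: "adj \<phi> \<in> borel_measurable M" "\<phi> \<in> borel_measurable M"
    using adj_sq[OF \<phi>] test_sq[OF \<phi>] by (auto intro: square_integrable_measurable)
  have "(LINT x|M. v x * adj \<phi> x) = (LINT x|M. v' x * adj \<phi> x)"
    "(LINT x|M. h x * \<phi> x) = (LINT x|M. h' x * \<phi> x)"
    using assms(3,5) by (intro integral_cong_AE; force)+
  then show "(LINT x|M. v' x * adj \<phi> x) + (LINT x|M. h' x * \<phi> x) = 0"
    using weakD(3)[OF assms(1) K \<phi>] by simp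
qed

text \<open>For a fixed test function both sides are continuous in \<open>L2\<close>. This
  closedness of the derivative is what makes the graph spaces complete.\<close>

lemma weak_limit:
  assumes w: "\<And>n. weak \<K> (v n) (h n)" and l: "l \<in> square_integrable M" "k \<in> square_integrable M"
    and vl: "(\<lambda>n. l2norm M (\<lambda>x. v n x - l x)) \<longlonglongrightarrow> 0"
    and hk: "(\<lambda>n. l2norm M (\<lambda>x. h n x - k x)) \<longlonglongrightarrow> 0"
  shows "weak \<K> l k"
  unfolding weak_def
proof (intro conjI ballI l)
  fix K \<phi> assume K: "K \<in> \<K>" and \<phi>: "\<phi> \<in> test_functions K"
  have sq: "v n \<in> square_integrable M" "h n \<in> square_integrable M" for n
    using w by (auto simp: weak_def)
  have "(\<lambda>n. (LINT x|M. v n x * adj \<phi> x) + (LINT x|M. h n x * \<phi> x))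
      \<longlonglongrightarrow> (LINT x|M. l x * adj \<phi> x) + (LINT x|M. k x * \<phi> x)"
    by (intro tendsto_add L2.tendsto_ip) (simp_all add: sq l vl hk adj_sq[OF \<phi>] test_sq[OF \<phi>] L2.nrm_zero)
  moreover have "(LINT x|M. v n x * adj \<phi> x) + (LINT x|M. h n x * \<phi> x) = 0" for n
    using w[of n] K \<phi> by (auto simp: weak_def)
  ultimately show "(LINT x|M. l x * adj \<phi> x) + (LINT x|M. k x * \<phi> x) = 0"
    by (simp add: LIMSEQ_const_iff)
qed

text \<open>The product of two test functions is again one, so that the identity that defines
  \<open>d\<close> can be tested with \<open>\<phi> \<psi>\<close>.\<close>

lemma weak_test:
  assumes \<phi>: "\<phi> \<in> test_functions \<Omega>" shows "weak {\<Omega>} \<phi> (pd \<phi>)"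
  unfolding weak_def
proof (intro conjI ballI test_sq[OF \<phi>] pd_sq[OF \<phi>])
  fix K \<psi> assume "K \<in> {\<Omega>}" and "\<psi> \<in> test_functions K"
  then have \<psi>: "\<psi> \<in> test_functions \<Omega>" by simp
  have \<phi>\<psi>: "(\<lambda>x. \<phi> x * \<psi> x) \<in> test_functions \<Omega>"
    by (rule test_functions_mult[OF \<phi> test_functions_C_k[OF \<psi>]])
  have "(LINT x|M. \<phi> x * adj \<psi> x) + (LINT x|M. pd \<phi> x * \<psi> x) = (LINT x|M. \<phi> x * adj \<psi> x + pd \<phi> x * \<psi> x)"
    using adj_sq[OF \<psi>] test_sq[OF \<phi>] test_sq[OF \<psi>] pd_sq[OF \<phi>]
    by (simp add: integrable_mult_square_integrable)
  also have "\<dots> = (LINT x|M. pd (\<lambda>x. \<phi> x * \<psi> x) x + d x * (\<phi> x * \<psi> x))"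
    unfolding adj_def pd_mult[OF \<phi> \<psi>] by (simp add: algebra_simps)
  also have "\<dots> = (LINT x|M. pd (\<lambda>x. \<phi> x * \<psi> x) x) + (LINT x|M. d x * (\<phi> x * \<psi> x))"
    by (intro Bochner_Integration.integral_add square_integrable_integrable pd_sq[OF \<phi>\<psi>]
        sq_Linf_mult d_Linf test_sq[OF \<phi>\<psi>])
  also have "\<dots> = 0"
    using has_div \<phi>\<psi> by (simp add: has_weak_div_def pd_def)
  finally show "(LINT x|M. \<phi> x * adj \<psi> x) + (LINT x|M. pd \<phi> x * \<psi> x) = 0" .
qed

text \<open>A smooth factor can be moved to the test function. This simple case of the product rule
  is the starting point for the case of two nonsmooth factors in \<open>weak_mult\<close>.\<close>

lemma weak_test_mult:
  assumes w: "weak {\<Omega>} u h" and \<zeta>: "\<zeta> \<in> test_functions \<Omega>"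
  shows "weak {\<Omega>} (\<lambda>x. \<zeta> x * u x) (\<lambda>x. \<zeta> x * h x + pd \<zeta> x * u x)"
  unfolding weak_def
proof (intro conjI ballI)
  have u: "u \<in> square_integrable M" and h: "h \<in> square_integrable M" using w by (auto simp: weak_def)
  obtain C where C: "\<And>x. \<bar>\<zeta> x\<bar> \<le> C" "C \<ge> 0" using test_functions_bounded[OF \<zeta>] by blast
  obtain C' where C': "AE x in M. \<bar>pd \<zeta> x\<bar> \<le> C'" using pd_bounded[OF \<zeta>] by blast
  show 1: "(\<lambda>x. \<zeta> x * u x) \<in> square_integrable M"
    by (rule square_integrable_bounded_mult(1)[OF u test_meas[OF \<zeta>]]) (use C in auto)
  have 2: "(\<lambda>x. \<zeta> x * h x) \<in> square_integrable M"
    by (rule square_integrable_bounded_mult(1)[OF h test_meas[OF \<zeta>]]) (use C in auto)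
  have 3: "(\<lambda>x. pd \<zeta> x * u x) \<in> square_integrable M"
    by (rule square_integrable_bounded_mult(1)[OF u pd_meas[OF \<zeta>] C'])
  show 4: "(\<lambda>x. \<zeta> x * h x + pd \<zeta> x * u x) \<in> square_integrable M"
    using 2 3 by (rule square_integrable_add)
  fix K \<psi> assume "K \<in> {\<Omega>}" and "\<psi> \<in> test_functions K"
  then have \<psi>: "\<psi> \<in> test_functions \<Omega>" by simp
  have \<zeta>\<psi>: "(\<lambda>x. \<zeta> x * \<psi> x) \<in> test_functions \<Omega>"
    by (rule test_functions_mult[OF \<zeta> test_functions_C_k[OF \<psi>]])
  have "(LINT x|M. \<zeta> x * u x * adj \<psi> x) + (LINT x|M. (\<zeta> x * h x + pd \<zeta> x * u x) * \<psi> x)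
      = (LINT x|M. \<zeta> x * u x * adj \<psi> x + (\<zeta> x * h x + pd \<zeta> x * u x) * \<psi> x)"
    by (rule Bochner_Integration.integral_add[symmetric])
      (intro integrable_mult_square_integrable 1 4 adj_sq[OF \<psi>] test_sq[OF \<psi>])+
  also have "\<dots> = (LINT x|M. u x * adj (\<lambda>x. \<zeta> x * \<psi> x) x + h x * (\<zeta> x * \<psi> x))"
    unfolding adj_def pd_mult[OF \<zeta> \<psi>] by (simp add: algebra_simps)
  also have "\<dots> = (LINT x|M. u x * adj (\<lambda>x. \<zeta> x * \<psi> x) x) + (LINT x|M. h x * (\<zeta> x * \<psi> x))"
    by (intro Bochner_Integration.integral_add integrable_mult_square_integrable u h adj_sq[OF \<zeta>\<psi>] test_sq[OF \<zeta>\<psi>])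
  also have "\<dots> = 0" using w \<zeta>\<psi> by (simp add: weak_def)
  finally show "(LINT x|M. \<zeta> x * u x * adj \<psi> x) + (LINT x|M. (\<zeta> x * h x + pd \<zeta> x * u x) * \<psi> x) = 0" .
qed

end

section \<open>Broken spaces\<close>

context transport begin

definition mesh :: "'a set set \<Rightarrow> bool" where
  "mesh \<K> \<longleftrightarrow> finite \<K> \<and> disjoint \<K> \<and> (\<forall>K\<in>\<K>. open K \<and> K \<subseteq> \<Omega>) \<and> negligible (\<Omega> - \<Union>\<K>)"

lemma mesh_single: "mesh {\<Omega>}"
  by (simp add: mesh_def open_\<Omega>)

lemma mesh_cell: "mesh \<K> \<Longrightarrow> K \<in> \<K> \<Longrightarrow> open K \<and> K \<subseteq> \<Omega> \<and> K \<in> sets lebesgue"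
  by (auto simp: mesh_def borel_open)

lemma mesh_AE_covered:
  assumes "mesh \<K>" shows "AE x in M. x \<in> \<Union>\<K>"
proof -
  have "\<Omega> - \<Union>\<K> \<in> null_sets lebesgue" using assms by (simp add: mesh_def negligible_iff_null_sets)
  then have "AE x in lebesgue. x \<notin> \<Omega> - \<Union>\<K>" by (rule AE_not_in)
  then show ?thesis by (subst AE_restrict_space_iff) (auto elim!: eventually_mono)
qed

lemma mesh_AE:
  assumes m: "mesh \<K>" and P: "\<And>K. K \<in> \<K> \<Longrightarrow> AE x in lebesgue_on K. P x"
  shows "AE x in M. P x"
proof -
  have "AE x in lebesgue. \<forall>K\<in>\<K>. x \<in> K \<longrightarrow> P x"
  proof (rule AE_finite_allI)
    show "finite \<K>" using m by (simp add: mesh_def)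
    show "AE x in lebesgue. x \<in> K \<longrightarrow> P x" if "K \<in> \<K>" for K
      using P[OF that] mesh_cell[OF m that] by (subst (asm) AE_restrict_space_iff) auto
  qed
  then have "AE x in M. \<forall>K\<in>\<K>. x \<in> K \<longrightarrow> P x"
    by (subst AE_restrict_space_iff) (auto elim!: eventually_mono)
  then show ?thesis using mesh_AE_covered[OF m] by eventually_elim blast
qed

lemma bgrad_h_cell:
  assumes m: "mesh \<K>" and K: "K \<in> \<K>" and x: "x \<in> K"
  shows "bgrad_h \<K> b v x = bgrad K b v x"
proof -
  have "(\<Sum>K'\<in>\<K>. indicator K' x * bgrad K' b v x) = (\<Sum>K'\<in>{K}. indicator K' x * bgrad K' b v x)"
  proof (rule sum.mono_neutral_right)
    show "finite \<K>" using m by (simp add: mesh_def)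
    show "\<forall>K'\<in>\<K> - {K}. indicator K' x * bgrad K' b v x = 0"
      using m K x by (auto simp: mesh_def disjoint_def indicator_def)
  qed (use K in auto)
  then show ?thesis using x by (simp add: bgrad_h_def)
qed

lemma weak_div_cell:
  assumes "mesh \<K>" "K \<in> \<K>"
  shows "AE x in lebesgue_on K. weak_div K b x = d x"
proof -
  have "has_weak_div K b d"
    using mesh_cell[OF assms] open_\<Omega> has_div by (auto intro: has_weak_div_subset)
  then show ?thesis
    using has_weak_div_unique has_weak_div_weak_div mesh_cell[OF assms] by blast
qed

lemma Hh_imp_weak:
  assumes m: "mesh \<K>" and v: "v \<in> ns_elems (Hh_space \<Omega> \<K> b)"
  shows "weak \<K> v (bgrad_h \<K> b v)"
proof -
  have sq: "v \<in> square_integrable M" "bgrad_h \<K> b v \<in> square_integrable M"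
    using v by (auto simp: Hh_space_def L2_eq_square_integrable)
  have "has_weak_div K (\<lambda>x. v x *\<^sub>R b x) (\<lambda>x. bgrad_h \<K> b v x + v x * d x)" if K: "K \<in> \<K>" for K
  proof -
    have Ko: "open K" "K \<subseteq> \<Omega>" using mesh_cell[OF m K] by auto
    have "has_weak_div K (\<lambda>x. v x *\<^sub>R b x) (weak_div K (\<lambda>x. v x *\<^sub>R b x))"
      using v K by (auto simp: Hh_space_def has_bgrad_def intro: has_weak_div_weak_div)
    then show ?thesis
    proof (rule has_weak_div_AE_cong[OF Ko(1)])
      have "(\<lambda>x. bgrad_h \<K> b v x + v x * d x) \<in> square_integrable M"
        using square_integrable_add[OF sq(2) sq_Linf_mult[OF d_Linf sq(1)]] by (simp add: mult.commute)
      then show "loc_integrable K (\<lambda>x. bgrad_h \<K> b v x + v x * d x)"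
        by (rule loc_integrable_subset[OF integrable_imp_loc_integrable[OF \<Omega>_meas
            square_integrable_integrable] Ko(2)])
      have "AE x in lebesgue_on K. x \<in> K" by (rule AE_I2) (simp add: space_restrict_space)
      then show "AE x in lebesgue_on K. weak_div K (\<lambda>x. v x *\<^sub>R b x) x = bgrad_h \<K> b v x + v x * d x"
        using weak_div_cell[OF m K]
        by eventually_elim (simp add: bgrad_h_cell[OF m K] bgrad_def)
    qed
  qed
  then show ?thesis
    using has_weak_div_iff[OF _ _ sq] mesh_cell[OF m] sq unfolding weak_def by blast
qed

text \<open>Converse of \<open>Hh_imp_weak\<close>. Together they remove the choice in
  \<open>weak_div\<close>: calculations are done with pairs related by \<open>weak\<close>, where
  any representative of the derivative will do.\<close>

lemma weak_imp_Hh: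
  assumes m: "mesh \<K>" and w: "weak \<K> v h"
  shows "v \<in> ns_elems (Hh_space \<Omega> \<K> b)" "AE x in M. bgrad_h \<K> b v x = h x"
proof -
  have sq: "v \<in> square_integrable M" "h \<in> square_integrable M" using weakD[OF w] by auto
  have wd: "has_weak_div K (\<lambda>x. v x *\<^sub>R b x) (\<lambda>x. h x + v x * d x)" if "K \<in> \<K>" for K
    using has_weak_div_iff[OF _ _ sq] mesh_cell[OF m that] weakD(3)[OF w that] by blast
  have bg: "AE x in lebesgue_on K. bgrad_h \<K> b v x = h x" if K: "K \<in> \<K>" for K
  proof -
    have "open K" using mesh_cell[OF m K] by blast
    then have "AE x in lebesgue_on K. weak_div K (\<lambda>x. v x *\<^sub>R b x) x = h x + v x * d x"
      using has_weak_div_unique has_weak_div_weak_div wd[OF K] by blast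
    moreover have "AE x in lebesgue_on K. x \<in> K" by (rule AE_I2) (simp add: space_restrict_space)
    ultimately show ?thesis using weak_div_cell[OF m K]
      by eventually_elim (simp add: bgrad_h_cell[OF m K] bgrad_def)
  qed
  show ae: "AE x in M. bgrad_h \<K> b v x = h x" by (rule mesh_AE[OF m bg])
  \<comment> \<open>Almost everywhere equality with \<open>h\<close> is used for integrability
    below; measurability is taken cell by cell from the local integrability of the chosen
    divergences.\<close>
  have "bgrad_h \<K> b v \<in> borel_measurable M"
    unfolding bgrad_h_def[abs_def]
  proof (rule borel_measurable_sum)
    fix K assume K: "K \<in> \<K>"
    have Ko: "open K" "K \<subseteq> \<Omega>" "K \<in> sets lebesgue" using mesh_cell[OF m K] by auto
    have "weak_div K (\<lambda>x. v x *\<^sub>R b x) \<in> borel_measurable (lebesgue_on K)"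
      using has_weak_div_weak_div[OF wd[OF K]]
      by (intro loc_integrable_measurable[OF Ko(1)]) (simp add: has_weak_div_def)
    moreover have "weak_div K b \<in> borel_measurable (lebesgue_on K)"
      using has_weak_div_weak_div[OF has_weak_div_subset[OF Ko(1) open_\<Omega> Ko(2) has_div]]
      by (intro loc_integrable_measurable[OF Ko(1)]) (simp add: has_weak_div_def)
    moreover have "v \<in> borel_measurable (lebesgue_on K)"
      using square_integrable_measurable[OF sq(1)] Ko measurable_restrict_mono by blast
    ultimately have "bgrad K b v \<in> borel_measurable (lebesgue_on K)"
      unfolding bgrad_def[abs_def]
      by (intro borel_measurable_diff borel_measurable_times)
    then have "(\<lambda>x. indicator K x *\<^sub>R bgrad K b v x) \<in> borel_measurable lebesgue"
      using Ko(3) by (simp add: borel_measurable_restrict_space_iff)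
    then show "(\<lambda>x. indicator K x * bgrad K b v x) \<in> borel_measurable M"
      by (auto intro: measurable_restrict_space1)
  qed
  then have "bgrad_h \<K> b v \<in> square_integrable M"
    by (rule square_integrable_AE[OF sq(2)]) (use ae in \<open>auto elim: eventually_mono\<close>)
  then show "v \<in> ns_elems (Hh_space \<Omega> \<K> b)"
    using sq wd by (auto simp: Hh_space_def L2_eq_square_integrable has_bgrad_def)
qed

lemma graph_space_Hh:
  assumes m: "mesh \<K>"
  shows "graph_space M (ns_elems (Hh_space \<Omega> \<K> b)) (bgrad_h \<K> b)"
proof
  show "(\<lambda>x. 0) \<in> ns_elems (Hh_space \<Omega> \<K> b)" by (rule weak_imp_Hh(1)[OF m weak_zero])
next
  fix f g r assume f: "f \<in> ns_elems (Hh_space \<Omega> \<K> b)"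
  note wf = Hh_imp_weak[OF m f]
  show "f \<in> square_integrable M" "bgrad_h \<K> b f \<in> square_integrable M"
    using weakD[OF wf] by auto
  show "(\<lambda>x. r * f x) \<in> ns_elems (Hh_space \<Omega> \<K> b)"
    "AE x in M. bgrad_h \<K> b (\<lambda>x. r * f x) x = r * bgrad_h \<K> b f x"
    using weak_imp_Hh[OF m weak_scale[OF wf]] by auto
  assume g: "g \<in> ns_elems (Hh_space \<Omega> \<K> b)"
  note wg = Hh_imp_weak[OF m g]
  show "(\<lambda>x. f x + g x) \<in> ns_elems (Hh_space \<Omega> \<K> b)"
    "AE x in M. bgrad_h \<K> b (\<lambda>x. f x + g x) x = bgrad_h \<K> b f x + bgrad_h \<K> b g x"
    using weak_imp_Hh[OF m weak_add[OF wf wg]] by auto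
qed

text \<open>A Cauchy sequence and its derivatives converge separately in \<open>L2\<close>, and
  closedness identifies the second limit as the derivative of the first.\<close>

lemma semi_hilbert_Hh:
  assumes m: "mesh \<K>"
  shows "semi_hilbert_space (ns_elems (Hh_space \<Omega> \<K> b)) (graph_space.gip M (bgrad_h \<K> b))"
proof -
  let ?D = "bgrad_h \<K> b"
  interpret G: graph_space M "ns_elems (Hh_space \<Omega> \<K> b)" ?D by (rule graph_space_Hh[OF m])
  show ?thesis
  proof
    fix u :: "nat \<Rightarrow> 'a \<Rightarrow> real" assume u: "\<And>n. u n \<in> ns_elems (Hh_space \<Omega> \<K> b)"
      and cauchy: "\<And>e. e > 0 \<Longrightarrow> \<exists>N. \<forall>m\<ge>N. \<forall>n\<ge>N. G.gip (\<lambda>x. u m x - u n x) (\<lambda>x. u m x - u n x) < e"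
    have usq: "u n \<in> square_integrable M" "?D (u n) \<in> square_integrable M" for n
      using u by (auto intro: G.S_sq G.D_sq)
    have D_meas: "?D f \<in> borel_measurable M" if "f \<in> ns_elems (Hh_space \<Omega> \<K> b)" for f
      by (rule square_integrable_measurable[OF G.D_sq[OF that]])
    have D_diff_int: "(LINT x|M. ?D (\<lambda>x. f x - g x) x * ?D (\<lambda>x. f x - g x) x)
        = (LINT x|M. (?D f x - ?D g x) * (?D f x - ?D g x))"
      if "f \<in> ns_elems (Hh_space \<Omega> \<K> b)" "g \<in> ns_elems (Hh_space \<Omega> \<K> b)" for f g
    proof (rule integral_cong_AE)
      show "AE x in M. ?D (\<lambda>x. f x - g x) x * ?D (\<lambda>x. f x - g x) x = (?D f x - ?D g x) * (?D f x - ?D g x)"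
        using G.D_diff[OF that] by eventually_elim simp
    qed (intro borel_measurable_times borel_measurable_diff D_meas G.diff that)+
    have le: "(LINT x|M. (u m x - u n x) * (u m x - u n x)) \<le> G.gip (\<lambda>x. u m x - u n x) (\<lambda>x. u m x - u n x)"
      "(LINT x|M. (?D (u m) x - ?D (u n) x) * (?D (u m) x - ?D (u n) x)) \<le> G.gip (\<lambda>x. u m x - u n x) (\<lambda>x. u m x - u n x)" for m n
      unfolding G.gip_def D_diff_int[OF u u] by auto
    have cauchy1: "\<exists>N. \<forall>m\<ge>N. \<forall>n\<ge>N. (LINT x|M. (u m x - u n x) * (u m x - u n x)) < e" if e: "e > 0" for e
    proof -
      obtain N where N: "\<And>m n. m \<ge> N \<Longrightarrow> n \<ge> N \<Longrightarrow> G.gip (\<lambda>x. u m x - u n x) (\<lambda>x. u m x - u n x) < e"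
        using cauchy[OF e] by blast
      show ?thesis by (intro exI[of _ N] allI impI le_less_trans[OF le(1) N])
    qed
    obtain l where l: "l \<in> square_integrable M" "(\<lambda>n. LINT x|M. (u n x - l x) * (u n x - l x)) \<longlonglongrightarrow> 0"
      using bexE[OF square_integrable_complete[OF usq(1) cauchy1]] by blast
    have cauchy2: "\<exists>N. \<forall>m\<ge>N. \<forall>n\<ge>N. (LINT x|M. (?D (u m) x - ?D (u n) x) * (?D (u m) x - ?D (u n) x)) < e" if e: "e > 0" for e
    proof -
      obtain N where N: "\<And>m n. m \<ge> N \<Longrightarrow> n \<ge> N \<Longrightarrow> G.gip (\<lambda>x. u m x - u n x) (\<lambda>x. u m x - u n x) < e"
        using cauchy[OF e] by blast
      show ?thesis by (intro exI[of _ N] allI impI le_less_trans[OF le(2) N])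
    qed
    obtain k where k: "k \<in> square_integrable M" "(\<lambda>n. LINT x|M. (?D (u n) x - k x) * (?D (u n) x - k x)) \<longlonglongrightarrow> 0"
      using bexE[OF square_integrable_complete[OF usq(2) cauchy2]] by blast
    have "weak \<K> l k"
    proof (rule weak_limit)
      show "weak \<K> (u n) (?D (u n))" for n using u by (rule Hh_imp_weak[OF m])
      show "(\<lambda>n. l2norm M (\<lambda>x. u n x - l x)) \<longlonglongrightarrow> 0"
        using tendsto_real_sqrt[OF l(2)] by (simp add: L2.nrm_def)
      show "(\<lambda>n. l2norm M (\<lambda>x. ?D (u n) x - k x)) \<longlonglongrightarrow> 0"
        using tendsto_real_sqrt[OF k(2)] by (simp add: L2.nrm_def)
    qed (use l k in auto)
    then have lH: "l \<in> ns_elems (Hh_space \<Omega> \<K> b)" and Dl: "AE x in M. ?D l x = k x"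
      using weak_imp_Hh[OF m] by auto
    have "G.gip (\<lambda>x. u n x - l x) (\<lambda>x. u n x - l x) =
        (LINT x|M. (u n x - l x) * (u n x - l x)) + (LINT x|M. (?D (u n) x - k x) * (?D (u n) x - k x))" for n
    proof -
      have "(LINT x|M. (?D (u n) x - ?D l x) * (?D (u n) x - ?D l x)) = (LINT x|M. (?D (u n) x - k x) * (?D (u n) x - k x))"
      proof (rule integral_cong_AE)
        show "AE x in M. (?D (u n) x - ?D l x) * (?D (u n) x - ?D l x) = (?D (u n) x - k x) * (?D (u n) x - k x)"
          using Dl by eventually_elim simp
      qed (intro borel_measurable_times borel_measurable_diff D_meas u lH square_integrable_measurable[OF k(1)])+
      then show ?thesis unfolding G.gip_def D_diff_int[OF u lH] by simp
    qed
    moreover have "(\<lambda>n. (LINT x|M. (u n x - l x) * (u n x - l x)) + (LINT x|M. (?D (u n) x - k x) * (?D (u n) x - k x)))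
        \<longlonglongrightarrow> 0 + 0"
      by (intro tendsto_add l k)
    ultimately show "\<exists>l\<in>ns_elems (Hh_space \<Omega> \<K> b). (\<lambda>n. G.gip (\<lambda>x. u n x - l x) (\<lambda>x. u n x - l x)) \<longlonglongrightarrow> 0"
      using lH by (intro bexI[of _ l]) simp_all
  qed
qed

section \<open>The unbroken space as the case of one cell\<close>

lemma bgrad_h_single: "x \<in> \<Omega> \<Longrightarrow> bgrad_h {\<Omega>} b u x = bgrad \<Omega> b u x"
  by (rule bgrad_h_cell[OF mesh_single]) auto

lemma bgrad_sq_iff: "bgrad_h {\<Omega>} b u \<in> square_integrable M \<longleftrightarrow> bgrad \<Omega> b u \<in> square_integrable M"
proof -
  have "bgrad_h {\<Omega>} b u \<in> borel_measurable M \<longleftrightarrow> bgrad \<Omega> b u \<in> borel_measurable M"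
    by (rule measurable_cong) (simp add: bgrad_h_single space_restrict_space)
  moreover have "integrable M (\<lambda>x. (bgrad_h {\<Omega>} b u x)\<^sup>2) \<longleftrightarrow> integrable M (\<lambda>x. (bgrad \<Omega> b u x)\<^sup>2)"
    by (rule Bochner_Integration.integrable_cong) (simp_all add: bgrad_h_single space_restrict_space)
  ultimately show ?thesis by (simp add: square_integrable_def)
qed

lemma H_elems_eq: "ns_elems (H_space \<Omega> b) = ns_elems (Hh_space \<Omega> {\<Omega>} b)"
  by (auto simp: H_space_def Hh_space_def L2_eq_square_integrable bgrad_sq_iff)

lemma H_imp_weak:
  assumes "u \<in> ns_elems (H_space \<Omega> b)" shows "weak {\<Omega>} u (bgrad \<Omega> b u)"
proof -
  have "weak {\<Omega>} u (bgrad_h {\<Omega>} b u)"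
    using Hh_imp_weak[OF mesh_single] assms by (simp add: H_elems_eq)
  then show ?thesis
  proof (rule weak_AE)
    show "u \<in> borel_measurable M" "bgrad \<Omega> b u \<in> borel_measurable M"
      using assms by (auto simp: H_space_def L2_eq_square_integrable intro: square_integrable_measurable)
    show "AE x in M. bgrad_h {\<Omega>} b u x = bgrad \<Omega> b u x"
      by (rule AE_I2) (simp add: bgrad_h_single space_restrict_space)
  qed simp
qed

lemma weak_imp_H:
  assumes "weak {\<Omega>} u h" shows "u \<in> ns_elems (H_space \<Omega> b)" "AE x in M. bgrad \<Omega> b u x = h x"
proof -
  show "u \<in> ns_elems (H_space \<Omega> b)" using weak_imp_Hh[OF mesh_single assms] by (simp add: H_elems_eq)
  have "AE x in M. bgrad_h {\<Omega>} b u x = bgrad \<Omega> b u x"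
    by (rule AE_I2) (simp add: bgrad_h_single space_restrict_space)
  with weak_imp_Hh(2)[OF mesh_single assms] show "AE x in M. bgrad \<Omega> b u x = h x"
    by eventually_elim simp
qed

sublocale H: graph_space M "ns_elems (H_space \<Omega> b)" "bgrad \<Omega> b"
proof
  show "(\<lambda>x. 0) \<in> ns_elems (H_space \<Omega> b)" by (rule weak_imp_H(1)[OF weak_zero])
next
  fix f g r assume f: "f \<in> ns_elems (H_space \<Omega> b)"
  note wf = H_imp_weak[OF f]
  show "f \<in> square_integrable M" "bgrad \<Omega> b f \<in> square_integrable M"
    using weakD[OF wf] by auto
  show "(\<lambda>x. r * f x) \<in> ns_elems (H_space \<Omega> b)"
    "AE x in M. bgrad \<Omega> b (\<lambda>x. r * f x) x = r * bgrad \<Omega> b f x"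
    using weak_imp_H[OF weak_scale[OF wf]] by auto
  assume g: "g \<in> ns_elems (H_space \<Omega> b)"
  note wg = H_imp_weak[OF g]
  show "(\<lambda>x. f x + g x) \<in> ns_elems (H_space \<Omega> b)"
    "AE x in M. bgrad \<Omega> b (\<lambda>x. f x + g x) x = bgrad \<Omega> b f x + bgrad \<Omega> b g x"
    using weak_imp_H[OF weak_add[OF wf wg]] by auto
qed

lemma H_norm_eq: "H_norm \<Omega> b = H.nrm"
  by (rule ext) (simp add: H_norm_def H.nrm_eq L2_norm_eq)

lemma H_AE:
  assumes u: "u \<in> ns_elems (H_space \<Omega> b)" and v: "v \<in> borel_measurable M" "AE x in M. u x = v x"
  shows "v \<in> ns_elems (H_space \<Omega> b)" "AE x in M. bgrad \<Omega> b u x = bgrad \<Omega> b v x"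
proof -
  have "bgrad \<Omega> b u \<in> borel_measurable M"
    using H.D_sq[OF u] by (rule square_integrable_measurable)
  then have "weak {\<Omega>} v (bgrad \<Omega> b u)"
    by (intro weak_AE[OF H_imp_weak[OF u] v]) auto
  from weak_imp_H[OF this] show "v \<in> ns_elems (H_space \<Omega> b)" "AE x in M. bgrad \<Omega> b u x = bgrad \<Omega> b v x"
    by (auto elim: eventually_mono)
qed

lemma H_nrm_AE:
  assumes u: "u \<in> ns_elems (H_space \<Omega> b)" and v: "v \<in> ns_elems (H_space \<Omega> b)" and uv: "AE x in M. u x = v x"
  shows "H.nrm u = H.nrm v"
proof -
  have m: "u \<in> borel_measurable M" "v \<in> borel_measurable M"
    "bgrad \<Omega> b u \<in> borel_measurable M" "bgrad \<Omega> b v \<in> borel_measurable M"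
    using H.S_sq[OF u] H.S_sq[OF v] H.D_sq[OF u] H.D_sq[OF v] by (auto intro: square_integrable_measurable)
  show ?thesis
    unfolding H.nrm_eq l2norm_AE_cong[OF m(1,2) uv] l2norm_AE_cong[OF m(3,4) H_AE(2)[OF u m(2) uv]] ..
qed

text \<open>A test function of a cell is one of \<open>\<Omega>\<close>, so the global derivative
  also serves on each cell.\<close>

lemma H_subset_Hh:
  assumes m: "mesh \<K>" and w: "w \<in> ns_elems (H_space \<Omega> b)"
  shows "w \<in> ns_elems (Hh_space \<Omega> \<K> b)" "AE x in M. bgrad_h \<K> b w x = bgrad \<Omega> b w x"
proof -
  have "weak \<K> w (bgrad \<Omega> b w)"
    unfolding weak_def
  proof (intro conjI ballI weakD(1,2)[OF H_imp_weak[OF w]])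
    fix K \<phi> assume "K \<in> \<K>" "\<phi> \<in> test_functions K"
    then have "\<phi> \<in> test_functions \<Omega>" using mesh_cell[OF m] test_functions_mono by blast
    then show "(LINT x|M. w x * adj \<phi> x) + (LINT x|M. bgrad \<Omega> b w x * \<phi> x) = 0"
      using weakD(3)[OF H_imp_weak[OF w]] by simp
  qed
  from weak_imp_Hh[OF m this] show "w \<in> ns_elems (Hh_space \<Omega> \<K> b)" "AE x in M. bgrad_h \<K> b w x = bgrad \<Omega> b w x"
    by auto
qed

lemma sum_integral_cells:
  fixes f :: "'a \<Rightarrow> real"
  assumes m: "mesh \<K>" and f: "integrable M f"
  shows "(\<Sum>K\<in>\<K>. LINT x|lebesgue_on K. f x) = (LINT x|M. f x)"
proof -
  have cell: "(LINT x|lebesgue_on K. f x) = (LINT x|M. indicator K x * f x)" if K: "K \<in> \<K>" for K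
  proof -
    have "(LINT x|lebesgue_on K. f x) = (LINT x|lebesgue_on K. indicator K x * f x)"
      by (rule Bochner_Integration.integral_cong) (auto simp: space_restrict_space)
    also have "\<dots> = (LINT x|M. indicator K x * f x)"
      using mesh_cell[OF m K] by (intro integral_lebesgue_on_eq) auto
    finally show ?thesis .
  qed
  have int: "integrable M (\<lambda>x. indicator K x * f x)" if K: "K \<in> \<K>" for K
  proof -
    have "K \<in> sets M" using mesh_cell[OF m K] by (simp add: sets_restrict_space_iff)
    then show ?thesis using integrable_mult_indicator[OF _ f, of K] by simp
  qed
  have "(\<Sum>K\<in>\<K>. LINT x|lebesgue_on K. f x) = (LINT x|M. (\<Sum>K\<in>\<K>. indicator K x * f x))"
    using int cell by (simp add: Bochner_Integration.integral_sum)
  also have "\<dots> = (LINT x|M. f x)"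
  proof (rule integral_cong_AE)
    show "(\<lambda>x. \<Sum>K\<in>\<K>. indicator K x * f x) \<in> borel_measurable M"
      using int by (intro borel_measurable_sum) auto
    show "f \<in> borel_measurable M" using f by auto
    show "AE x in M. (\<Sum>K\<in>\<K>. indicator K x * f x) = f x"
      using mesh_AE_covered[OF m]
    proof eventually_elim
      case (elim x)
      then obtain K where K: "K \<in> \<K>" "x \<in> K" by blast
      have "(\<Sum>K'\<in>\<K>. indicator K' x * f x) = (\<Sum>K'\<in>{K}. indicator K' x * f x)"
      proof (rule sum.mono_neutral_right)
        show "finite \<K>" using m by (simp add: mesh_def)
        show "\<forall>K'\<in>\<K> - {K}. indicator K' x * f x = 0"
          using m K by (auto simp: mesh_def disjoint_def indicator_def)
      qed (use K in auto)
      then show ?case using K by simp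
    qed
  qed
  finally show ?thesis .
qed

text \<open>The cells exhaust \<open>\<Omega>\<close> up to a null set, so the cellwise sum becomes
  two \<open>L2\<close> products over \<open>\<Omega>\<close>; estimates and limits of the skeleton
  term are read off from these.\<close>

lemma skeleton_int_eq:
  assumes m: "mesh \<K>" and v: "v \<in> ns_elems (Hh_space \<Omega> \<K> b)" and w: "w \<in> ns_elems (H_space \<Omega> b)"
  shows "skeleton_int \<Omega> \<K> b v w =
    (LINT x|M. bgrad_h \<K> b v x * w x) + (LINT x|M. v x * (bgrad \<Omega> b w x + d x * w x))"
proof -
  note sq = weakD(1,2)[OF Hh_imp_weak[OF m v]] H.S_sq[OF w] H.D_sq[OF w]
  have s: "(\<lambda>x. bgrad \<Omega> b w x + d x * w x) \<in> square_integrable M"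
    by (intro square_integrable_add sq sq_Linf_mult d_Linf)
  have i: "integrable M (\<lambda>x. bgrad_h \<K> b v x * w x)" "integrable M (\<lambda>x. v x * (bgrad \<Omega> b w x + d x * w x))"
    using sq s by (auto intro: integrable_mult_square_integrable)
  have "skeleton_int \<Omega> \<K> b v w =
      (\<Sum>K\<in>\<K>. LINT x|lebesgue_on K. bgrad_h \<K> b v x * w x + v x * (bgrad \<Omega> b w x + d x * w x))"
    unfolding skeleton_int_def
  proof (intro sum.cong Bochner_Integration.integral_cong refl)
    fix K x assume "K \<in> \<K>" "x \<in> space (lebesgue_on K)"
    then show "bgrad K b v x * w x + v x * (bgrad \<Omega> b w x + w x * d x)
        = bgrad_h \<K> b v x * w x + v x * (bgrad \<Omega> b w x + d x * w x)"
      by (simp add: bgrad_h_cell[OF m] space_restrict_space mult.commute)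
  qed
  also have "\<dots> = (LINT x|M. bgrad_h \<K> b v x * w x + v x * (bgrad \<Omega> b w x + d x * w x))"
    by (rule sum_integral_cells[OF m]) (use i in auto)
  finally show ?thesis using i by simp
qed

end

section \<open>Vanishing of the boundary form\<close>

text \<open>Each of the \<open>Suc k\<close> terms of the geometric sum is at least
  \<open>s ^ k\<close>. The resulting bound by 1 does not depend on \<open>k\<close>, which allows
  dominated convergence for the derivatives of \<open>s ^ Suc k\<close>.\<close>

lemma one_minus_power_lower:
  fixes s :: real
  assumes "0 \<le> s" "s \<le> 1"
  shows "real (Suc k) * s ^ k * (1 - s) \<le> 1 - s ^ Suc k"
proof -
  have "real (Suc k) * s ^ k = (\<Sum>i<Suc k. s ^ k)" by simp
  also have "\<dots> \<le> (\<Sum>i<Suc k. s ^ i)"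
    using assms by (intro sum_mono power_decreasing) auto
  finally have "real (Suc k) * s ^ k * (1 - s) \<le> (\<Sum>i<Suc k. s ^ i) * (1 - s)"
    using assms by (intro mult_right_mono) auto
  also have "\<dots> = 1 - s ^ Suc k" unfolding one_diff_power_eq by (simp only: mult.commute)
  finally show ?thesis .
qed

context transport begin

lemma H_cont_iff: "u \<in> H_cont \<Omega> b \<longleftrightarrow> u \<in> ns_elems (H_space \<Omega> b) \<and> continuous_on (closure \<Omega>) u"
  by (simp add: H_cont_def)

lemma H_contI: "weak {\<Omega>} u h \<Longrightarrow> continuous_on (closure \<Omega>) u \<Longrightarrow> u \<in> H_cont \<Omega> b"
  by (simp add: H_cont_iff weak_imp_H(1))

lemma H_cont_bounded:
  fixes u :: "'a \<Rightarrow> real"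
  assumes "continuous_on (closure \<Omega>) u" obtains N where "N > 0" "\<And>x. x \<in> \<Omega> \<Longrightarrow> \<bar>u x\<bar> \<le> N"
proof -
  have "compact (closure \<Omega>)" using bounded_\<Omega> by simp
  then have "bounded (u ` closure \<Omega>)"
    using assms compact_continuous_image compact_imp_bounded by blast
  then obtain N where "N > 0" "\<forall>y\<in>u ` closure \<Omega>. norm y \<le> N" using bounded_pos by metis
  then show ?thesis using that[of N] closure_subset by force
qed

lemma AE_in_\<Omega>: "AE x in M. x \<in> \<Omega>"
  by (rule AE_I2) (simp add: space_restrict_space)

lemma bounded_mult_sq:
  assumes "continuous_on (closure \<Omega>) u" "u \<in> borel_measurable M" "f \<in> square_integrable M"
  shows "(\<lambda>x. u x * f x) \<in> square_integrable M"
proof -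
  obtain N where N: "\<And>x. x \<in> \<Omega> \<Longrightarrow> \<bar>u x\<bar> \<le> N" using H_cont_bounded[OF assms(1)] by blast
  have "AE x in M. \<bar>u x\<bar> \<le> N" using AE_in_\<Omega> by eventually_elim (rule N)
  then show ?thesis by (rule square_integrable_bounded_mult(1)[OF assms(3,2)])
qed

lemma boundary_form_weak:
  assumes w: "weak {\<Omega>} z h"
  shows "boundary_form \<Omega> b z = (LINT x|M. 2 * z x * h x + (z x)\<^sup>2 * d x)"
  unfolding boundary_form_def
proof (rule integral_cong_AE)
  have z: "z \<in> ns_elems (H_space \<Omega> b)" and D: "AE x in M. bgrad \<Omega> b z x = h x"
    using weak_imp_H[OF w] by auto
  note [measurable] = weakD(1,2)[OF w, THEN square_integrable_measurable]
    H.D_sq[OF z, THEN square_integrable_measurable]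
  show "(\<lambda>x. 2 * z x * bgrad \<Omega> b z x + (z x)\<^sup>2 * d x) \<in> borel_measurable M"
    "(\<lambda>x. 2 * z x * h x + (z x)\<^sup>2 * d x) \<in> borel_measurable M" by measurable
  show "AE x in M. 2 * z x * bgrad \<Omega> b z x + (z x)\<^sup>2 * d x = 2 * z x * h x + (z x)\<^sup>2 * d x"
    using D by eventually_elim simp
qed

lemma boundary_form_integrable:
  assumes "weak {\<Omega>} z h" "weak {\<Omega>} w k"
  shows "integrable M (\<lambda>x. h x * w x)" "integrable M (\<lambda>x. z x * k x)" "integrable M (\<lambda>x. d x * z x * w x)"
  using weakD(1,2)[OF assms(1)] weakD(1,2)[OF assms(2)]
  by (auto intro!: integrable_mult_square_integrable sq_Linf_mult d_Linf)

lemma weak_one: "weak {\<Omega>} (\<lambda>x. 1) (\<lambda>x. 0)"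
  unfolding weak_def
proof (intro conjI ballI L2.zero)
  show "(\<lambda>x. 1) \<in> square_integrable M" by (simp add: square_integrable_def)
  fix K \<phi> assume "K \<in> {\<Omega>}" "\<phi> \<in> test_functions K"
  then have \<phi>: "\<phi> \<in> test_functions \<Omega>" by simp
  have "(LINT x|M. adj \<phi> x) = (LINT x|M. pd \<phi> x) + (LINT x|M. d x * \<phi> x)"
    unfolding adj_def
    by (intro Bochner_Integration.integral_add square_integrable_integrable pd_sq[OF \<phi>]
        sq_Linf_mult d_Linf test_sq[OF \<phi>])
  also have "\<dots> = 0" using has_div \<phi> by (simp add: has_weak_div_def pd_def)
  finally show "(LINT x|M. 1 * adj \<phi> x) + (LINT x|M. 0 * \<phi> x) = 0" by simp
qed

end

locale transport_characteristic = transport +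
  fixes \<Gamma>0
  assumes char: "characteristic_part \<Omega> b \<Gamma>0"
begin

text \<open>The quadratic identity is applied to \<open>z + w\<close>, \<open>z\<close> and
  \<open>w\<close>. All three have to vanish on \<open>frontier \<Omega> - \<Gamma>0\<close>, hence
  each factor has to do so separately.\<close>

lemma polarized_form_zero:
  assumes z: "weak {\<Omega>} z h" "continuous_on (closure \<Omega>) z" "\<And>x. x \<in> frontier \<Omega> - \<Gamma>0 \<Longrightarrow> z x = 0"
    and w: "weak {\<Omega>} w k" "continuous_on (closure \<Omega>) w" "\<And>x. x \<in> frontier \<Omega> - \<Gamma>0 \<Longrightarrow> w x = 0"
  shows "(LINT x|M. h x * w x + z x * k x + d x * z x * w x) = 0"
proof -
  have bf: "(LINT x|M. 2 * z x * h x + (z x)\<^sup>2 * d x) = 0"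
    if "weak {\<Omega>} z h" "continuous_on (closure \<Omega>) z" "\<And>x. x \<in> frontier \<Omega> - \<Gamma>0 \<Longrightarrow> z x = 0" for z h
    using char H_contI[OF that(1,2)] that(3) boundary_form_weak[OF that(1)]
    by (auto simp: characteristic_part_def)
  have bi: "integrable M (\<lambda>x. 2 * z x * h x + (z x)\<^sup>2 * d x)" if "weak {\<Omega>} z h" for z h
  proof -
    have "integrable M (\<lambda>x. h x * z x + z x * h x + d x * z x * z x)"
      using boundary_form_integrable[OF that that] by (intro Bochner_Integration.integrable_add)
    then show ?thesis by (simp add: power2_eq_square algebra_simps)
  qed
  define f where "f x = 2 * (z x + w x) * (h x + k x) + (z x + w x)\<^sup>2 * d x" for x
  define f1 where "f1 x = 2 * z x * h x + (z x)\<^sup>2 * d x" for x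
  define f2 where "f2 x = 2 * w x * k x + (w x)\<^sup>2 * d x" for x
  have zw: "weak {\<Omega>} (\<lambda>x. z x + w x) (\<lambda>x. h x + k x)" by (rule weak_add[OF z(1) w(1)])
  have i: "integrable M f" "integrable M f1" "integrable M f2"
    unfolding f_def f1_def f2_def by (rule bi[OF zw] bi[OF z(1)] bi[OF w(1)])+
  have c: "continuous_on (closure \<Omega>) (\<lambda>x. z x + w x)" using z w by (intro continuous_intros)
  have "(LINT x|M. f x) = 0" "(LINT x|M. f1 x) = 0" "(LINT x|M. f2 x) = 0"
    unfolding f_def f1_def f2_def using bf[OF zw c] bf[OF z] bf[OF w] z(3) w(3) by auto
  then have "(LINT x|M. f x - f1 x - f2 x) = 0" using i by simp
  moreover have "f x - f1 x - f2 x = 2 * (h x * w x + z x * k x + d x * z x * w x)" for x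
    by (simp add: f_def f1_def f2_def power2_eq_square algebra_simps)
  ultimately have "(LINT x|M. 2 * (h x * w x + z x * k x + d x * z x * w x)) = 0" by (simp only:)
  then show ?thesis unfolding integral_mult_right_zero by simp
qed

text \<open>For merely bounded \<open>b\<close> a chain rule can fail even for continuous functions. Here the
  characteristic part supplies it, through functions that vanish near the boundary.\<close>

lemma weak_mult:
  assumes u: "weak {\<Omega>} u h" "continuous_on (closure \<Omega>) u"
    and v: "weak {\<Omega>} v k" "continuous_on (closure \<Omega>) v"
  shows "weak {\<Omega>} (\<lambda>x. u x * v x) (\<lambda>x. v x * h x + u x * k x)"
  unfolding weak_def
proof (intro conjI ballI)
  note meas = weakD(1)[OF u(1), THEN square_integrable_measurable] weakD(1)[OF v(1), THEN square_integrable_measurable]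
  show 1: "(\<lambda>x. u x * v x) \<in> square_integrable M"
    by (rule bounded_mult_sq[OF u(2) meas(1) weakD(1)[OF v(1)]])
  show 2: "(\<lambda>x. v x * h x + u x * k x) \<in> square_integrable M"
    by (intro square_integrable_add bounded_mult_sq u(2) v(2) meas weakD(2)[OF u(1)] weakD(2)[OF v(1)])
  fix K \<phi> assume "K \<in> {\<Omega>}" "\<phi> \<in> test_functions K"
  then have \<phi>: "\<phi> \<in> test_functions \<Omega>" by simp
  obtain C where C: "compact C" "C \<subseteq> \<Omega>" "\<And>x. x \<notin> C \<Longrightarrow> \<phi> x = 0"
    using \<phi> by (rule test_functionsE) blast
  \<comment> \<open>A cutoff equal to 1 on the support of \<open>\<phi>\<close> makes
    \<open>\<phi> u\<close> and \<open>\<eta> v\<close> vanish on the whole frontier, so that they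
    form an admissible pair, while their product is still \<open>\<phi> u v\<close>.\<close>
  obtain \<eta> where \<eta>: "\<eta> \<in> test_functions \<Omega>" "\<And>x. x \<in> C \<Longrightarrow> \<eta> x = 1"
    using cutoff_function[OF C(1) open_\<Omega> C(2)] by metis
  have e1: "\<phi> x * \<eta> x = \<phi> x" for x using C(3)[of x] \<eta>(2)[of x] by auto
  have e2: "pd \<phi> x * \<eta> x = pd \<phi> x" for x
  proof (cases "x \<in> C")
    case False
    then have "frechet_derivative \<phi> (at x) = (\<lambda>_. 0)"
      using C by (intro frechet_derivative_zero_outside[of "- C"]) (auto intro: compact_imp_closed)
    then show ?thesis by (simp add: pd_def)
  qed (simp add: \<eta>)
  \<comment> \<open>Where \<open>\<phi>\<close> is nonzero, a neighbourhood lies in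
    \<open>C\<close>, and \<open>\<eta>\<close> is constant there.\<close>
  have e3: "\<phi> x * pd \<eta> x = 0" for x
  proof (cases "\<phi> x = 0")
    case False
    have "open {y. \<phi> y \<noteq> 0}"
      using test_functions_continuous[OF \<phi>, of UNIV] by (intro open_Collect_neq continuous_intros)
    then have "frechet_derivative \<eta> (at x) = (\<lambda>_. 0)"
      using False \<eta>(2) C(3) by (intro frechet_derivative_zero_outside[of "{y. \<phi> y \<noteq> 0}" _ _ 1]) auto
    then show ?thesis by (simp add: pd_def)
  qed simp
  have off: "x \<notin> \<Omega>" if "x \<in> frontier \<Omega>" for x
    using that open_\<Omega> by (simp add: frontier_def interior_open)
  have "(LINT x|M. (\<phi> x * h x + pd \<phi> x * u x) * (\<eta> x * v x) + (\<phi> x * u x) * (\<eta> x * k x + pd \<eta> x * v x)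
      + d x * (\<phi> x * u x) * (\<eta> x * v x)) = 0"
    by (rule polarized_form_zero)
      (use u v off test_functions_outside[OF \<phi>] test_functions_outside[OF \<eta>(1)] in
        \<open>auto intro!: weak_test_mult \<phi> \<eta>(1) continuous_on_mult test_functions_continuous[OF \<phi>] test_functions_continuous[OF \<eta>(1)]\<close>)
  moreover have "(\<phi> x * h x + pd \<phi> x * u x) * (\<eta> x * v x) + (\<phi> x * u x) * (\<eta> x * k x + pd \<eta> x * v x)
      + d x * (\<phi> x * u x) * (\<eta> x * v x) = u x * v x * adj \<phi> x + (v x * h x + u x * k x) * \<phi> x" for x
  proof -
    have "(\<phi> x * h x + pd \<phi> x * u x) * (\<eta> x * v x) + (\<phi> x * u x) * (\<eta> x * k x + pd \<eta> x * v x)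
      + d x * (\<phi> x * u x) * (\<eta> x * v x) = (\<phi> x * \<eta> x) * h x * v x + (pd \<phi> x * \<eta> x) * u x * v x
        + (\<phi> x * \<eta> x) * u x * k x + (\<phi> x * pd \<eta> x) * u x * v x + d x * (\<phi> x * \<eta> x) * u x * v x"
      by (simp add: algebra_simps)
    then show ?thesis unfolding e1 e2 e3 by (simp add: adj_def algebra_simps)
  qed
  ultimately have "(LINT x|M. u x * v x * adj \<phi> x + (v x * h x + u x * k x) * \<phi> x) = 0" by simp
  then show "(LINT x|M. u x * v x * adj \<phi> x) + (LINT x|M. (v x * h x + u x * k x) * \<phi> x) = 0"
    using 1 2 adj_sq[OF \<phi>] test_sq[OF \<phi>] by (simp add: integrable_mult_square_integrable)
qed

lemma weak_power:
  assumes s: "weak {\<Omega>} s \<sigma>" "continuous_on (closure \<Omega>) s"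
  shows "weak {\<Omega>} (\<lambda>x. s x ^ Suc k) (\<lambda>x. real (Suc k) * s x ^ k * \<sigma> x)"
proof (induction k)
  case (Suc k)
  have "weak {\<Omega>} (\<lambda>x. s x * s x ^ Suc k) (\<lambda>x. s x ^ Suc k * \<sigma> x + s x * (real (Suc k) * s x ^ k * \<sigma> x))"
    using s by (intro weak_mult Suc.IH continuous_intros)
  then show ?case by (simp add: algebra_simps)
qed (use s in simp)

text \<open>The functions \<open>p m\<^sub>k\<close> with \<open>m\<^sub>k = 1 - (1 - p\<^sup>2 / N\<^sup>2)\<^sup>k\<close> approximate \<open>p\<close>, and both factors
  vanish wherever \<open>p\<close> does, so that the polarised form applies to \<open>p\<close> and \<open>m\<^sub>k\<close>. In the limit
  the derivative of \<open>p\<close> appears off the zero set of \<open>p\<close> only, and testing with test functions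
  shows that it vanishes on the zero set.\<close>

lemma integral_zero_of_vanishing:
  assumes p: "weak {\<Omega>} p q" "continuous_on (closure \<Omega>) p" "\<And>x. x \<in> frontier \<Omega> - \<Gamma>0 \<Longrightarrow> p x = 0"
  shows "(LINT x|M. q x + d x * p x) = 0"
proof -
  obtain N where N: "N > 0" "\<And>x. x \<in> \<Omega> \<Longrightarrow> \<bar>p x\<bar> \<le> N" using H_cont_bounded[OF p(2)] by blast
  \<comment> \<open>As \<open>\<bar>p\<bar> \<le> N\<close>, the values lie between 0 and 1, with 1
    exactly on the zero set of \<open>p\<close>; hence the powers of \<open>s\<close> tend to the
    indicator of that set.\<close>
  define s where "s x = 1 - (1 / N\<^sup>2) * (p x * p x)" for x
  define \<sigma> where "\<sigma> x = 0 - (1 / N\<^sup>2) * (p x * q x + p x * q x)" for x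
  define m where "m k x = 1 - s x ^ Suc k" for k x
  define \<mu> where "\<mu> k x = 0 - real (Suc k) * s x ^ k * \<sigma> x" for k x
  have s: "weak {\<Omega>} s \<sigma>" "continuous_on (closure \<Omega>) s"
    unfolding s_def[abs_def] \<sigma>_def[abs_def]
    by (intro weak_diff weak_one weak_scale weak_mult p continuous_intros)+
  have mw: "weak {\<Omega>} (m k) (\<mu> k)" "continuous_on (closure \<Omega>) (m k)" for k
    unfolding m_def[abs_def] \<mu>_def[abs_def]
    by (intro weak_diff weak_one weak_power s continuous_intros)+
  note pq = weakD(1,2)[OF p(1)]
  have s01: "0 \<le> s x \<and> s x \<le> 1" if "x \<in> \<Omega>" for x
  proof -
    have "\<bar>p x\<bar>\<^sup>2 \<le> N\<^sup>2" using N that by (intro power_mono) auto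
    then have "p x * p x \<le> N\<^sup>2" by (simp add: power2_eq_square)
    then show ?thesis using N by (simp add: s_def field_simps)
  qed
  \<comment> \<open>The derivative of \<open>m k\<close> contains a factor \<open>p q / N^2\<close>.
    The additional \<open>p\<close> completes it to \<open>(1 - s) q\<close>, which is what keeps
    the growing factor \<open>Suc k\<close> under control.\<close>
  have p\<mu>: "p x * \<mu> k x = 2 * (real (Suc k) * s x ^ k * (1 - s x)) * q x" for k x
    by (simp add: \<mu>_def \<sigma>_def s_def algebra_simps)
  have m01: "0 \<le> m k x \<and> m k x \<le> 1" if "x \<in> \<Omega>" for k x
    using s01[OF that] power_le_one[of "s x" "Suc k"] by (simp add: m_def del: power_Suc)
  have c01: "0 \<le> real (Suc k) * s x ^ k * (1 - s x) \<and> real (Suc k) * s x ^ k * (1 - s x) \<le> 1" if "x \<in> \<Omega>" for k x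
    using s01[OF that] one_minus_power_lower[of "s x" k] m01[OF that, of k]
    by (auto simp: m_def simp del: power_Suc intro: order_trans)
  \<comment> \<open>One for \<open>m k\<close>, and two for the doubled product bounded by
    \<open>one_minus_power_lower\<close>.\<close>
  have coeff: "\<bar>m k x + 2 * (real (Suc k) * s x ^ k * (1 - s x))\<bar> \<le> 3" if "x \<in> \<Omega>" for k x
    using m01[OF that, of k] c01[OF that, of k] by linarith
  define q0 where "q0 x = (if p x = 0 then 0 else q x)" for x
  have lim: "(\<lambda>k. p x * m k x) \<longlonglongrightarrow> p x" "(\<lambda>k. q x * m k x + p x * \<mu> k x) \<longlonglongrightarrow> q0 x"
    if x: "x \<in> \<Omega>" for x
  proof -
    have "(\<lambda>k. p x * m k x) \<longlonglongrightarrow> p x \<and> (\<lambda>k. q x * m k x + p x * \<mu> k x) \<longlonglongrightarrow> q0 x"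
    proof (cases "p x = 0")
      case True
      then have "s x = 1" by (simp add: s_def)
      then show ?thesis using True by (simp add: m_def q0_def)
    next
      case False
      then have "0 < p x * p x" using not_real_square_gt_zero by blast
      then have "0 < (1 / N\<^sup>2) * (p x * p x)" using N(1) by simp
      then have s1: "\<bar>s x\<bar> < 1" using s01[OF x] by (simp add: s_def)
      have "(\<lambda>k. s x ^ Suc k) \<longlonglongrightarrow> 0" using s1 by (intro LIMSEQ_Suc LIMSEQ_power_zero) simp
      then have ml: "(\<lambda>k. m k x) \<longlonglongrightarrow> 1 - 0" unfolding m_def by (intro tendsto_intros)
      have "(\<lambda>k. real k * s x ^ k + s x ^ k) \<longlonglongrightarrow> 0 + 0"
        using s1 by (intro tendsto_add powser_times_n_limit_0 LIMSEQ_power_zero) simp_all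
      then have "(\<lambda>k. real (Suc k) * s x ^ k) \<longlonglongrightarrow> 0" by (simp add: algebra_simps)
      then have "(\<lambda>k. q x * m k x + 2 * (real (Suc k) * s x ^ k * (1 - s x)) * q x)
          \<longlonglongrightarrow> q x * (1 - 0) + 2 * (0 * (1 - s x)) * q x"
        using ml by (intro tendsto_intros)
      moreover have "(\<lambda>k. p x * m k x) \<longlonglongrightarrow> p x * (1 - 0)" using ml by (intro tendsto_intros)
      ultimately show ?thesis using False unfolding p\<mu> by (simp add: q0_def)
    qed
    then show "(\<lambda>k. p x * m k x) \<longlonglongrightarrow> p x" "(\<lambda>k. q x * m k x + p x * \<mu> k x) \<longlonglongrightarrow> q0 x" by auto
  qed
  note [measurable] = pq[THEN square_integrable_measurable]
  have [measurable]: "m k \<in> borel_measurable M" "\<mu> k \<in> borel_measurable M" for k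
    using weakD(1,2)[OF mw(1)] by (auto intro: square_integrable_measurable)
  have q0m [measurable]: "q0 \<in> borel_measurable M" unfolding q0_def[abs_def] by measurable
  have q0_sq: "q0 \<in> square_integrable M"
  proof -
    have "(\<lambda>x. (if p x = 0 then 0 else 1) * q x) \<in> square_integrable M"
      by (rule square_integrable_bounded_mult(1)[OF pq(2), where C=1]) auto
    moreover have "(\<lambda>x. (if p x = 0 then 0 else 1) * q x) = q0" by (auto simp: q0_def)
    ultimately show ?thesis by simp
  qed
  \<comment> \<open>The passage to the limit, used twice: with \<open>A = adj \<phi>\<close> and
    \<open>\<psi> = \<phi>\<close> it makes \<open>q0\<close> a derivative of \<open>p\<close>, with
    \<open>A = d\<close> and \<open>\<psi> = 1\<close> it gives the integral of
    \<open>q0 + d p\<close>.\<close>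
  have main: "(LINT x|M. p x * A x + q0 x * \<psi> x) = 0"
    if A: "A \<in> square_integrable M" and \<psi>: "\<psi> \<in> square_integrable M"
      and zero: "\<And>k. (LINT x|M. p x * m k x * A x + (q x * m k x + p x * \<mu> k x) * \<psi> x) = 0" for A \<psi>
  proof -
    note [measurable] = A[THEN square_integrable_measurable] \<psi>[THEN square_integrable_measurable]
    have "(\<lambda>k. LINT x|M. p x * m k x * A x + (q x * m k x + p x * \<mu> k x) * \<psi> x)
        \<longlonglongrightarrow> (LINT x|M. p x * A x + q0 x * \<psi> x)"
    proof (rule integral_dominated_convergence[where w="\<lambda>x. \<bar>p x * A x\<bar> + 3 * \<bar>q x * \<psi> x\<bar>"])
      show "integrable M (\<lambda>x. \<bar>p x * A x\<bar> + 3 * \<bar>q x * \<psi> x\<bar>)"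
        using integrable_mult_square_integrable[OF pq(1) A] integrable_mult_square_integrable[OF pq(2) \<psi>]
        by auto
      show "AE x in M. (\<lambda>k. p x * m k x * A x + (q x * m k x + p x * \<mu> k x) * \<psi> x) \<longlonglongrightarrow> p x * A x + q0 x * \<psi> x"
        using AE_in_\<Omega> by eventually_elim (intro tendsto_intros lim)
      show "AE x in M. norm (p x * m k x * A x + (q x * m k x + p x * \<mu> k x) * \<psi> x) \<le> \<bar>p x * A x\<bar> + 3 * \<bar>q x * \<psi> x\<bar>" for k
        using AE_in_\<Omega>
      proof eventually_elim
        case (elim x)
        have "p x * m k x * A x + (q x * m k x + p x * \<mu> k x) * \<psi> x
          = m k x * (p x * A x) + (m k x + 2 * (real (Suc k) * s x ^ k * (1 - s x))) * (q x * \<psi> x)"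
          unfolding p\<mu> by (simp add: algebra_simps)
        also have "norm \<dots> \<le> \<bar>m k x\<bar> * \<bar>p x * A x\<bar> + \<bar>m k x + 2 * (real (Suc k) * s x ^ k * (1 - s x))\<bar> * \<bar>q x * \<psi> x\<bar>"
          unfolding real_norm_def abs_mult[symmetric] by (rule abs_triangle_ineq)
        also have "\<dots> \<le> 1 * \<bar>p x * A x\<bar> + 3 * \<bar>q x * \<psi> x\<bar>"
          using m01[OF elim, of k] coeff[OF elim, of k] by (intro add_mono mult_right_mono) auto
        finally show ?case by simp
      qed
    qed measurable
    then show ?thesis using zero by (simp add: LIMSEQ_const_iff)
  qed
  have "weak {\<Omega>} p q0"
    unfolding weak_def
  proof (intro conjI ballI pq q0_sq)
    fix K \<phi> assume "K \<in> {\<Omega>}" "\<phi> \<in> test_functions K"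
    then have \<phi>: "\<phi> \<in> test_functions \<Omega>" by simp
    have "(LINT x|M. p x * adj \<phi> x + q0 x * \<phi> x) = 0"
    proof (rule main[OF adj_sq[OF \<phi>] test_sq[OF \<phi>]])
      fix k
      have w: "weak {\<Omega>} (\<lambda>x. p x * m k x) (\<lambda>x. m k x * q x + p x * \<mu> k x)"
        by (intro weak_mult p mw)
      have "(LINT x|M. p x * m k x * adj \<phi> x) + (LINT x|M. (m k x * q x + p x * \<mu> k x) * \<phi> x) = 0"
        using weakD(3)[OF w _ \<phi>] by simp
      then have "(LINT x|M. p x * m k x * adj \<phi> x + (m k x * q x + p x * \<mu> k x) * \<phi> x) = 0"
        using weakD(1,2)[OF w] adj_sq[OF \<phi>] test_sq[OF \<phi>] by (simp add: integrable_mult_square_integrable)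
      then show "(LINT x|M. p x * m k x * adj \<phi> x + (q x * m k x + p x * \<mu> k x) * \<phi> x) = 0"
        by (simp add: mult.commute)
    qed
    then show "(LINT x|M. p x * adj \<phi> x) + (LINT x|M. q0 x * \<phi> x) = 0"
      using pq q0_sq adj_sq[OF \<phi>] test_sq[OF \<phi>] by (simp add: integrable_mult_square_integrable)
  qed
  \<comment> \<open>Both \<open>q0\<close> and \<open>q\<close> are derivatives of \<open>p\<close>,
    hence they agree almost everywhere; this is where \<open>q\<close> is seen to vanish on the zero
    set of \<open>p\<close>.\<close>
  from weak_imp_H(2)[OF this] weak_imp_H(2)[OF p(1)]
  have "AE x in M. q x + d x * p x = p x * d x + q0 x * 1"
    by eventually_elim (simp add: mult.commute)
  then have "(LINT x|M. q x + d x * p x) = (LINT x|M. p x * d x + q0 x * 1)"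
    by (rule integral_cong_AE[rotated 2]) measurable
  also have "\<dots> = 0"
  proof (rule main)
    show one: "(\<lambda>x. 1) \<in> square_integrable M" by (simp add: square_integrable_def)
    show "d \<in> square_integrable M" using sq_Linf_mult[OF d_Linf one] by simp
    fix k
    \<comment> \<open>The pair \<open>p\<close>, \<open>m k\<close> is admissible because
      \<open>p = 0\<close> gives \<open>s = 1\<close> and therefore \<open>m k = 0\<close>.\<close>
    have "(LINT x|M. q x * m k x + p x * \<mu> k x + d x * p x * m k x) = 0"
    proof (rule polarized_form_zero[OF p mw])
      show "m k x = 0" if "x \<in> frontier \<Omega> - \<Gamma>0" for x using p(3)[OF that] by (simp add: m_def s_def)
    qed
    then show "(LINT x|M. p x * m k x * d x + (q x * m k x + p x * \<mu> k x) * 1) = 0"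
      by (simp add: algebra_simps)
  qed
  finally show ?thesis .
qed

section \<open>The boundary form on closures of continuous functions\<close>

lemma H0_approx:
  assumes "u \<in> ns_elems (H0_space \<Omega> b \<Gamma>)"
  obtains w where "\<And>n. w n \<in> H_cont \<Omega> b" "\<And>n x. x \<in> \<Gamma> \<Longrightarrow> w n x = 0"
    "(\<lambda>n. l2norm M (\<lambda>x. w n x - u x)) \<longlonglongrightarrow> 0"
    "(\<lambda>n. l2norm M (\<lambda>x. bgrad \<Omega> b (w n) x - bgrad \<Omega> b u x)) \<longlonglongrightarrow> 0"
proof -
  have u: "u \<in> ns_elems (H_space \<Omega> b)" using assms by (simp add: H0_space_def)
  have "\<exists>w\<in>H_cont \<Omega> b. (\<forall>x\<in>\<Gamma>. w x = 0) \<and> H.nrm (\<lambda>x. u x - w x) < 1 / real (Suc n)" for n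
    using assms by (simp add: H0_space_def H_norm_eq)
  then obtain w where w: "\<And>n. w n \<in> H_cont \<Omega> b" "\<And>n x. x \<in> \<Gamma> \<Longrightarrow> w n x = 0"
    "\<And>n. H.nrm (\<lambda>x. u x - w n x) < 1 / real (Suc n)" by metis
  have wH: "w n \<in> ns_elems (H_space \<Omega> b)" for n using w(1) by (simp add: H_cont_iff)
  have n1: "H.nrm (\<lambda>x. w n x - u x) < 1 / real (Suc n)" for n
    using w(3)[of n] H.nrm_scale[OF H.diff[OF u wH[of n]], of "-1"] by simp
  have lim: "(\<lambda>n. 1 / real (Suc n)) \<longlonglongrightarrow> 0" by (intro LIMSEQ_Suc lim_1_over_n)
  have "(\<lambda>n. l2norm M (\<lambda>x. w n x - u x)) \<longlonglongrightarrow> 0"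
  proof (rule tendsto_sandwich[OF _ _ tendsto_const lim])
    show "\<forall>\<^sub>F n in sequentially. 0 \<le> l2norm M (\<lambda>x. w n x - u x)"
      by (simp add: L2.nrm_nonneg square_integrable_diff H.S_sq u wH)
    show "\<forall>\<^sub>F n in sequentially. l2norm M (\<lambda>x. w n x - u x) \<le> 1 / real (Suc n)"
      using order_trans[OF H.l2norm_le_nrm less_imp_le[OF n1]] by simp
  qed
  moreover have "(\<lambda>n. l2norm M (\<lambda>x. bgrad \<Omega> b (w n) x - bgrad \<Omega> b u x)) \<longlonglongrightarrow> 0"
  proof (rule tendsto_sandwich[OF _ _ tendsto_const lim])
    show "\<forall>\<^sub>F n in sequentially. 0 \<le> l2norm M (\<lambda>x. bgrad \<Omega> b (w n) x - bgrad \<Omega> b u x)"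
      by (simp add: L2.nrm_nonneg square_integrable_diff H.D_sq u wH)
    have "l2norm M (\<lambda>x. bgrad \<Omega> b (w n) x - bgrad \<Omega> b u x) \<le> 1 / real (Suc n)" for n
    proof -
      have "l2norm M (\<lambda>x. bgrad \<Omega> b (w n) x - bgrad \<Omega> b u x) = l2norm M (bgrad \<Omega> b (\<lambda>x. w n x - u x))"
      proof (rule l2norm_AE_cong)
        show "AE x in M. bgrad \<Omega> b (w n) x - bgrad \<Omega> b u x = bgrad \<Omega> b (\<lambda>x. w n x - u x) x"
          using H.D_diff[OF wH[of n] u] by eventually_elim simp
      qed (intro square_integrable_measurable square_integrable_diff H.D_sq H.diff wH u)+
      then show ?thesis using order_trans[OF H.l2norm_D_le_nrm less_imp_le[OF n1]] by simp
    qed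
    then show "\<forall>\<^sub>F n in sequentially. l2norm M (\<lambda>x. bgrad \<Omega> b (w n) x - bgrad \<Omega> b u x) \<le> 1 / real (Suc n)"
      by simp
  qed
  ultimately show ?thesis using that w(1,2) by blast
qed

lemma l2norm_Linf_mult_tendsto:
  assumes c: "c \<in> Linf \<Omega>" and u: "\<And>n. u n \<in> square_integrable M"
    and lim: "(\<lambda>n. l2norm M (u n)) \<longlonglongrightarrow> 0"
  shows "(\<lambda>n. l2norm M (\<lambda>x. c x * u n x)) \<longlonglongrightarrow> 0"
proof (rule tendsto_sandwich[OF _ _ tendsto_const])
  show "\<forall>\<^sub>F n in sequentially. 0 \<le> l2norm M (\<lambda>x. c x * u n x)"
    by (simp add: L2.nrm_nonneg sq_Linf_mult c u)
  show "\<forall>\<^sub>F n in sequentially. l2norm M (\<lambda>x. c x * u n x) \<le> Linf_norm \<Omega> c * l2norm M (u n)"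
    by (simp add: l2norm_bounded_mult u Linf_measurable[OF c] Linf_AE[OF c] Linf_norm_nonneg)
  show "(\<lambda>n. Linf_norm \<Omega> c * l2norm M (u n)) \<longlonglongrightarrow> 0"
    using tendsto_mult[OF tendsto_const lim, of "Linf_norm \<Omega> c"] by simp
qed

text \<open>For continuous approximants the product vanishes on
  \<open>\<Gamma>1 \<union> \<Gamma>2\<close>, so that \<open>integral_zero_of_vanishing\<close>
  applies to it. The resulting identity is bilinear and continuous in the graph norms, and it passes
  to the closures.\<close>

theorem boundary_form_H0_zero:
  assumes \<Gamma>: "frontier \<Omega> - \<Gamma>0 \<subseteq> \<Gamma>1 \<union> \<Gamma>2"
    and v: "v \<in> ns_elems (H0_space \<Omega> b \<Gamma>1)" and w: "w \<in> ns_elems (H0_space \<Omega> b \<Gamma>2)"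
  shows "(LINT x|M. bgrad \<Omega> b v x * w x) + (LINT x|M. v x * (bgrad \<Omega> b w x + d x * w x)) = 0"
proof -
  obtain v' where v': "\<And>n. v' n \<in> H_cont \<Omega> b" "\<And>n x. x \<in> \<Gamma>1 \<Longrightarrow> v' n x = 0"
    "(\<lambda>n. l2norm M (\<lambda>x. v' n x - v x)) \<longlonglongrightarrow> 0"
    "(\<lambda>n. l2norm M (\<lambda>x. bgrad \<Omega> b (v' n) x - bgrad \<Omega> b v x)) \<longlonglongrightarrow> 0"
    using H0_approx[OF v] by blast
  obtain w' where w': "\<And>n. w' n \<in> H_cont \<Omega> b" "\<And>n x. x \<in> \<Gamma>2 \<Longrightarrow> w' n x = 0"
    "(\<lambda>n. l2norm M (\<lambda>x. w' n x - w x)) \<longlonglongrightarrow> 0"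
    "(\<lambda>n. l2norm M (\<lambda>x. bgrad \<Omega> b (w' n) x - bgrad \<Omega> b w x)) \<longlonglongrightarrow> 0"
    using H0_approx[OF w] by blast
  have H: "v \<in> ns_elems (H_space \<Omega> b)" "w \<in> ns_elems (H_space \<Omega> b)"
    using v w by (auto simp: H0_space_def)
  have H': "v' n \<in> ns_elems (H_space \<Omega> b)" "w' n \<in> ns_elems (H_space \<Omega> b)" for n
    using v'(1) w'(1) by (auto simp: H_cont_iff)
  note sq = H[THEN H.S_sq] H[THEN H.D_sq] H'[THEN H.S_sq] H'[THEN H.D_sq]
  have dw: "(\<lambda>n. l2norm M (\<lambda>x. d x * w' n x - d x * w x)) \<longlonglongrightarrow> 0"
    using l2norm_Linf_mult_tendsto[OF d_Linf square_integrable_diff[OF sq(6,2)] w'(3)]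
    by (simp add: right_diff_distrib)
  have zero: "(LINT x|M. bgrad \<Omega> b (v' n) x * w' n x) + (LINT x|M. v' n x * bgrad \<Omega> b (w' n) x)
      + (LINT x|M. v' n x * (d x * w' n x)) = 0" for n
  proof -
    have cont: "continuous_on (closure \<Omega>) (v' n)" "continuous_on (closure \<Omega>) (w' n)"
      using v'(1) w'(1) by (auto simp: H_cont_iff)
    have "(LINT x|M. (w' n x * bgrad \<Omega> b (v' n) x + v' n x * bgrad \<Omega> b (w' n) x) + d x * (v' n x * w' n x)) = 0"
    proof (rule integral_zero_of_vanishing)
      show "weak {\<Omega>} (\<lambda>x. v' n x * w' n x) (\<lambda>x. w' n x * bgrad \<Omega> b (v' n) x + v' n x * bgrad \<Omega> b (w' n) x)"
        by (intro weak_mult cont H_imp_weak H')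
      show "continuous_on (closure \<Omega>) (\<lambda>x. v' n x * w' n x)" by (intro continuous_intros cont)
      show "v' n x * w' n x = 0" if "x \<in> frontier \<Omega> - \<Gamma>0" for x
        using that \<Gamma> v'(2)[of x n] w'(2)[of x n] by auto
    qed
    moreover have "(w' n x * bgrad \<Omega> b (v' n) x + v' n x * bgrad \<Omega> b (w' n) x) + d x * (v' n x * w' n x)
        = (bgrad \<Omega> b (v' n) x * w' n x + v' n x * bgrad \<Omega> b (w' n) x) + v' n x * (d x * w' n x)" for x
      by (simp add: algebra_simps)
    ultimately show ?thesis
      using sq by (simp add: integrable_mult_square_integrable sq_Linf_mult d_Linf)
  qed
  have "(\<lambda>n. (LINT x|M. bgrad \<Omega> b (v' n) x * w' n x) + (LINT x|M. v' n x * bgrad \<Omega> b (w' n) x)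
      + (LINT x|M. v' n x * (d x * w' n x))) \<longlonglongrightarrow>
      (LINT x|M. bgrad \<Omega> b v x * w x) + (LINT x|M. v x * bgrad \<Omega> b w x) + (LINT x|M. v x * (d x * w x))"
    by (intro tendsto_add L2.tendsto_ip sq v' w' dw sq_Linf_mult d_Linf)
  then have "(LINT x|M. bgrad \<Omega> b v x * w x) + (LINT x|M. v x * bgrad \<Omega> b w x) + (LINT x|M. v x * (d x * w x)) = 0"
    unfolding zero by (simp add: LIMSEQ_const_iff)
  then show ?thesis
    using sq by (simp add: distrib_left integrable_mult_square_integrable sq_Linf_mult d_Linf)
qed

end

section \<open>Lifting functionals to traces\<close>

definition seminormed :: "'x nspace \<Rightarrow> bool" where
  "seminormed X \<longleftrightarrow> (\<forall>x\<in>ns_elems X. 0 \<le> ns_norm X x) \<and>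
     (\<forall>r. \<forall>x\<in>ns_elems X. ns_scale X r x \<in> ns_elems X \<and> ns_norm X (ns_scale X r x) = \<bar>r\<bar> * ns_norm X x) \<and>
     (\<forall>x\<in>ns_elems X. \<forall>y\<in>ns_elems X. ns_eq X x y \<longrightarrow> ns_norm X x = ns_norm X y)"

lemma seminormedD:
  assumes "seminormed X"
  shows "x \<in> ns_elems X \<Longrightarrow> 0 \<le> ns_norm X x"
    and "x \<in> ns_elems X \<Longrightarrow> ns_scale X r x \<in> ns_elems X"
    and "x \<in> ns_elems X \<Longrightarrow> ns_norm X (ns_scale X r x) = \<bar>r\<bar> * ns_norm X x"
    and "x \<in> ns_elems X \<Longrightarrow> y \<in> ns_elems X \<Longrightarrow> ns_eq X x y \<Longrightarrow> ns_norm X x = ns_norm X y"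
  using assms by (auto simp: seminormed_def)

lemma bounded_op_bdd_above:
  assumes T: "bounded_op X Y T" and X: "seminormed X"
  shows "bdd_above {ns_norm Y (T x) | x. x \<in> ns_elems X \<and> ns_norm X x \<le> 1}"
proof -
  obtain C where C: "\<forall>x\<in>ns_elems X. ns_norm Y (T x) \<le> C * ns_norm X x"
    using T unfolding bounded_op_def by blast
  show ?thesis
  proof (rule bdd_aboveI, clarsimp)
    fix x assume x: "x \<in> ns_elems X" "ns_norm X x \<le> 1"
    have n: "0 \<le> ns_norm X x" using X x by (simp add: seminormed_def)
    have "ns_norm Y (T x) \<le> C * ns_norm X x" using C x by blast
    also have "\<dots> \<le> \<bar>C\<bar> * ns_norm X x" using n by (intro mult_right_mono) auto
    also have "\<dots> \<le> \<bar>C\<bar> * 1" using x by (intro mult_left_mono) auto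
    finally show "ns_norm Y (T x) \<le> \<bar>C\<bar> * 1" .
  qed
qed

lemma op_norm_upper:
  assumes T: "bounded_op X Y T" and X: "seminormed X" and x: "x \<in> ns_elems X" "ns_norm X x \<le> 1"
  shows "ns_norm Y (T x) \<le> op_norm X Y T"
  unfolding op_norm_def using x by (intro cSup_upper bounded_op_bdd_above[OF T X]) auto

text \<open>Normalisation of \<open>x\<close>. Operators are homogeneous only up to
  \<open>ns_eq\<close>, so invariance of the norm under \<open>ns_eq\<close> is required of the
  target. Elements of norm 0 cannot be normalised; for these the boundedness of the operator gives
  the claim.\<close>

lemma op_norm_bound:
  assumes T: "bounded_op X Y T" and X: "seminormed X" and Y: "seminormed Y" and x: "x \<in> ns_elems X"
  shows "ns_norm Y (T x) \<le> op_norm X Y T * ns_norm X x"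
proof (cases "ns_norm X x = 0")
  case True
  then show ?thesis using T x by (auto simp: bounded_op_def)
next
  case False
  let ?n = "ns_norm X x"
  have n: "?n > 0" using False seminormedD(1)[OF X x] by simp
  let ?x = "ns_scale X (1 / ?n) x"
  have x': "?x \<in> ns_elems X" "ns_norm X ?x \<le> 1" using X x n by (auto simp: seminormed_def)
  have "ns_eq Y (T ?x) (ns_scale Y (1 / ?n) (T x))" "T x \<in> ns_elems Y" "T ?x \<in> ns_elems Y"
    using T x x' by (auto simp: bounded_op_def)
  then have "ns_norm Y (T ?x) = (1 / ?n) * ns_norm Y (T x)"
    using seminormedD(4)[OF Y, of "T ?x" "ns_scale Y (1 / ?n) (T x)"]
      seminormedD(2,3)[OF Y, of "T x" "1 / ?n"] n by simp
  then have "(1 / ?n) * ns_norm Y (T x) \<le> op_norm X Y T" using op_norm_upper[OF T X x'] by simp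
  then show ?thesis using n by (simp add: field_simps)
qed

text \<open>No zero element is part of an \<open>nspace\<close>; a multiple
  \<open>ns_scale X 0 x\<close> takes its place and shows that the supremum is over a nonempty
  set.\<close>

lemma op_norm_nonneg:
  assumes "bounded_op X Y T" "seminormed X" "seminormed Y" "x \<in> ns_elems X"
  shows "0 \<le> op_norm X Y T"
proof -
  have x: "ns_scale X 0 x \<in> ns_elems X" "ns_norm X (ns_scale X 0 x) \<le> 1"
    using seminormedD(2,3)[OF assms(2,4), of 0] by simp_all
  then have "T (ns_scale X 0 x) \<in> ns_elems Y" using assms(1) by (simp add: bounded_op_def)
  then have "0 \<le> ns_norm Y (T (ns_scale X 0 x))" by (rule seminormedD(1)[OF assms(3)])
  also have "\<dots> \<le> op_norm X Y T" by (rule op_norm_upper[OF assms(1,2) x])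
  finally show ?thesis .
qed

lemma op_norm_le:
  assumes "x0 \<in> ns_elems X" "ns_norm X x0 \<le> 1"
    and "\<And>x. x \<in> ns_elems X \<Longrightarrow> ns_norm X x \<le> 1 \<Longrightarrow> ns_norm Y (T x) \<le> C"
  shows "op_norm X Y T \<le> C"
  unfolding op_norm_def using assms by (intro cSup_least) auto

lemma inverse_op_props:
  assumes "bijective_op X Y T" "y \<in> ns_elems Y"
  shows "inverse_op X Y T y \<in> ns_elems X" "ns_eq Y (T (inverse_op X Y T y)) y"
proof -
  have "\<exists>x. x \<in> ns_elems X \<and> ns_eq Y (T x) y" using assms by (auto simp: bijective_op_def)
  from someI_ex[OF this]
  show "inverse_op X Y T y \<in> ns_elems X" "ns_eq Y (T (inverse_op X Y T y)) y"
    by (simp_all add: inverse_op_def)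
qed

lemma seminormed_real_space: "seminormed real_space"
  by (simp add: seminormed_def real_space_def abs_mult)

lemma L2_space_simps [simp]:
  "ns_elems (L2_space \<Omega>) = square_integrable (lebesgue_on \<Omega>)"
  "ns_eq (L2_space \<Omega>) f g \<longleftrightarrow> (AE x in lebesgue_on \<Omega>. f x = g x)"
  "ns_add (L2_space \<Omega>) f g = (\<lambda>x. f x + g x)"
  "ns_scale (L2_space \<Omega>) r f = (\<lambda>x. r * f x)"
  "ns_norm (L2_space \<Omega>) f = l2norm (lebesgue_on \<Omega>) f"
  using L2_eq_square_integrable[of \<Omega>] by (simp_all add: L2_space_def L2_norm_eq)

lemma seminormed_L2_space: "seminormed (L2_space \<Omega>)"
  by (auto simp: seminormed_def L2.nrm_scale square_integrable_scale
      intro!: l2norm_AE_cong square_integrable_measurable)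

lemma integral_mult_AE_cong:
  assumes "f \<in> square_integrable M" "f' \<in> square_integrable M" "AE x in M. f x = f' x"
    and "g \<in> square_integrable M" "g' \<in> square_integrable M" "AE x in M. g x = g' x"
  shows "(LINT x|M. f x * g x) = (LINT x|M. f' x * g' x)"
proof (rule integral_cong_AE)
  show "AE x in M. f x * g x = f' x * g' x"
    using assms(3,6) by eventually_elim simp
qed (intro borel_measurable_times square_integrable_measurable assms)+

section \<open>Subspaces with boundary conditions\<close>

context transport begin

lemma H_space_simps [simp]:
  "ns_eq (H_space \<Omega> b) f g \<longleftrightarrow> (AE x in M. f x = g x)"
  "ns_add (H_space \<Omega> b) f g = (\<lambda>x. f x + g x)"
  "ns_scale (H_space \<Omega> b) r f = (\<lambda>x. r * f x)"
  "ns_norm (H_space \<Omega> b) f = H.nrm f"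
  by (simp_all add: H_space_def H_norm_eq L2_space_def)

lemma H0_space_simps [simp]:
  "ns_eq (H0_space \<Omega> b \<Gamma>) f g \<longleftrightarrow> (AE x in M. f x = g x)"
  "ns_add (H0_space \<Omega> b \<Gamma>) f g = (\<lambda>x. f x + g x)"
  "ns_scale (H0_space \<Omega> b \<Gamma>) r f = (\<lambda>x. r * f x)"
  "ns_norm (H0_space \<Omega> b \<Gamma>) f = H.nrm f"
  by (simp_all add: H0_space_def)

lemma Hh_space_simps [simp]:
  "ns_eq (Hh_space \<Omega> \<K> b) f g \<longleftrightarrow> (AE x in M. f x = g x)"
  "ns_add (Hh_space \<Omega> \<K> b) f g = (\<lambda>x. f x + g x)"
  "ns_scale (Hh_space \<Omega> \<K> b) r f = (\<lambda>x. r * f x)"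
  by (simp_all add: Hh_space_def L2_space_def)

lemma H0_iff: "u \<in> ns_elems (H0_space \<Omega> b \<Gamma>) \<longleftrightarrow> u \<in> ns_elems (H_space \<Omega> b) \<and>
    (\<forall>\<epsilon>>0. \<exists>w\<in>H_cont \<Omega> b. (\<forall>x\<in>\<Gamma>. w x = 0) \<and> H.nrm (\<lambda>x. u x - w x) < \<epsilon>)"
  by (simp add: H0_space_def H_norm_eq)

lemma H0_H: "u \<in> ns_elems (H0_space \<Omega> b \<Gamma>) \<Longrightarrow> u \<in> ns_elems (H_space \<Omega> b)"
  by (simp add: H0_iff)

lemma H0_add:
  assumes u: "u \<in> ns_elems (H0_space \<Omega> b \<Gamma>)" and v: "v \<in> ns_elems (H0_space \<Omega> b \<Gamma>)"
  shows "(\<lambda>x. u x + v x) \<in> ns_elems (H0_space \<Omega> b \<Gamma>)"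
  unfolding H0_iff
proof (intro conjI allI impI)
  have uH: "u \<in> ns_elems (H_space \<Omega> b)" and vH: "v \<in> ns_elems (H_space \<Omega> b)" using u v H0_H by auto
  then show "(\<lambda>x. u x + v x) \<in> ns_elems (H_space \<Omega> b)" by (rule H.add)
  fix \<epsilon> :: real assume "\<epsilon> > 0"
  then have e: "\<epsilon> / 2 > 0" by simp
  obtain w where w: "w \<in> H_cont \<Omega> b" "\<forall>x\<in>\<Gamma>. w x = 0" "H.nrm (\<lambda>x. u x - w x) < \<epsilon> / 2"
    using u e unfolding H0_iff by blast
  obtain z where z: "z \<in> H_cont \<Omega> b" "\<forall>x\<in>\<Gamma>. z x = 0" "H.nrm (\<lambda>x. v x - z x) < \<epsilon> / 2"
    using v e unfolding H0_iff by blast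
  have wz: "w \<in> ns_elems (H_space \<Omega> b)" "z \<in> ns_elems (H_space \<Omega> b)" using w z by (auto simp: H_cont_iff)
  have "H.nrm (\<lambda>x. (u x - w x) + (v x - z x)) \<le> H.nrm (\<lambda>x. u x - w x) + H.nrm (\<lambda>x. v x - z x)"
    by (intro H.triangle H.diff uH vH wz)
  moreover have "(\<lambda>x. (u x - w x) + (v x - z x)) = (\<lambda>x. (u x + v x) - (w x + z x))"
    by (simp add: fun_eq_iff)
  ultimately have "H.nrm (\<lambda>x. (u x + v x) - (w x + z x)) < \<epsilon>"
    using w(3) z(3) by simp
  moreover have "(\<lambda>x. w x + z x) \<in> H_cont \<Omega> b"
    using w z by (auto simp: H_cont_iff intro!: H.add continuous_intros)
  ultimately show "\<exists>w\<in>H_cont \<Omega> b. (\<forall>x\<in>\<Gamma>. w x = 0) \<and> H.nrm (\<lambda>x. (u x + v x) - w x) < \<epsilon>"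
    using w(2) z(2) by (intro bexI[of _ "\<lambda>x. w x + z x"]) auto
qed

lemma H0_scale:
  assumes u: "u \<in> ns_elems (H0_space \<Omega> b \<Gamma>)"
  shows "(\<lambda>x. r * u x) \<in> ns_elems (H0_space \<Omega> b \<Gamma>)"
  unfolding H0_iff
proof (intro conjI allI impI)
  have uH: "u \<in> ns_elems (H_space \<Omega> b)" using u H0_H by auto
  then show "(\<lambda>x. r * u x) \<in> ns_elems (H_space \<Omega> b)" by (rule H.scale)
  fix \<epsilon> :: real assume e: "\<epsilon> > 0"
  then have "\<epsilon> / (\<bar>r\<bar> + 1) > 0" by (simp add: add_nonneg_pos)
  then obtain w where w: "w \<in> H_cont \<Omega> b" "\<forall>x\<in>\<Gamma>. w x = 0" "H.nrm (\<lambda>x. u x - w x) < \<epsilon> / (\<bar>r\<bar> + 1)"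
    using u unfolding H0_iff by blast
  have wH: "w \<in> ns_elems (H_space \<Omega> b)" using w by (auto simp: H_cont_iff)
  have n: "0 \<le> H.nrm (\<lambda>x. u x - w x)" by (intro H.nrm_nonneg H.diff uH wH)
  have "H.nrm (\<lambda>x. r * u x - r * w x) = \<bar>r\<bar> * H.nrm (\<lambda>x. u x - w x)"
    using H.nrm_scale[OF H.diff[OF uH wH], of r] by (simp add: right_diff_distrib)
  also have "\<dots> \<le> (\<bar>r\<bar> + 1) * H.nrm (\<lambda>x. u x - w x)" using n by (intro mult_right_mono) auto
  also have "\<dots> < \<epsilon>" using w(3) by (simp add: field_simps)
  finally have "H.nrm (\<lambda>x. r * u x - r * w x) < \<epsilon>" .
  moreover have "(\<lambda>x. r * w x) \<in> H_cont \<Omega> b"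
    using w by (auto simp: H_cont_iff intro!: H.scale continuous_intros)
  ultimately show "\<exists>w\<in>H_cont \<Omega> b. (\<forall>x\<in>\<Gamma>. w x = 0) \<and> H.nrm (\<lambda>x. r * u x - w x) < \<epsilon>"
    using w(2) by (intro bexI[of _ "\<lambda>x. r * w x"]) auto
qed

text \<open>Compact support in an open set gives zero boundary values. Consequently a functional
  that vanishes on the domain of the adjoint vanishes on all test functions.\<close>

lemma test_H0:
  assumes \<phi>: "\<phi> \<in> test_functions \<Omega>" and \<Gamma>: "\<Gamma> \<subseteq> frontier \<Omega>"
  shows "\<phi> \<in> ns_elems (H0_space \<Omega> b \<Gamma>)"
  unfolding H0_iff
proof (intro conjI allI impI)
  show H: "\<phi> \<in> ns_elems (H_space \<Omega> b)" by (rule weak_imp_H(1)[OF weak_test[OF \<phi>]])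
  fix \<epsilon> :: real assume "\<epsilon> > 0"
  moreover have "\<phi> \<in> H_cont \<Omega> b" using H test_functions_continuous[OF \<phi>] by (simp add: H_cont_iff)
  moreover have "\<phi> x = 0" if "x \<in> \<Gamma>" for x
    using that \<Gamma> open_\<Omega> by (intro test_functions_outside[OF \<phi>]) (auto simp: frontier_def interior_open)
  ultimately show "\<exists>w\<in>H_cont \<Omega> b. (\<forall>x\<in>\<Gamma>. w x = 0) \<and> H.nrm (\<lambda>x. \<phi> x - w x) < \<epsilon>"
    using H.nrm_zero by (intro bexI[of _ \<phi>]) auto
qed

lemma zero_H0: "(\<lambda>x. 0) \<in> ns_elems (H0_space \<Omega> b \<Gamma>)"
proof -
  have "(\<lambda>x. 0) \<in> H_cont \<Omega> b" by (simp add: H_cont_iff H.zero)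
  then show ?thesis
    unfolding H0_iff using H.nrm_zero H.zero by (auto intro!: bexI[of _ "\<lambda>x. 0"])
qed

lemma seminormed_H0: "seminormed (H0_space \<Omega> b \<Gamma>)"
  by (auto simp: seminormed_def H.nrm_scale H0_H H0_scale intro!: H_nrm_AE)

end

section \<open>The skeleton form and the adjoint identity\<close>

locale dpg = transport_characteristic +
  fixes \<Gamma>p \<Gamma>m and c :: "'a \<Rightarrow> real" and \<K>
  assumes \<Gamma>pm: "frontier \<Omega> - \<Gamma>0 \<subseteq> \<Gamma>p \<union> \<Gamma>m" and \<Gamma>p: "\<Gamma>p \<subseteq> frontier \<Omega>"
    and c_Linf: "c \<in> Linf \<Omega>"
    and mesh_\<K>: "mesh \<K>"
    and B_inv: "boundedly_invertible (H0_space \<Omega> b \<Gamma>m) (L2_space \<Omega>) (B_op \<Omega> b c)"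
    and B_star_inv: "boundedly_invertible (H0_space \<Omega> b \<Gamma>p) (L2_space \<Omega>) (B_star \<Omega> b c)"
begin

abbreviation "Hs \<equiv> ns_elems (H_space \<Omega> b)"
abbreviation "H0m \<equiv> ns_elems (H0_space \<Omega> b \<Gamma>m)"
abbreviation "H0p \<equiv> ns_elems (H0_space \<Omega> b \<Gamma>p)"
abbreviation "V \<equiv> Hh_space \<Omega> \<K> b"
abbreviation "Dh \<equiv> bgrad_h \<K> b"
abbreviation "D \<equiv> bgrad \<Omega> b"
abbreviation "sk \<equiv> skeleton_int \<Omega> \<K> b"
abbreviation "invB \<equiv> inverse_op (H0_space \<Omega> b \<Gamma>m) (L2_space \<Omega>) (B_op \<Omega> b c)"
abbreviation "invBs \<equiv> inverse_op (H0_space \<Omega> b \<Gamma>p) (L2_space \<Omega>) (B_star \<Omega> b c)"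
abbreviation "\<beta> \<equiv> op_norm (L2_space \<Omega>) (H0_space \<Omega> b \<Gamma>m) invB"
abbreviation "\<beta>s \<equiv> op_norm (L2_space \<Omega>) (H0_space \<Omega> b \<Gamma>p) invBs"
abbreviation "cd \<equiv> \<lambda>x. c x - d x"
abbreviation "m \<equiv> Linf_norm \<Omega> cd"
abbreviation "\<delta> \<equiv> Linf_norm \<Omega> d"
abbreviation "Bh \<equiv> Bh_op \<Omega> \<K> b c"

sublocale V: graph_space M "ns_elems V" Dh
  by (rule graph_space_Hh[OF mesh_\<K>])

sublocale VH: semi_hilbert_space "ns_elems V" V.gip
  by (rule semi_hilbert_Hh[OF mesh_\<K>])

lemma norm_V [simp]: "ns_norm V v = V.nrm v"
  by (simp add: Hh_space_def V.nrm_eq L2_norm_eq)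

text \<open>Two representatives may have different chosen derivatives, but these agree almost
  everywhere. Hence bounded linear functionals respect almost everywhere equality.\<close>

lemma V_AE_nrm:
  assumes v: "v \<in> ns_elems V" "w \<in> ns_elems V" and ae: "AE x in M. v x = w x"
  shows "V.nrm (\<lambda>x. v x - w x) = 0"
proof -
  have "weak \<K> (\<lambda>x. v x - w x) (\<lambda>x. Dh v x - Dh w x)"
    by (intro weak_diff Hh_imp_weak mesh_\<K> v)
  have "weak \<K> w (Dh v)"
    by (rule weak_AE[OF Hh_imp_weak[OF mesh_\<K> v(1)] _ ae])
      (auto intro: square_integrable_measurable V.S_sq V.D_sq v)
  from weak_imp_Hh(2)[OF mesh_\<K> this] have "AE x in M. Dh (\<lambda>x. v x - w x) x = 0"
    using V.D_diff[OF v] by eventually_elim simp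
  moreover have "AE x in M. v x - w x = 0" using ae by eventually_elim simp
  ultimately have "V.gip (\<lambda>x. v x - w x) (\<lambda>x. v x - w x) = 0"
    unfolding V.gip_def by (auto intro!: integral_eq_zero_AE simp: add_nonneg_eq_0_iff elim: eventually_mono)
  then show ?thesis by (simp add: V.nrm_def)
qed

lemma H_sub_V: "w \<in> Hs \<Longrightarrow> w \<in> ns_elems V"
  by (rule H_subset_Hh(1)[OF mesh_\<K>])

lemma Dh_eq_D: "w \<in> Hs \<Longrightarrow> AE x in M. Dh w x = D w x"
  by (rule H_subset_Hh(2)[OF mesh_\<K>])

lemma V_nrm_H: assumes "w \<in> Hs" shows "V.nrm w = H.nrm w"
proof -
  have "l2norm M (Dh w) = l2norm M (D w)"
    by (rule l2norm_AE_cong[OF _ _ Dh_eq_D[OF assms]])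
      (intro square_integrable_measurable V.D_sq H.D_sq H_sub_V assms)+
  then show ?thesis by (simp add: V.nrm_eq H.nrm_eq)
qed

lemma seminormed_V: "seminormed V"
proof -
  have "V.nrm v = V.nrm w" if v: "v \<in> ns_elems V" "w \<in> ns_elems V" "AE x in M. v x = w x" for v w
  proof -
    have "V.nrm v \<le> V.nrm w" if vw: "v \<in> ns_elems V" "w \<in> ns_elems V" "AE x in M. v x = w x" for v w
      using V.triangle[OF V.diff[OF vw(1,2)] vw(2)] V_AE_nrm[OF vw] by simp
    moreover have "AE x in M. w x = v x" using v(3) by eventually_elim simp
    ultimately show ?thesis using v by (meson order_antisym)
  qed
  then show ?thesis
    unfolding seminormed_def Hh_space_simps norm_V
    by (intro conjI ballI allI impI V.nrm_scale V.scale V.nrm_nonneg)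
qed

lemma cd_Linf: "cd \<in> Linf \<Omega>"
  by (rule Linf_diff[OF c_Linf d_Linf])

lemma l2norm_Linf_mult:
  assumes "f \<in> Linf \<Omega>" "v \<in> square_integrable M"
  shows "l2norm M (\<lambda>x. f x * v x) \<le> Linf_norm \<Omega> f * l2norm M v"
  by (rule l2norm_bounded_mult[OF assms(2) Linf_measurable[OF assms(1)] Linf_AE[OF assms(1)] Linf_norm_nonneg])

lemma sk_eq:
  assumes v: "v \<in> ns_elems V" and w: "w \<in> Hs"
  shows "sk v w = (LINT x|M. Dh v x * w x) + (LINT x|M. v x * D w x) + (LINT x|M. v x * (d x * w x))"
  using skeleton_int_eq[OF mesh_\<K> v w] V.S_sq[OF v] H.D_sq[OF w] sq_Linf_mult[OF d_Linf H.S_sq[OF w]]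
  by (simp add: distrib_left integrable_mult_square_integrable)

lemma sk_add_right:
  assumes v: "v \<in> ns_elems V" and w: "w \<in> Hs" "z \<in> Hs"
  shows "sk v (\<lambda>x. w x + z x) = sk v w + sk v z"
proof -
  note sq = V.S_sq[OF v] V.D_sq[OF v] w[THEN H.S_sq] w[THEN H.D_sq] w[THEN H.S_sq, THEN sq_Linf_mult[OF d_Linf]]
  have "(LINT x|M. v x * D (\<lambda>x. w x + z x) x) = (LINT x|M. v x * (D w x + D z x))"
    by (rule integral_mult_AE_cong)
      (simp_all add: sq H.D_sq H.add w square_integrable_add H.D_add)
  then show ?thesis
    using sq by (simp add: sk_eq v w H.add distrib_left integrable_mult_square_integrable)
qed

lemma sk_scale_right:
  assumes v: "v \<in> ns_elems V" and w: "w \<in> Hs"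
  shows "sk v (\<lambda>x. r * w x) = r * sk v w"
proof -
  have "(LINT x|M. v x * D (\<lambda>x. r * w x) x) = (LINT x|M. v x * (r * D w x))"
    by (rule integral_mult_AE_cong)
      (simp_all add: H.D_sq H.scale w V.S_sq v square_integrable_scale H.D_scale)
  then show ?thesis
    by (simp add: sk_eq v w H.scale distrib_left mult.left_commute[of _ r])
qed

lemma sk_diff_right:
  assumes v: "v \<in> ns_elems V" and w: "w \<in> Hs" "z \<in> Hs"
  shows "sk v (\<lambda>x. w x - z x) = sk v w - sk v z"
  using sk_add_right[OF v w(1) H.scale[OF w(2), of "-1"]] sk_scale_right[OF v w(2), of "-1"] by simp

lemma sk_add_left:
  assumes v: "v \<in> ns_elems V" "z \<in> ns_elems V" and w: "w \<in> Hs"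
  shows "sk (\<lambda>x. v x + z x) w = sk v w + sk z w"
proof -
  note sq = v[THEN V.S_sq] v[THEN V.D_sq] H.S_sq[OF w] H.D_sq[OF w] sq_Linf_mult[OF d_Linf H.S_sq[OF w]]
  have "(LINT x|M. Dh (\<lambda>x. v x + z x) x * w x) = (LINT x|M. (Dh v x + Dh z x) * w x)"
    by (rule integral_mult_AE_cong)
      (simp_all add: sq V.D_sq V.add v square_integrable_add V.D_add)
  then show ?thesis
    using sq by (simp add: sk_eq v w V.add distrib_right integrable_mult_square_integrable)
qed

lemma sk_scale_left:
  assumes v: "v \<in> ns_elems V" and w: "w \<in> Hs"
  shows "sk (\<lambda>x. r * v x) w = r * sk v w"
proof -
  have "(LINT x|M. Dh (\<lambda>x. r * v x) x * w x) = (LINT x|M. (r * Dh v x) * w x)"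
    by (rule integral_mult_AE_cong)
      (simp_all add: V.D_sq V.scale v H.S_sq w square_integrable_scale V.D_scale)
  then show ?thesis
    by (simp add: sk_eq v w V.scale distrib_left mult.assoc)
qed

lemma sk_AE_right:
  assumes v: "v \<in> ns_elems V" and w: "w \<in> Hs" "z \<in> Hs" and wz: "AE x in M. w x = z x"
  shows "sk v w = sk v z"
proof -
  have D: "AE x in M. D w x = D z x"
    by (rule H_AE(2)[OF w(1) square_integrable_measurable[OF H.S_sq[OF w(2)]] wz])
  have dwz: "AE x in M. d x = 0 \<or> w x = z x" using wz by eventually_elim simp
  have "(LINT x|M. Dh v x * w x) = (LINT x|M. Dh v x * z x)"
    "(LINT x|M. v x * D w x) = (LINT x|M. v x * D z x)"
    "(LINT x|M. v x * (d x * w x)) = (LINT x|M. v x * (d x * z x))"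
    by (rule integral_mult_AE_cong;
        simp add: v w wz D dwz V.S_sq V.D_sq H.S_sq H.D_sq sq_Linf_mult d_Linf)+
  then show ?thesis by (simp add: sk_eq v w)
qed

text \<open>The two derivative terms together cost the constant 1 and the divergence term costs
  \<open>\<delta>\<close>.\<close>

lemma sk_bound:
  assumes v: "v \<in> ns_elems V" and w: "w \<in> Hs"
  shows "\<bar>sk v w\<bar> \<le> (1 + \<delta>) * V.nrm v * H.nrm w"
proof -
  define a where "a = l2norm M v"
  define a' where "a' = l2norm M (Dh v)"
  define e where "e = l2norm M w"
  define e' where "e' = l2norm M (D w)"
  have nn: "0 \<le> a" "0 \<le> a'" "0 \<le> e" "0 \<le> e'"
    unfolding a_def a'_def e_def e'_def by (intro L2.nrm_nonneg V.S_sq V.D_sq H.S_sq H.D_sq v w)+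
  have "\<bar>LINT x|M. Dh v x * w x\<bar> \<le> a' * e" "\<bar>LINT x|M. v x * D w x\<bar> \<le> a * e'"
    unfolding a_def a'_def e_def e'_def by (intro L2.Cauchy_Schwarz V.S_sq V.D_sq H.S_sq H.D_sq v w)+
  moreover have "a' * e + a * e' \<le> V.nrm v * H.nrm w"
  proof -
    \<comment> \<open>Cauchy-Schwarz in the plane: the difference of the two sides is
      \<open>(a e - a' e')^2\<close>. Estimating the two products separately would give 2 instead of
      1.\<close>
    have "(a' * e + a * e')\<^sup>2 \<le> (a\<^sup>2 + a'\<^sup>2) * (e\<^sup>2 + e'\<^sup>2)"
      using sum_squares_ge_zero[of "a * e - a' * e'" 0] by (simp add: power2_eq_square algebra_simps)
    then have "a' * e + a * e' \<le> sqrt ((a\<^sup>2 + a'\<^sup>2) * (e\<^sup>2 + e'\<^sup>2))" by (rule real_le_rsqrt)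
    then show ?thesis by (simp add: V.nrm_eq H.nrm_eq real_sqrt_mult a_def a'_def e_def e'_def)
  qed
  moreover have "\<bar>LINT x|M. v x * (d x * w x)\<bar> \<le> \<delta> * (V.nrm v * H.nrm w)"
  proof -
    have "\<bar>LINT x|M. v x * (d x * w x)\<bar> \<le> a * l2norm M (\<lambda>x. d x * w x)"
      unfolding a_def by (intro L2.Cauchy_Schwarz V.S_sq v sq_Linf_mult d_Linf H.S_sq w)
    also have "\<dots> \<le> a * (\<delta> * e)"
      unfolding e_def by (intro mult_left_mono l2norm_Linf_mult d_Linf H.S_sq w nn)
    also have "\<dots> = \<delta> * (a * e)" by simp
    also have "\<dots> \<le> \<delta> * (V.nrm v * H.nrm w)"
      using V.l2norm_le_nrm[of v] H.l2norm_le_nrm[of w] nn V.nrm_nonneg[OF v]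
      by (intro mult_left_mono mult_mono) (auto simp: a_def e_def Linf_norm_nonneg)
    finally show ?thesis .
  qed
  ultimately have "\<bar>sk v w\<bar> \<le> V.nrm v * H.nrm w + \<delta> * (V.nrm v * H.nrm w)"
    unfolding sk_eq[OF v w] by linarith
  then show ?thesis by (simp add: algebra_simps)
qed

text \<open>On a globally differentiable \<open>v\<close> the piecewise derivative is the global
  one, so the skeleton term reduces to the form on \<open>\<Omega>\<close>, without contributions
  from interior faces. Then \<open>\<Gamma>pm\<close> makes the boundary form vanish.\<close>

lemma sk_zero:
  assumes v: "v \<in> H0p" and w: "w \<in> H0m" shows "sk v w = 0"
proof -
  note H = H0_H[OF v] H0_H[OF w]
  have "(LINT x|M. Dh v x * w x) = (LINT x|M. D v x * w x)"
    by (rule integral_mult_AE_cong) (simp_all add: Dh_eq_D H V.D_sq H_sub_V H.D_sq H.S_sq)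
  then have "sk v w = (LINT x|M. D v x * w x) + (LINT x|M. v x * (D w x + d x * w x))"
    using skeleton_int_eq[OF mesh_\<K> H_sub_V[OF H(1)] H(2)] by simp
  also have "\<dots> = 0" by (rule boundary_form_H0_zero[OF \<Gamma>pm v w])
  finally show ?thesis .
qed

lemma same_trace_iff:
  assumes "w \<in> Hs" "z \<in> Hs"
  shows "same_trace \<Omega> \<K> b w z \<longleftrightarrow> (\<forall>v\<in>ns_elems V. sk v w = sk v z)"
  using assms by (auto simp: same_trace_def sk_diff_right)

text \<open>The piecewise version of \<open>B_star\<close>, since
  \<open>div (v b) = D v + d v\<close>; it is what multiplies \<open>u\<close> in
  \<open>Bh\<close>.\<close>

definition A :: "('a \<Rightarrow> real) \<Rightarrow> 'a \<Rightarrow> real" where "A v x = cd x * v x - Dh v x"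

lemma A_sq: "v \<in> ns_elems V \<Longrightarrow> A v \<in> square_integrable M"
  unfolding A_def[abs_def] by (intro square_integrable_diff sq_Linf_mult cd_Linf V.S_sq V.D_sq)

lemma A_add: "v \<in> ns_elems V \<Longrightarrow> w \<in> ns_elems V \<Longrightarrow> AE x in M. A (\<lambda>x. v x + w x) x = A v x + A w x"
  using V.D_add[of v w] by (auto simp: A_def algebra_simps elim!: eventually_mono)

lemma A_scale: "v \<in> ns_elems V \<Longrightarrow> AE x in M. A (\<lambda>x. r * v x) x = r * A v x"
  using V.D_scale[of v r] by (auto simp: A_def algebra_simps elim!: eventually_mono)

lemma A_bound: assumes v: "v \<in> ns_elems V" shows "l2norm M (A v) \<le> (m + 1) * V.nrm v"
proof -
  have "l2norm M (A v) \<le> l2norm M (\<lambda>x. cd x * v x) + l2norm M (Dh v)"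
    unfolding A_def[abs_def] by (intro L2.triangle_diff sq_Linf_mult cd_Linf V.S_sq V.D_sq v)
  also have "\<dots> \<le> m * l2norm M v + l2norm M (Dh v)"
    using l2norm_Linf_mult[OF cd_Linf V.S_sq[OF v]] by simp
  also have "\<dots> \<le> m * V.nrm v + V.nrm v"
    by (intro add_mono mult_left_mono V.l2norm_le_nrm V.l2norm_D_le_nrm Linf_norm_nonneg)
  finally show ?thesis by (simp add: algebra_simps)
qed

lemma Bh_eq: "Bh (u, \<theta>) v = (LINT x|M. A v x * u x) + sk v \<theta>"
  by (simp add: Bh_op_def A_def algebra_simps)

lemma B_star_eq: "B_star \<Omega> b c v x = cd x * v x - D v x"
  by (simp add: B_star_def bgrad_def algebra_simps)

lemma A_eq_B_star: assumes "v \<in> Hs" shows "AE x in M. A v x = B_star \<Omega> b c v x"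
  using Dh_eq_D[OF assms] by eventually_elim (simp add: A_def B_star_eq)

lemma B_star_sq: "v \<in> Hs \<Longrightarrow> B_star \<Omega> b c v \<in> square_integrable M"
  unfolding B_star_eq[abs_def] by (intro square_integrable_diff sq_Linf_mult cd_Linf H.S_sq H.D_sq)

lemma B_op_sq: "w \<in> Hs \<Longrightarrow> B_op \<Omega> b c w \<in> square_integrable M"
  unfolding B_op_def by (intro square_integrable_add sq_Linf_mult c_Linf H.S_sq H.D_sq)

text \<open>The integrands agree pointwise once \<open>sk v w\<close> is expanded. The skeleton term
  plays the part of the boundary term, so that the identity covers both functions with inflow
  condition and the \<open>s\<close> of \<open>trace_lift\<close>, for which that condition is still
  unknown.\<close>

lemma adjoint_identity:
  assumes v: "v \<in> Hs" and w: "w \<in> Hs"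
  shows "(LINT x|M. A v x * w x) + sk v w = (LINT x|M. v x * B_op \<Omega> b c w x)"
proof -
  note vV = H_sub_V[OF v]
  note sq = A_sq[OF vV] V.D_sq[OF vV] H.S_sq[OF v] H.S_sq[OF w] H.D_sq[OF w] sq_Linf_mult[OF d_Linf H.S_sq[OF w]]
  have "(LINT x|M. A v x * w x) + sk v w
      = (LINT x|M. A v x * w x + Dh v x * w x + v x * D w x + v x * (d x * w x))"
    using sq by (simp add: sk_eq vV w integrable_mult_square_integrable)
  also have "\<dots> = (LINT x|M. v x * B_op \<Omega> b c w x)"
    by (rule Bochner_Integration.integral_cong) (auto simp: A_def B_op_def algebra_simps)
  finally show ?thesis .
qed

lemma invB:
  assumes "y \<in> square_integrable M"
  shows "invB y \<in> H0m" "AE x in M. B_op \<Omega> b c (invB y) x = y x" "H.nrm (invB y) \<le> \<beta> * l2norm M y"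
  using inverse_op_props[of "H0_space \<Omega> b \<Gamma>m" "L2_space \<Omega>" "B_op \<Omega> b c" y] B_inv assms
    op_norm_bound[of "L2_space \<Omega>" "H0_space \<Omega> b \<Gamma>m" invB y, OF _ seminormed_L2_space seminormed_H0]
  by (auto simp: boundedly_invertible_def)

lemma invBs:
  assumes "y \<in> square_integrable M"
  shows "invBs y \<in> H0p" "AE x in M. B_star \<Omega> b c (invBs y) x = y x" "H.nrm (invBs y) \<le> \<beta>s * l2norm M y"
  using inverse_op_props[of "H0_space \<Omega> b \<Gamma>p" "L2_space \<Omega>" "B_star \<Omega> b c" y] B_star_inv assms
    op_norm_bound[of "L2_space \<Omega>" "H0_space \<Omega> b \<Gamma>p" invBs y, OF _ seminormed_L2_space seminormed_H0]
  by (auto simp: boundedly_invertible_def)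

lemma \<beta>_nonneg: "0 \<le> \<beta>" and \<beta>s_nonneg: "0 \<le> \<beta>s"
  using op_norm_nonneg[of "L2_space \<Omega>" "H0_space \<Omega> b \<Gamma>m" invB "\<lambda>x. 0", OF _ seminormed_L2_space seminormed_H0]
    op_norm_nonneg[of "L2_space \<Omega>" "H0_space \<Omega> b \<Gamma>p" invBs "\<lambda>x. 0", OF _ seminormed_L2_space seminormed_H0]
    B_inv B_star_inv L2.zero by (auto simp: boundedly_invertible_def)

text \<open>If \<open>r\<close> is the Riesz representative of \<open>g\<close>, then \<open>g v = \<integral> r v + \<integral> (Dh r) (Dh v)\<close>. As \<open>g\<close>
  vanishes on test functions, \<open>s = Dh r\<close> has the derivative \<open>r - d s\<close>, and hence the jump
  functional of \<open>s\<close> is \<open>g\<close>. As \<open>g\<close> vanishes on the domain of the adjoint, \<open>s\<close> inherits the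
  inflow condition from \<open>invB (B s)\<close>.\<close>

lemma trace_lift:
  assumes g_add: "\<And>u v. u \<in> ns_elems V \<Longrightarrow> v \<in> ns_elems V \<Longrightarrow> g (\<lambda>x. u x + v x) = g u + g v"
    and g_scale: "\<And>r u. u \<in> ns_elems V \<Longrightarrow> g (\<lambda>x. r * u x) = r * g u"
    and g_bound: "\<And>u. u \<in> ns_elems V \<Longrightarrow> \<bar>g u\<bar> \<le> G * V.nrm u"
    and G: "0 \<le> G" and g_zero: "\<And>v. v \<in> H0p \<Longrightarrow> g v = 0"
  shows "\<exists>w\<in>H0m. (\<forall>v\<in>ns_elems V. sk v w = g v) \<and> H.nrm w \<le> \<beta> * ((m + 1) * G)"
proof -
  obtain r where r: "r \<in> ns_elems V" "\<And>v. v \<in> ns_elems V \<Longrightarrow> g v = V.gip r v"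
    using VH.Riesz[of g G] g_add g_scale g_bound by blast
  \<comment> \<open>The functional is tested with its own representative.\<close>
  have rG: "V.nrm r \<le> G"
  proof (cases "V.nrm r = 0")
    case False
    then have pos: "V.nrm r > 0" using V.nrm_nonneg[OF r(1)] by simp
    have "V.nrm r * V.nrm r = g r" using V.nrm_sq[OF r(1)] r by (simp add: power2_eq_square)
    also have "\<dots> \<le> G * V.nrm r" using g_bound[OF r(1)] by simp
    finally show ?thesis using pos by simp
  qed (use G in simp)
  define s where "s = Dh r"
  note rs = V.S_sq[OF r(1)] V.D_sq[OF r(1), folded s_def]
  have ds: "(\<lambda>x. d x * s x) \<in> square_integrable M" by (rule sq_Linf_mult[OF d_Linf rs(2)])
  have ws: "weak {\<Omega>} s (\<lambda>x. r x - d x * s x)"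
    unfolding weak_def
  proof (intro conjI ballI rs square_integrable_diff[OF rs(1) ds])
    fix K \<phi> assume "K \<in> {\<Omega>}" "\<phi> \<in> test_functions K"
    then have \<phi>: "\<phi> \<in> test_functions \<Omega>" by simp
    have \<phi>H0: "\<phi> \<in> H0p" by (rule test_H0[OF \<phi> \<Gamma>p])
    note \<phi>H = H0_H[OF \<phi>H0]
    have "AE x in M. Dh \<phi> x = pd \<phi> x"
      using Dh_eq_D[OF \<phi>H] weak_imp_H(2)[OF weak_test[OF \<phi>]] by eventually_elim simp
    then have "(LINT x|M. s x * Dh \<phi> x) = (LINT x|M. s x * pd \<phi> x)"
      by (intro integral_mult_AE_cong rs V.D_sq H_sub_V \<phi>H pd_sq[OF \<phi>]) auto
    then have 1: "(LINT x|M. r x * \<phi> x) + (LINT x|M. s x * pd \<phi> x) = 0"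
      using g_zero[OF \<phi>H0] r(2)[OF H_sub_V[OF \<phi>H]] by (simp add: V.gip_def s_def)
    have "(LINT x|M. s x * adj \<phi> x) + (LINT x|M. (r x - d x * s x) * \<phi> x)
        = (LINT x|M. s x * adj \<phi> x + (r x - d x * s x) * \<phi> x)"
      using rs adj_sq[OF \<phi>] test_sq[OF \<phi>] square_integrable_diff[OF rs(1) ds]
      by (simp add: integrable_mult_square_integrable)
    \<comment> \<open>The zeroth order part \<open>d s \<phi>\<close> of
      \<open>s (adj \<phi>)\<close> cancels against the correction \<open>- d s\<close> in the
      derivative.\<close>
    also have "\<dots> = (LINT x|M. r x * \<phi> x + s x * pd \<phi> x)"
      by (simp add: adj_def algebra_simps)
    also have "\<dots> = 0" using 1 rs pd_sq[OF \<phi>] test_sq[OF \<phi>]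
      by (simp add: integrable_mult_square_integrable)
    finally show "(LINT x|M. s x * adj \<phi> x) + (LINT x|M. (r x - d x * s x) * \<phi> x) = 0" .
  qed
  have sH: "s \<in> Hs" and Ds: "AE x in M. D s x = r x - d x * s x" using weak_imp_H[OF ws] by auto
  have sk_s: "sk v s = g v" if v: "v \<in> ns_elems V" for v
  proof -
    have "AE x in M. D s x + d x * s x = r x" using Ds by eventually_elim simp
    then have "(LINT x|M. v x * (D s x + d x * s x)) = (LINT x|M. v x * r x)"
      by (intro integral_mult_AE_cong) (simp_all add: V.S_sq v square_integrable_add H.D_sq sH ds rs)
    then show ?thesis
      using skeleton_int_eq[OF mesh_\<K> v sH] r(2)[OF v] by (simp add: V.gip_def s_def mult.commute)
  qed
  define y where "y = B_op \<Omega> b c s"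
  have y: "y \<in> square_integrable M" unfolding y_def by (rule B_op_sq[OF sH])
  define w where "w = invB y"
  have w: "w \<in> H0m" "AE x in M. B_op \<Omega> b c w x = y x" "H.nrm w \<le> \<beta> * l2norm M y"
    unfolding w_def using invB[OF y] by auto
  note wH = H0_H[OF w(1)]
  \<comment> \<open>Both functions have the same image under \<open>B\<close>. Testing with the
    preimage of \<open>w - s\<close> under the adjoint removes both skeleton terms, one by
    \<open>sk_zero\<close>, the other because \<open>g\<close> vanishes on the domain of the
    adjoint; what is left is the square of the norm of \<open>w - s\<close>.\<close>
  have "AE x in M. w x - s x = 0"
  proof -
    have ws: "(\<lambda>x. w x - s x) \<in> square_integrable M" by (intro square_integrable_diff H.S_sq wH sH)
    define v where "v = invBs (\<lambda>x. w x - s x)"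
    have v: "v \<in> H0p" "AE x in M. B_star \<Omega> b c v x = w x - s x"
      unfolding v_def using invBs[OF ws] by auto
    note vH = H0_H[OF v(1)]
    have "(LINT x|M. A v x * w x) = (LINT x|M. v x * y x)"
      using adjoint_identity[OF vH wH] sk_zero[OF v(1) w(1)]
        integral_mult_AE_cong[OF H.S_sq[OF vH] H.S_sq[OF vH] _ B_op_sq[OF wH] y w(2)] by simp
    moreover have "(LINT x|M. A v x * s x) = (LINT x|M. v x * y x)"
      using adjoint_identity[OF vH sH] sk_s[OF H_sub_V[OF vH]] g_zero[OF v(1)] by (simp add: y_def)
    ultimately have "(LINT x|M. A v x * (w x - s x)) = 0"
      using A_sq[OF H_sub_V[OF vH]] H.S_sq[OF wH] H.S_sq[OF sH]
      by (simp add: right_diff_distrib integrable_mult_square_integrable)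
    moreover have "AE x in M. A v x = w x - s x"
      using A_eq_B_star[OF vH] v(2) by eventually_elim simp
    then have "(LINT x|M. A v x * (w x - s x)) = (LINT x|M. (w x - s x) * (w x - s x))"
      by (intro integral_mult_AE_cong A_sq H_sub_V vH ws) auto
    ultimately show ?thesis by (intro l2norm_zero_imp_AE[OF ws]) simp
  qed
  then have ae: "AE x in M. w x = s x" by eventually_elim simp
  have "l2norm M y \<le> (m + 1) * G"
  proof -
    have cs: "(\<lambda>x. cd x * s x) \<in> square_integrable M" by (rule sq_Linf_mult[OF cd_Linf rs(2)])
    \<comment> \<open>Here \<open>D s + c s = r - d s + c s\<close>. Since \<open>s = Dh r\<close>,
      the graph norm of \<open>r\<close>, at most \<open>G\<close>, bounds both \<open>r\<close> and
      \<open>s\<close>, whence the factor \<open>m + 1\<close>.\<close>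
    have "AE x in M. y x = r x + cd x * s x"
      using Ds by eventually_elim (simp add: y_def B_op_def algebra_simps)
    then have "l2norm M y = l2norm M (\<lambda>x. r x + cd x * s x)"
      by (intro l2norm_AE_cong square_integrable_measurable y square_integrable_add rs cs)
    also have "\<dots> \<le> l2norm M r + l2norm M (\<lambda>x. cd x * s x)" by (intro L2.triangle rs cs)
    also have "\<dots> \<le> l2norm M r + m * l2norm M s" using l2norm_Linf_mult[OF cd_Linf rs(2)] by simp
    also have "\<dots> \<le> G + m * G"
      using V.l2norm_le_nrm[of r] V.l2norm_D_le_nrm[of r] rG
      by (intro add_mono mult_left_mono Linf_norm_nonneg) (auto simp: s_def)
    finally show ?thesis by (simp add: algebra_simps)
  qed
  then have "H.nrm w \<le> \<beta> * ((m + 1) * G)"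
    using w(3) mult_left_mono[OF _ \<beta>_nonneg] order_trans by blast
  moreover have "sk v w = g v" if "v \<in> ns_elems V" for v
    using sk_AE_right[OF that wH sH ae] sk_s[OF that] by simp
  ultimately show ?thesis using w(1) by blast
qed

end

section \<open>The ultraweak operator\<close>

lemma real_space_simps [simp]:
  "ns_elems real_space = UNIV" "ns_eq real_space x y \<longleftrightarrow> x = y" "ns_add real_space x y = x + y"
  "ns_scale real_space x y = x * y" "ns_norm real_space x = \<bar>x\<bar>"
  by (simp_all add: real_space_def)

lemma dual_space_simps [simp]:
  "f \<in> ns_elems (dual_space X) \<longleftrightarrow> bounded_op X real_space f"
  "ns_eq (dual_space X) f g \<longleftrightarrow> (\<forall>x\<in>ns_elems X. f x = g x)"
  "ns_add (dual_space X) f g = (\<lambda>x. f x + g x)"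
  "ns_scale (dual_space X) r f = (\<lambda>x. r * f x)"
  "ns_norm (dual_space X) f = op_norm X real_space f"
  by (simp_all add: dual_space_def)

lemma prod_space_simps [simp]:
  "p \<in> ns_elems (prod_space X Y) \<longleftrightarrow> fst p \<in> ns_elems X \<and> snd p \<in> ns_elems Y"
  "ns_eq (prod_space X Y) p q \<longleftrightarrow> ns_eq X (fst p) (fst q) \<and> ns_eq Y (snd p) (snd q)"
  "ns_add (prod_space X Y) p q = (ns_add X (fst p) (fst q), ns_add Y (snd p) (snd q))"
  "ns_scale (prod_space X Y) r p = (ns_scale X r (fst p), ns_scale Y r (snd p))"
  "ns_norm (prod_space X Y) p = sqrt ((ns_norm X (fst p))\<^sup>2 + (ns_norm Y (snd p))\<^sup>2)"
  by (simp_all add: prod_space_def mem_Times_iff)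

section \<open>The quotient norm and the dual norm\<close>

context dpg begin

abbreviation "T \<equiv> trace_space \<Omega> \<K> b \<Gamma>m"
abbreviation "U \<equiv> prod_space (L2_space \<Omega>) T"

lemma trace_space_simps [simp]:
  "ns_elems T = H0m"
  "ns_eq T f g \<longleftrightarrow> same_trace \<Omega> \<K> b f g"
  "ns_add T f g = (\<lambda>x. f x + g x)"
  "ns_scale T r f = (\<lambda>x. r * f x)"
  by (simp_all add: trace_space_def H0_space_def H_space_def L2_space_def)

lemma trace_norm_eq: "ns_norm T \<theta> = Inf {H.nrm w | w. w \<in> H0m \<and> same_trace \<Omega> \<K> b \<theta> w}"
  by (simp add: trace_space_def H_norm_eq)

lemma trace_norm_le:
  assumes "w \<in> H0m" "same_trace \<Omega> \<K> b \<theta> w" shows "ns_norm T \<theta> \<le> H.nrm w"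
  unfolding trace_norm_eq
proof (rule cInf_lower)
  show "bdd_below {H.nrm w | w. w \<in> H0m \<and> same_trace \<Omega> \<K> b \<theta> w}"
    by (rule bdd_belowI[of _ 0]) (auto intro: H.nrm_nonneg H0_H)
qed (use assms in auto)

lemma same_trace_refl: "\<theta> \<in> H0m \<Longrightarrow> same_trace \<Omega> \<K> b \<theta> \<theta>"
  by (simp add: same_trace_iff H0_H)

lemma trace_norm_greatest:
  assumes \<theta>: "\<theta> \<in> H0m" and le: "\<And>w. w \<in> H0m \<Longrightarrow> same_trace \<Omega> \<K> b \<theta> w \<Longrightarrow> C \<le> H.nrm w"
  shows "C \<le> ns_norm T \<theta>"
  unfolding trace_norm_eq
proof (rule cInf_greatest)
  show "{H.nrm w | w. w \<in> H0m \<and> same_trace \<Omega> \<K> b \<theta> w} \<noteq> {}"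
    using same_trace_refl[OF \<theta>] \<theta> by blast
qed (use le in auto)

lemma trace_norm_nonneg: "\<theta> \<in> H0m \<Longrightarrow> 0 \<le> ns_norm T \<theta>"
  by (rule trace_norm_greatest) (auto intro: H.nrm_nonneg H0_H)

text \<open>The left side depends on the trace alone, so the bound holds with each representative
  and passes to the infimum. Dividing by the constant first requires it to be positive, hence the
  case distinction.\<close>

lemma sk_trace_bound:
  assumes v: "v \<in> ns_elems V" and \<theta>: "\<theta> \<in> H0m"
  shows "\<bar>sk v \<theta>\<bar> \<le> (1 + \<delta>) * V.nrm v * ns_norm T \<theta>"
proof -
  have b: "\<bar>sk v \<theta>\<bar> \<le> (1 + \<delta>) * V.nrm v * H.nrm w" if w: "w \<in> H0m" "same_trace \<Omega> \<K> b \<theta> w" for w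
    using sk_bound[OF v H0_H[OF w(1)]] w v \<theta> by (simp add: same_trace_iff H0_H)
  have nn: "0 \<le> (1 + \<delta>) * V.nrm v" using V.nrm_nonneg[OF v] Linf_norm_nonneg[of \<Omega> d] by simp
  show ?thesis
  proof (cases "(1 + \<delta>) * V.nrm v = 0")
    case True
    show ?thesis using b[OF \<theta> same_trace_refl[OF \<theta>]] unfolding True by simp
  next
    case False
    then have pos: "0 < (1 + \<delta>) * V.nrm v" using nn by linarith
    have "\<bar>sk v \<theta>\<bar> / ((1 + \<delta>) * V.nrm v) \<le> ns_norm T \<theta>"
      by (rule trace_norm_greatest[OF \<theta>]) (use b pos in \<open>simp add: pos_divide_le_eq mult.commute\<close>)
    then show ?thesis using pos by (simp add: pos_divide_le_eq mult.commute)
  qed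
qed

lemma Bh_left:
  assumes u: "u \<in> square_integrable M" and \<theta>: "\<theta> \<in> H0m"
  shows "v \<in> ns_elems V \<Longrightarrow> w \<in> ns_elems V \<Longrightarrow> Bh (u, \<theta>) (\<lambda>x. v x + w x) = Bh (u, \<theta>) v + Bh (u, \<theta>) w"
    and "v \<in> ns_elems V \<Longrightarrow> Bh (u, \<theta>) (\<lambda>x. r * v x) = r * Bh (u, \<theta>) v"
    and "v \<in> ns_elems V \<Longrightarrow> \<bar>Bh (u, \<theta>) v\<bar> \<le> ((m + 1) * l2norm M u + (1 + \<delta>) * ns_norm T \<theta>) * V.nrm v"
proof -
  note \<theta>H = H0_H[OF \<theta>]
  assume v: "v \<in> ns_elems V"
  have "(LINT x|M. A (\<lambda>x. r * v x) x * u x) = (LINT x|M. (r * A v x) * u x)"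
    by (rule integral_mult_AE_cong) (simp_all add: A_sq v V.scale u square_integrable_scale A_scale)
  then show "Bh (u, \<theta>) (\<lambda>x. r * v x) = r * Bh (u, \<theta>) v"
    by (simp add: Bh_eq sk_scale_left v \<theta>H distrib_left mult.assoc)
  have "\<bar>LINT x|M. A v x * u x\<bar> \<le> l2norm M (A v) * l2norm M u"
    by (intro L2.Cauchy_Schwarz A_sq v u)
  also have "\<dots> \<le> (m + 1) * V.nrm v * l2norm M u"
    by (intro mult_right_mono A_bound v L2.nrm_nonneg u)
  finally have "\<bar>Bh (u, \<theta>) v\<bar> \<le> (m + 1) * V.nrm v * l2norm M u + (1 + \<delta>) * V.nrm v * ns_norm T \<theta>"
    using sk_trace_bound[OF v \<theta>] unfolding Bh_eq by linarith
  then show "\<bar>Bh (u, \<theta>) v\<bar> \<le> ((m + 1) * l2norm M u + (1 + \<delta>) * ns_norm T \<theta>) * V.nrm v"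
    by (simp add: algebra_simps)
  assume w: "w \<in> ns_elems V"
  have "(LINT x|M. A (\<lambda>x. v x + w x) x * u x) = (LINT x|M. (A v x + A w x) * u x)"
    by (rule integral_mult_AE_cong) (simp_all add: A_sq v w V.add u square_integrable_add A_add)
  also have "\<dots> = (LINT x|M. A v x * u x) + (LINT x|M. A w x * u x)"
    by (simp add: distrib_right integrable_mult_square_integrable A_sq v w u)
  finally show "Bh (u, \<theta>) (\<lambda>x. v x + w x) = Bh (u, \<theta>) v + Bh (u, \<theta>) w"
    by (simp add: Bh_eq sk_add_left v w \<theta>H)
qed

lemma Bh_add:
  assumes "u \<in> square_integrable M" "u' \<in> square_integrable M" "\<theta> \<in> H0m" "\<theta>' \<in> H0m" "v \<in> ns_elems V"
  shows "Bh (\<lambda>x. u x + u' x, \<lambda>x. \<theta> x + \<theta>' x) v = Bh (u, \<theta>) v + Bh (u', \<theta>') v"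
  using assms by (simp add: Bh_eq sk_add_right H0_H distrib_left integrable_mult_square_integrable A_sq)

lemma Bh_scale:
  assumes "\<theta> \<in> H0m" "v \<in> ns_elems V"
  shows "Bh (\<lambda>x. r * u x, \<lambda>x. r * \<theta> x) v = r * Bh (u, \<theta>) v"
  using assms by (simp add: Bh_eq sk_scale_right H0_H distrib_left mult.left_commute[of _ r])

lemma Bh_cong:
  assumes "u \<in> square_integrable M" "u' \<in> square_integrable M" "AE x in M. u x = u' x"
    and "\<theta> \<in> H0m" "\<theta>' \<in> H0m" "same_trace \<Omega> \<K> b \<theta> \<theta>'" "v \<in> ns_elems V"
  shows "Bh (u, \<theta>) v = Bh (u', \<theta>') v"
proof -
  have "(LINT x|M. A v x * u x) = (LINT x|M. A v x * u' x)"
    by (rule integral_mult_AE_cong) (simp_all add: A_sq assms)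
  moreover have "sk v \<theta> = sk v \<theta>'" using assms by (simp add: same_trace_iff H0_H)
  ultimately show ?thesis by (simp add: Bh_eq)
qed

text \<open>Compatibility with \<open>ns_eq\<close>, a separate clause of \<open>bounded_op\<close>,
  follows from linearity and the bound, since the difference of equal elements has norm 0.\<close>

lemma dualI:
  assumes f_add: "\<And>u v. u \<in> ns_elems V \<Longrightarrow> v \<in> ns_elems V \<Longrightarrow> f (\<lambda>x. u x + v x) = f u + f v"
    and f_scale: "\<And>r u. u \<in> ns_elems V \<Longrightarrow> f (\<lambda>x. r * u x) = r * f u"
    and f_bound: "\<And>u. u \<in> ns_elems V \<Longrightarrow> \<bar>f u\<bar> \<le> C * V.nrm u" and C: "0 \<le> C"
  shows "bounded_op V real_space f" "op_norm V real_space f \<le> C"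
proof -
  have "f v = f w" if vw: "v \<in> ns_elems V" "w \<in> ns_elems V" "AE x in M. v x = w x" for v w
  proof -
    have "f (\<lambda>x. v x - w x) = f v - f w"
      using f_add[OF vw(1) V.scale[OF vw(2), of "-1"]] f_scale[OF vw(2), of "-1"] by simp
    moreover have "\<bar>f (\<lambda>x. v x - w x)\<bar> \<le> 0"
      using f_bound[OF V.diff[OF vw(1,2)]] V_AE_nrm[OF vw] by simp
    ultimately show ?thesis by simp
  qed
  then show "bounded_op V real_space f"
    unfolding bounded_op_def real_space_simps Hh_space_simps norm_V
    by (intro conjI ballI allI impI exI[of _ C] UNIV_I f_add f_scale f_bound)
  show "op_norm V real_space f \<le> C"
  proof (rule op_norm_le[of "\<lambda>x. 0"])
    fix v assume v: "v \<in> ns_elems V" "ns_norm V v \<le> 1"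
    have "\<bar>f v\<bar> \<le> C * V.nrm v" by (rule f_bound[OF v(1)])
    also have "\<dots> \<le> C * 1" using v C by (intro mult_left_mono) auto
    finally show "ns_norm real_space (f v) \<le> C" by simp
  qed (simp_all add: V.zero V.nrm_zero)
qed

lemma dualD:
  assumes f: "bounded_op V real_space f"
  shows "u \<in> ns_elems V \<Longrightarrow> v \<in> ns_elems V \<Longrightarrow> f (\<lambda>x. u x + v x) = f u + f v"
    and "u \<in> ns_elems V \<Longrightarrow> f (\<lambda>x. r * u x) = r * f u"
    and "u \<in> ns_elems V \<Longrightarrow> v \<in> ns_elems V \<Longrightarrow> AE x in M. u x = v x \<Longrightarrow> f u = f v"
    and "u \<in> ns_elems V \<Longrightarrow> \<bar>f u\<bar> \<le> op_norm V real_space f * V.nrm u"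
    and "0 \<le> op_norm V real_space f"
proof -
  note f' = f[unfolded bounded_op_def real_space_simps Hh_space_simps]
  show "u \<in> ns_elems V \<Longrightarrow> v \<in> ns_elems V \<Longrightarrow> f (\<lambda>x. u x + v x) = f u + f v"
    "u \<in> ns_elems V \<Longrightarrow> f (\<lambda>x. r * u x) = r * f u"
    "u \<in> ns_elems V \<Longrightarrow> v \<in> ns_elems V \<Longrightarrow> AE x in M. u x = v x \<Longrightarrow> f u = f v"
    using f' by blast+
  show "u \<in> ns_elems V \<Longrightarrow> \<bar>f u\<bar> \<le> op_norm V real_space f * V.nrm u"
    using op_norm_bound[OF f seminormed_V seminormed_real_space, of u] by simp
  show "0 \<le> op_norm V real_space f"
    by (rule op_norm_nonneg[OF f seminormed_V seminormed_real_space V.zero])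
qed

lemma Bh_dual:
  assumes "u \<in> square_integrable M" "\<theta> \<in> H0m"
  shows "bounded_op V real_space (Bh (u, \<theta>))"
    and "op_norm V real_space (Bh (u, \<theta>)) \<le> (m + 1) * l2norm M u + (1 + \<delta>) * ns_norm T \<theta>"
proof -
  have nn: "0 \<le> (m + 1) * l2norm M u + (1 + \<delta>) * ns_norm T \<theta>"
    by (intro add_nonneg_nonneg mult_nonneg_nonneg L2.nrm_nonneg trace_norm_nonneg assms)
      (simp_all add: Linf_norm_nonneg)
  show "bounded_op V real_space (Bh (u, \<theta>))"
    by (rule dualI(1)[OF Bh_left[OF assms] nn])
  show "op_norm V real_space (Bh (u, \<theta>)) \<le> (m + 1) * l2norm M u + (1 + \<delta>) * ns_norm T \<theta>"
    by (rule dualI(2)[OF Bh_left[OF assms] nn])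
qed

section \<open>Determining the two components\<close>

lemma invBs_V:
  assumes "y \<in> square_integrable M"
  shows "invBs y \<in> ns_elems V" "V.nrm (invBs y) \<le> \<beta>s * l2norm M y"
  using invBs[OF assms] by (simp_all add: H_sub_V H0_H V_nrm_H)

text \<open>Read as a product: \<open>1 + \<beta>s * (1 + m)\<close> bounds the residual
  \<open>f - \<integral> (A v) u\<close> relative to \<open>f\<close>, \<open>m + 1\<close> is the
  cost of \<open>B s\<close> in \<open>trace_lift\<close>, and \<open>\<beta>\<close> that of
  inverting \<open>B\<close>.\<close>

definition C\<^sub>B :: real where "C\<^sub>B = (1 + \<beta>s * (1 + m)) * \<beta> * (m + 1)"

lemma Bh_adjoint_domain:
  assumes u: "u \<in> square_integrable M" and \<theta>: "\<theta> \<in> H0m" and v: "v \<in> H0p"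
  shows "Bh (u, \<theta>) v = (LINT x|M. B_star \<Omega> b c v x * u x)"
proof -
  have "(LINT x|M. A v x * u x) = (LINT x|M. B_star \<Omega> b c v x * u x)"
    by (rule integral_mult_AE_cong)
      (simp_all add: A_sq B_star_sq H_sub_V H0_H[OF v] u A_eq_B_star)
  then show ?thesis by (simp add: Bh_eq sk_zero v \<theta>)
qed

text \<open>Common core of the bound for the trace and of existence: once \<open>u\<close> accounts
  for \<open>f\<close> on the domain of the adjoint, the remainder vanishes there and is the
  skeleton functional of some \<open>w\<close> that satisfies the inflow condition.\<close>

lemma lift_residual:
  assumes f: "bounded_op V real_space f" and u: "u \<in> square_integrable M"
    and le: "l2norm M u \<le> \<beta>s * op_norm V real_space f"
    and zero: "\<And>v. v \<in> H0p \<Longrightarrow> f v = (LINT x|M. A v x * u x)"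
  shows "\<exists>w\<in>H0m. (\<forall>v\<in>ns_elems V. Bh (u, w) v = f v) \<and> H.nrm w \<le> C\<^sub>B * op_norm V real_space f"
proof -
  define F where "F = op_norm V real_space f"
  define g where "g v = f v - (LINT x|M. A v x * u x)" for v
  \<comment> \<open>Viewed as \<open>Bh\<close> with zero trace, the volume term inherits its
    linearity in \<open>v\<close> from \<open>Bh_left\<close>.\<close>
  have A_lin: "(LINT x|M. A v x * u x) = Bh (u, \<lambda>x. 0) v" if "v \<in> ns_elems V" for v
    using sk_scale_right[OF that H.zero, of 0] by (simp add: Bh_eq)
  note Bu = Bh_left[OF u zero_H0]
  have m0: "0 \<le> m" by (rule Linf_norm_nonneg)
  have "\<exists>w\<in>H0m. (\<forall>v\<in>ns_elems V. sk v w = g v) \<and> H.nrm w \<le> \<beta> * ((m + 1) * (F + (m + 1) * l2norm M u))"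
  proof (rule trace_lift)
    show "g (\<lambda>x. v x + w x) = g v + g w" if "v \<in> ns_elems V" "w \<in> ns_elems V" for v w
      using dualD(1)[OF f that] Bu(1)[OF that] that by (simp add: g_def A_lin V.add)
    show "g (\<lambda>x. r * v x) = r * g v" if "v \<in> ns_elems V" for r v
      using dualD(2)[OF f that] Bu(2)[OF that] that by (simp add: g_def A_lin V.scale right_diff_distrib)
    show "\<bar>g v\<bar> \<le> (F + (m + 1) * l2norm M u) * V.nrm v" if v: "v \<in> ns_elems V" for v
    proof -
      have "\<bar>LINT x|M. A v x * u x\<bar> \<le> l2norm M (A v) * l2norm M u"
        by (intro L2.Cauchy_Schwarz A_sq v u)
      also have "\<dots> \<le> (m + 1) * V.nrm v * l2norm M u"
        by (intro mult_right_mono A_bound v L2.nrm_nonneg u)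
      finally have "\<bar>g v\<bar> \<le> F * V.nrm v + (m + 1) * V.nrm v * l2norm M u"
        using dualD(4)[OF f v] unfolding g_def F_def by linarith
      then show ?thesis by (simp add: algebra_simps)
    qed
    show "0 \<le> F + (m + 1) * l2norm M u"
      unfolding F_def using m0 by (intro add_nonneg_nonneg mult_nonneg_nonneg dualD(5)[OF f] L2.nrm_nonneg u) auto
    show "g v = 0" if "v \<in> H0p" for v using zero[OF that] by (simp add: g_def)
  qed
  then obtain w where w: "w \<in> H0m" "\<And>v. v \<in> ns_elems V \<Longrightarrow> sk v w = g v"
    "H.nrm w \<le> \<beta> * ((m + 1) * (F + (m + 1) * l2norm M u))" by blast
  have "\<beta> * ((m + 1) * (F + (m + 1) * l2norm M u)) \<le> \<beta> * ((m + 1) * (F + (m + 1) * (\<beta>s * F)))"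
    using le m0 \<beta>_nonneg unfolding F_def by (intro mult_left_mono add_left_mono) auto
  also have "\<dots> = C\<^sub>B * F" by (simp add: C\<^sub>B_def algebra_simps)
  finally have "H.nrm w \<le> C\<^sub>B * F" using w(3) by linarith
  then show ?thesis using w(1,2) by (intro bexI[of _ w]) (simp_all add: Bh_eq g_def F_def)
qed

text \<open>The test function \<open>invBs u\<close> removes the skeleton term and turns the volume
  term into the square of the norm of \<open>u\<close>. For the trace, the lifted \<open>w\<close>
  has the same skeleton functional as \<open>\<theta>\<close>, so it is one of the functions over
  which the quotient norm takes the infimum.\<close>

lemma solution_bound:
  assumes u: "u \<in> square_integrable M" and \<theta>: "\<theta> \<in> H0m" and f: "bounded_op V real_space f"
    and sol: "\<And>v. v \<in> ns_elems V \<Longrightarrow> Bh (u, \<theta>) v = f v"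
  shows "l2norm M u \<le> \<beta>s * op_norm V real_space f"
    and "ns_norm T \<theta> \<le> C\<^sub>B * op_norm V real_space f"
proof -
  define v where "v = invBs u"
  have v: "v \<in> H0p" "AE x in M. B_star \<Omega> b c v x = u x" unfolding v_def using invBs[OF u] by auto
  note vV = invBs_V[OF u, folded v_def]
  have "(l2norm M u)\<^sup>2 = (LINT x|M. u x * u x)" by (rule L2.nrm_sq[OF u])
  also have "\<dots> = (LINT x|M. B_star \<Omega> b c v x * u x)"
  proof (rule integral_mult_AE_cong)
    show "AE x in M. u x = B_star \<Omega> b c v x" using v(2) by eventually_elim simp
  qed (simp_all add: u B_star_sq H0_H[OF v(1)])
  also have "\<dots> = f v" using Bh_adjoint_domain[OF u \<theta> v(1)] sol[OF vV(1)] by simp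
  also have "\<dots> \<le> op_norm V real_space f * V.nrm v" using dualD(4)[OF f vV(1)] by simp
  also have "\<dots> \<le> op_norm V real_space f * (\<beta>s * l2norm M u)"
    by (intro mult_left_mono vV(2) dualD(5)[OF f])
  finally have sq: "l2norm M u * l2norm M u \<le> (\<beta>s * op_norm V real_space f) * l2norm M u"
    by (simp add: power2_eq_square mult_ac)
  show le: "l2norm M u \<le> \<beta>s * op_norm V real_space f"
  proof (cases "l2norm M u = 0")
    case True
    then show ?thesis using \<beta>s_nonneg dualD(5)[OF f] by simp
  next
    case False
    then have "l2norm M u > 0" using L2.nrm_nonneg[OF u] by linarith
    then show ?thesis using sq by simp
  qed
  have "f v = (LINT x|M. A v x * u x)" if v: "v \<in> H0p" for v
    using sol[OF H_sub_V[OF H0_H[OF v]]] sk_zero[OF v \<theta>] by (simp add: Bh_eq)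
  from lift_residual[OF f u le this] obtain w where w: "w \<in> H0m"
    "\<And>v. v \<in> ns_elems V \<Longrightarrow> Bh (u, w) v = f v" "H.nrm w \<le> C\<^sub>B * op_norm V real_space f" by blast
  have "sk v \<theta> = sk v w" if "v \<in> ns_elems V" for v
    using w(2)[OF that] sol[OF that] by (simp add: Bh_eq)
  then have "same_trace \<Omega> \<K> b \<theta> w"
    by (simp add: same_trace_iff[OF H0_H[OF \<theta>] H0_H[OF w(1)]])
  then show "ns_norm T \<theta> \<le> C\<^sub>B * op_norm V real_space f"
    using trace_norm_le[OF w(1)] w(3) order_trans by blast
qed

text \<open>The Riesz representative of \<open>f\<close> composed with the inverse adjoint is the
  only candidate for \<open>u\<close>, since tests from the domain of the adjoint do not see the
  trace.\<close>

lemma solution_exists: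
  assumes f: "bounded_op V real_space f"
  shows "\<exists>u\<in>square_integrable M. \<exists>\<theta>\<in>H0m. \<forall>v\<in>ns_elems V. Bh (u, \<theta>) v = f v"
proof -
  let ?F = "\<lambda>y. f (invBs y)"
  have Bs: "bounded_op (L2_space \<Omega>) (H0_space \<Omega> b \<Gamma>p) invBs"
    using B_star_inv by (simp add: boundedly_invertible_def)
  have F_bound: "\<bar>?F y\<bar> \<le> (op_norm V real_space f * \<beta>s) * l2norm M y" if y: "y \<in> square_integrable M" for y
  proof -
    have "\<bar>?F y\<bar> \<le> op_norm V real_space f * V.nrm (invBs y)" by (rule dualD(4)[OF f invBs_V(1)[OF y]])
    also have "\<dots> \<le> op_norm V real_space f * (\<beta>s * l2norm M y)"
      by (intro mult_left_mono invBs_V(2) y dualD(5)[OF f])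
    finally show ?thesis by (simp add: mult.assoc)
  qed
  have "\<exists>u\<in>square_integrable M. \<forall>y\<in>square_integrable M. ?F y = (LINT x|M. u x * y x)"
  proof (rule semi_hilbert_space.Riesz[OF semi_hilbert_square_integrable])
    fix y z r assume y: "y \<in> square_integrable M"
    \<comment> \<open>The inverse is linear only up to almost everywhere equality, which
      \<open>f\<close> respects.\<close>
    have "?F (\<lambda>x. r * y x) = f (\<lambda>x. r * invBs y x)"
    proof (rule dualD(3)[OF f])
      show "AE x in M. invBs (\<lambda>x. r * y x) x = r * invBs y x"
        using Bs y by (simp add: bounded_op_def)
    qed (simp_all add: invBs_V V.scale y square_integrable_scale)
    then show "?F (\<lambda>x. r * y x) = r * ?F y" using dualD(2)[OF f invBs_V(1)[OF y]] by simp
    assume z: "z \<in> square_integrable M"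
    have "?F (\<lambda>x. y x + z x) = f (\<lambda>x. invBs y x + invBs z x)"
    proof (rule dualD(3)[OF f])
      show "AE x in M. invBs (\<lambda>x. y x + z x) x = invBs y x + invBs z x"
        using Bs y z by (simp add: bounded_op_def)
    qed (simp_all add: invBs_V V.add y z square_integrable_add)
    then show "?F (\<lambda>x. y x + z x) = ?F y + ?F z"
      using dualD(1)[OF f invBs_V(1)[OF y] invBs_V(1)[OF z]] by simp
  next
    show "\<bar>?F y\<bar> \<le> (op_norm V real_space f * \<beta>s) * l2norm M y" if "y \<in> square_integrable M" for y
      by (rule F_bound[OF that])
  qed
  then obtain u where u: "u \<in> square_integrable M"
    "\<And>y. y \<in> square_integrable M \<Longrightarrow> ?F y = (LINT x|M. u x * y x)" by blast
  have le: "l2norm M u \<le> \<beta>s * op_norm V real_space f"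
  proof (cases "l2norm M u = 0")
    case True
    then show ?thesis using \<beta>s_nonneg dualD(5)[OF f] by simp
  next
    case False
    then have pos: "l2norm M u > 0" using L2.nrm_nonneg[OF u(1)] by linarith
    have "l2norm M u * l2norm M u = ?F u"
      using L2.nrm_sq[OF u(1)] u(2)[OF u(1)] by (simp add: power2_eq_square)
    also have "\<dots> \<le> (\<beta>s * op_norm V real_space f) * l2norm M u"
      using F_bound[OF u(1)] by (simp add: mult.commute)
    finally show ?thesis using pos by simp
  qed
  have "f v = (LINT x|M. A v x * u x)" if v: "v \<in> H0p" for v
  proof -
    note vH = H0_H[OF v]
    let ?y = "B_star \<Omega> b c v"
    have y: "?y \<in> square_integrable M" by (rule B_star_sq[OF vH])
    \<comment> \<open>Injectivity of the adjoint identifies the chosen preimage with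
      \<open>v\<close>, so that the representation of \<open>f\<close> extends from chosen preimages
      to the whole domain.\<close>
    have "AE x in M. invBs ?y x = v x"
      using B_star_inv v invBs(1,2)[OF y] by (simp add: boundedly_invertible_def bijective_op_def)
    then have "?F ?y = f v" by (intro dualD(3)[OF f] invBs_V y H_sub_V vH)
    moreover have "(LINT x|M. A v x * u x) = (LINT x|M. ?y x * u x)"
      by (rule integral_mult_AE_cong) (simp_all add: A_sq y H_sub_V vH u(1) A_eq_B_star)
    ultimately show ?thesis using u(2)[OF y] by (simp add: mult.commute)
  qed
  from lift_residual[OF f u(1) le this] show ?thesis using u(1) by blast
qed

text \<open>The difference solves the problem with right-hand side 0, so
  \<open>solution_bound\<close> removes its first component. Equality of the remaining skeleton
  functionals is what equality of traces means.\<close>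

lemma solution_unique:
  assumes u: "u \<in> square_integrable M" "u' \<in> square_integrable M" and \<theta>: "\<theta> \<in> H0m" "\<theta>' \<in> H0m"
    and eq: "\<And>v. v \<in> ns_elems V \<Longrightarrow> Bh (u, \<theta>) v = Bh (u', \<theta>') v"
  shows "AE x in M. u x = u' x" "same_trace \<Omega> \<K> b \<theta> \<theta>'"
proof -
  define w where "w = (\<lambda>x. u x + (-1) * u' x)"
  define \<zeta> where "\<zeta> = (\<lambda>x. \<theta> x + (-1) * \<theta>' x)"
  have w: "w \<in> square_integrable M" unfolding w_def by (intro L2.add L2.scale u)
  have \<zeta>: "\<zeta> \<in> H0m" unfolding \<zeta>_def by (intro H0_add H0_scale \<theta>)
  have sol: "Bh (w, \<zeta>) v = 0" if v: "v \<in> ns_elems V" for v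
    using Bh_add[OF u(1) L2.scale[OF u(2)] \<theta>(1) H0_scale[OF \<theta>(2)] v, of "-1" "-1"]
      Bh_scale[OF \<theta>(2) v, of "-1" u'] eq[OF v] by (simp add: w_def \<zeta>_def)
  have zero: "bounded_op V real_space (\<lambda>v. 0)" "op_norm V real_space (\<lambda>v. 0) \<le> 0"
    using dualI[of "\<lambda>v. 0" 0] by auto
  have "l2norm M w \<le> \<beta>s * op_norm V real_space (\<lambda>v. 0)"
    by (rule solution_bound(1)[OF w \<zeta> zero(1)]) (rule sol)
  also have "op_norm V real_space (\<lambda>v. 0) = 0" using zero(2) dualD(5)[OF zero(1)] by linarith
  finally have "l2norm M w = 0" using L2.nrm_nonneg[OF w] by simp
  then have "(LINT x|M. w x * w x) = 0" using L2.nrm_sq[OF w] by simp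
  then have w0: "AE x in M. w x = 0" by (rule l2norm_zero_imp_AE[OF w])
  then show ae: "AE x in M. u x = u' x" by eventually_elim (simp add: w_def)
  have "sk v \<theta> = sk v \<theta>'" if v: "v \<in> ns_elems V" for v
  proof -
    have "(LINT x|M. A v x * u x) = (LINT x|M. A v x * u' x)"
      by (rule integral_mult_AE_cong) (simp_all add: A_sq v u ae)
    then show ?thesis using eq[OF v] by (simp add: Bh_eq)
  qed
  then show "same_trace \<Omega> \<K> b \<theta> \<theta>'"
    by (simp add: same_trace_iff[OF H0_H[OF \<theta>(1)] H0_H[OF \<theta>(2)]])
qed

section \<open>Norms of the operator and of its inverse\<close>

lemma U_norm_components:
  assumes "p \<in> ns_elems U"
  shows "l2norm M (fst p) \<le> ns_norm U p" "ns_norm T (snd p) \<le> ns_norm U p"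
  by (auto intro!: real_le_rsqrt)

text \<open>The constant is \<open>(m + 1) + (1 + \<delta>)\<close>, one summand for each component,
  with both components bounded by the full norm.\<close>

lemma Bh_norm_bound:
  assumes p: "p \<in> ns_elems U"
  shows "op_norm V real_space (Bh p) \<le> (2 + \<delta> + m) * ns_norm U p"
proof -
  have "op_norm V real_space (Bh (fst p, snd p)) \<le> (m + 1) * l2norm M (fst p) + (1 + \<delta>) * ns_norm T (snd p)"
    using p by (intro Bh_dual(2)) auto
  also have "\<dots> \<le> (m + 1) * ns_norm U p + (1 + \<delta>) * ns_norm U p"
    using U_norm_components[OF p] Linf_norm_nonneg[of \<Omega> cd] Linf_norm_nonneg[of \<Omega> d]
    by (intro add_mono mult_left_mono) auto
  finally show ?thesis by (simp only: prod.collapse) (simp add: algebra_simps)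
qed

lemma bounded_op_Bh: "bounded_op U (dual_space V) Bh"
  unfolding bounded_op_def
proof (intro conjI ballI allI impI exI)
  fix p assume p: "p \<in> ns_elems U"
  then show "Bh p \<in> ns_elems (dual_space V)" using Bh_dual(1)[of "fst p" "snd p"] by simp
  show "ns_norm (dual_space V) (Bh p) \<le> (2 + \<delta> + m) * ns_norm U p"
    using Bh_norm_bound[OF p] by simp
  show "ns_eq (dual_space V) (Bh (ns_scale U r p)) (ns_scale (dual_space V) r (Bh p))" for r
    using p Bh_scale[of "snd p" _ r "fst p"] by simp
  fix q assume q: "q \<in> ns_elems U"
  show "ns_eq (dual_space V) (Bh (ns_add U p q)) (ns_add (dual_space V) (Bh p) (Bh q))"
    using p q Bh_add[of "fst p" "fst q" "snd p" "snd q"] by simp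
  assume "ns_eq U p q"
  then show "ns_eq (dual_space V) (Bh p) (Bh q)"
    using p q Bh_cong[of "fst p" "fst q" "snd p" "snd q"] by simp
qed

lemma bijective_op_Bh: "bijective_op U (dual_space V) Bh"
  unfolding bijective_op_def
proof (intro conjI ballI impI)
  fix p q assume "p \<in> ns_elems U" "q \<in> ns_elems U" "ns_eq (dual_space V) (Bh p) (Bh q)"
  then show "ns_eq U p q" using solution_unique[of "fst p" "fst q" "snd p" "snd q"] by simp
next
  fix f assume "f \<in> ns_elems (dual_space V)"
  then obtain u \<theta> where "u \<in> square_integrable M" "\<theta> \<in> H0m" "\<forall>v\<in>ns_elems V. Bh (u, \<theta>) v = f v"
    using solution_exists[of f] by auto
  then show "\<exists>p\<in>ns_elems U. ns_eq (dual_space V) (Bh p) f" by (intro bexI[of _ "(u, \<theta>)"]) auto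
qed

abbreviation "invBh \<equiv> inverse_op U (dual_space V) Bh"

lemma invBh:
  assumes "bounded_op V real_space f"
  shows "invBh f \<in> ns_elems U" "v \<in> ns_elems V \<Longrightarrow> Bh (invBh f) v = f v"
  using inverse_op_props[OF bijective_op_Bh, of f] assms by auto

text \<open>The componentwise bounds are squared and added, as in the norm of the product
  space.\<close>

lemma invBh_bound:
  assumes f: "bounded_op V real_space f"
  shows "ns_norm U (invBh f) \<le> sqrt (\<beta>s\<^sup>2 + C\<^sub>B\<^sup>2) * op_norm V real_space f"
proof -
  let ?p = "invBh f" and ?F = "op_norm V real_space f"
  have p: "fst ?p \<in> square_integrable M" "snd ?p \<in> H0m" using invBh(1)[OF f] by auto
  have "l2norm M (fst ?p) \<le> \<beta>s * ?F" "ns_norm T (snd ?p) \<le> C\<^sub>B * ?F"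
    using solution_bound[OF p f] invBh(2)[OF f] by auto
  then have "(l2norm M (fst ?p))\<^sup>2 + (ns_norm T (snd ?p))\<^sup>2 \<le> (\<beta>s * ?F)\<^sup>2 + (C\<^sub>B * ?F)\<^sup>2"
    using L2.nrm_nonneg[OF p(1)] trace_norm_nonneg[OF p(2)] by (intro add_mono power_mono)
  also have "\<dots> = (\<beta>s\<^sup>2 + C\<^sub>B\<^sup>2) * ?F\<^sup>2" by (simp add: power_mult_distrib algebra_simps)
  finally have "ns_norm U ?p \<le> sqrt ((\<beta>s\<^sup>2 + C\<^sub>B\<^sup>2) * ?F\<^sup>2)" by simp
  then show ?thesis using dualD(5)[OF f] by (simp add: real_sqrt_mult)
qed

text \<open>\<open>invBh\<close> chooses preimages independently of each other. Its linearity is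
  recovered from injectivity of \<open>Bh\<close>: both candidates have the same image.\<close>

lemma bounded_op_invBh: "bounded_op (dual_space V) U invBh"
  unfolding bounded_op_def
proof (intro conjI ballI allI impI exI)
  have unique: "ns_eq U p q" if "p \<in> ns_elems U" "q \<in> ns_elems U" "\<And>v. v \<in> ns_elems V \<Longrightarrow> Bh p v = Bh q v" for p q
    using bijective_op_Bh that by (simp add: bijective_op_def)
  fix f assume "f \<in> ns_elems (dual_space V)"
  then have f: "bounded_op V real_space f" by simp
  show "invBh f \<in> ns_elems U" by (rule invBh(1)[OF f])
  show "ns_norm U (invBh f) \<le> sqrt (\<beta>s\<^sup>2 + C\<^sub>B\<^sup>2) * ns_norm (dual_space V) f"
    using invBh_bound[OF f] by simp
  note p = invBh(1)[OF f]
  show "ns_eq U (invBh (ns_scale (dual_space V) r f)) (ns_scale U r (invBh f))" for r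
  proof (rule unique)
    have rf: "bounded_op V real_space (\<lambda>v. r * f v)"
    proof (rule dualI(1))
      show "\<bar>r * f v\<bar> \<le> (\<bar>r\<bar> * op_norm V real_space f) * V.nrm v" if "v \<in> ns_elems V" for v
        using mult_left_mono[OF dualD(4)[OF f that], of "\<bar>r\<bar>"] by (simp add: abs_mult mult.assoc)
    qed (simp_all add: dualD(1,2,5)[OF f] algebra_simps)
    show "invBh (ns_scale (dual_space V) r f) \<in> ns_elems U" using invBh(1)[OF rf] by simp
    show "ns_scale U r (invBh f) \<in> ns_elems U" using p by (simp add: square_integrable_scale H0_scale)
    show "Bh (invBh (ns_scale (dual_space V) r f)) v = Bh (ns_scale U r (invBh f)) v" if "v \<in> ns_elems V" for v
      using that p invBh(2)[OF rf that] invBh(2)[OF f that] Bh_scale[of "snd (invBh f)" v r "fst (invBh f)"] by simp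
  qed
  fix h assume "h \<in> ns_elems (dual_space V)"
  then have h: "bounded_op V real_space h" by simp
  note q = invBh(1)[OF h]
  show "ns_eq U (invBh (ns_add (dual_space V) f h)) (ns_add U (invBh f) (invBh h))"
  proof (rule unique)
    have fh: "bounded_op V real_space (\<lambda>v. f v + h v)"
    proof (rule dualI(1))
      show "\<bar>f v + h v\<bar> \<le> (op_norm V real_space f + op_norm V real_space h) * V.nrm v" if "v \<in> ns_elems V" for v
        using dualD(4)[OF f that] dualD(4)[OF h that] by (simp add: distrib_right)
    qed (simp_all add: dualD(1,2,5)[OF f] dualD(1,2,5)[OF h] algebra_simps)
    show "invBh (ns_add (dual_space V) f h) \<in> ns_elems U" using invBh(1)[OF fh] by simp
    show "ns_add U (invBh f) (invBh h) \<in> ns_elems U" using p q by (simp add: square_integrable_add H0_add)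
    show "Bh (invBh (ns_add (dual_space V) f h)) v = Bh (ns_add U (invBh f) (invBh h)) v" if "v \<in> ns_elems V" for v
      using that p q invBh(2)[OF fh that] invBh(2)[OF f that] invBh(2)[OF h that]
        Bh_add[of "fst (invBh f)" "fst (invBh h)" "snd (invBh f)" "snd (invBh h)" v] by simp
  qed
  assume "ns_eq (dual_space V) f h"
  then show "ns_eq U (invBh f) (invBh h)"
    using invBh(2)[OF f] invBh(2)[OF h] by (intro unique p q) simp
qed

theorem boundedly_invertible_Bh:
  "boundedly_invertible U (dual_space V) Bh"
  "op_norm U (dual_space V) Bh \<le> 2 + \<delta> + m"
  "op_norm (dual_space V) U invBh \<le> sqrt (\<beta>s\<^sup>2 + C\<^sub>B\<^sup>2)"
proof -
  show "boundedly_invertible U (dual_space V) Bh"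
    by (simp add: boundedly_invertible_def bounded_op_Bh bijective_op_Bh bounded_op_invBh)
  show "op_norm U (dual_space V) Bh \<le> 2 + \<delta> + m"
  proof (rule op_norm_le)
    have t0: "ns_norm T (\<lambda>x. 0) \<le> 0"
      using trace_norm_le[OF zero_H0 same_trace_refl[OF zero_H0]] H.nrm_zero by simp
    show "(\<lambda>x. 0, \<lambda>x. 0) \<in> ns_elems U" by (simp add: L2.zero zero_H0)
    show "ns_norm U (\<lambda>x. 0, \<lambda>x. 0) \<le> 1"
      using t0 trace_norm_nonneg[OF zero_H0] by (simp add: L2.nrm_zero)
    fix p assume p: "p \<in> ns_elems U" "ns_norm U p \<le> 1"
    have "op_norm V real_space (Bh p) \<le> (2 + \<delta> + m) * ns_norm U p" by (rule Bh_norm_bound[OF p(1)])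
    also have "\<dots> \<le> (2 + \<delta> + m) * 1"
      using p(2) Linf_norm_nonneg[of \<Omega> cd] Linf_norm_nonneg[of \<Omega> d] by (intro mult_left_mono) auto
    finally show "ns_norm (dual_space V) (Bh p) \<le> 2 + \<delta> + m" by simp
  qed
  show "op_norm (dual_space V) U invBh \<le> sqrt (\<beta>s\<^sup>2 + C\<^sub>B\<^sup>2)"
  proof (rule op_norm_le)
    show "(\<lambda>v. 0) \<in> ns_elems (dual_space V)" "ns_norm (dual_space V) (\<lambda>v. 0) \<le> 1"
      using dualI[of "\<lambda>v. 0" 0] by auto
    fix f assume f: "f \<in> ns_elems (dual_space V)" "ns_norm (dual_space V) f \<le> 1"
    have "ns_norm U (invBh f) \<le> sqrt (\<beta>s\<^sup>2 + C\<^sub>B\<^sup>2) * op_norm V real_space f"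
      using f by (intro invBh_bound) simp
    also have "\<dots> \<le> sqrt (\<beta>s\<^sup>2 + C\<^sub>B\<^sup>2) * 1" using f by (intro mult_left_mono) auto
    finally show "ns_norm U (invBh f) \<le> sqrt (\<beta>s\<^sup>2 + C\<^sub>B\<^sup>2)" by simp
  qed
qed

end

theorem theorem3p1:
  fixes \<Omega> :: "(real ^ 'n) set"
    and b :: "real ^ 'n \<Rightarrow> real ^ 'n"
    and c :: "real ^ 'n \<Rightarrow> real"
    and \<Gamma>0 \<Gamma>p \<Gamma>m :: "(real ^ 'n) set"
    and \<Omega>h :: "(real ^ 'n) set set"
  assumes dom: "bounded_lipschitz_domain \<Omega>"
    and b: "\<And>i. (\<lambda>x. b x $ i) \<in> Linf \<Omega>"
    and div_b: "\<exists>d\<in>Linf \<Omega>. has_weak_div \<Omega> b d"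
    and c: "c \<in> Linf \<Omega>"
    and \<Gamma>0: "characteristic_part \<Omega> b \<Gamma>0"
    and \<Gamma>p: "outflow_part \<Omega> b \<Gamma>0 \<Gamma>p"
    and \<Gamma>m: "\<Gamma>m = frontier \<Omega> - (\<Gamma>0 \<union> \<Gamma>p)"
    and B_inv: "boundedly_invertible (H0_space \<Omega> b \<Gamma>m) (L2_space \<Omega>) (B_op \<Omega> b c)"
    and B_star_inv: "boundedly_invertible (H0_space \<Omega> b \<Gamma>p) (L2_space \<Omega>) (B_star \<Omega> b c)"
    and part: "is_partition \<Omega> \<Omega>h"
  defines "U \<equiv> prod_space (L2_space \<Omega>) (trace_space \<Omega> \<Omega>h b \<Gamma>m)"
    and "V \<equiv> Hh_space \<Omega> \<Omega>h b"
    and "Bh \<equiv> Bh_op \<Omega> \<Omega>h b c"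
    and "norm_B_inv \<equiv> op_norm (L2_space \<Omega>) (H0_space \<Omega> b \<Gamma>m)
           (inverse_op (H0_space \<Omega> b \<Gamma>m) (L2_space \<Omega>) (B_op \<Omega> b c))"
    and "norm_B_star_inv \<equiv> op_norm (L2_space \<Omega>) (H0_space \<Omega> b \<Gamma>p)
           (inverse_op (H0_space \<Omega> b \<Gamma>p) (L2_space \<Omega>) (B_star \<Omega> b c))"
    and "m \<equiv> Linf_norm \<Omega> (\<lambda>x. c x - weak_div \<Omega> b x)"
  defines "CB \<equiv> (1 + norm_B_star_inv * (1 + m)) * norm_B_inv * (m + 1)"
  shows "boundedly_invertible U (dual_space V) Bh \<and>
         op_norm U (dual_space V) Bh \<le> 2 + Linf_norm \<Omega> (weak_div \<Omega> b) + m \<and>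
         op_norm (dual_space V) U (inverse_op U (dual_space V) Bh)
           \<le> sqrt (norm_B_star_inv\<^sup>2 + CB\<^sup>2)"
proof -
  \<comment> \<open>The bound on \<open>b\<close> does not enter the final constants, so the sum of
    the norms of the components serves.\<close>
  have tr: "transport \<Omega> b (\<Sum>i\<in>UNIV. Linf_norm \<Omega> (\<lambda>x. b x $ i))"
  proof
    show "open \<Omega>" "bounded \<Omega>" using dom by (auto simp: bounded_lipschitz_domain_def)
    have "(\<lambda>x. b x \<bullet> j) \<in> borel_measurable (lebesgue_on \<Omega>)" if "j \<in> Basis" for j
    proof -
      obtain i where "j = axis i 1" using \<open>j \<in> Basis\<close> by (auto simp: Basis_vec_def)
      then show ?thesis using Linf_measurable[OF b[of i]] by (simp add: inner_axis)
    qed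
    then show "b \<in> borel_measurable (lebesgue_on \<Omega>)"
      by (subst borel_measurable_euclidean_space) blast
    have "AE x in lebesgue_on \<Omega>. \<forall>i\<in>UNIV. \<bar>b x $ i\<bar> \<le> Linf_norm \<Omega> (\<lambda>x. b x $ i)"
      by (rule AE_finite_allI) (auto intro: Linf_AE[OF b])
    then show "AE x in lebesgue_on \<Omega>. norm (b x) \<le> (\<Sum>i\<in>UNIV. Linf_norm \<Omega> (\<lambda>x. b x $ i))"
    proof eventually_elim
      case (elim x)
      have "norm (b x) \<le> (\<Sum>i\<in>UNIV. \<bar>b x $ i\<bar>)" by (rule norm_le_l1_cart)
      also have "\<dots> \<le> (\<Sum>i\<in>UNIV. Linf_norm \<Omega> (\<lambda>x. b x $ i))" using elim by (intro sum_mono) auto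
      finally show ?case .
    qed
  qed (rule div_b)
  interpret transport \<Omega> b "\<Sum>i\<in>UNIV. Linf_norm \<Omega> (\<lambda>x. b x $ i)" by (rule tr)
  have me: "mesh \<Omega>h"
    using partition_cells[OF dom part] part by (auto simp: mesh_def is_partition_def)
  \<comment> \<open>\<open>\<Gamma>m\<close> is what \<open>\<Gamma>0\<close> and
    \<open>\<Gamma>p\<close> leave of the frontier, so that \<open>\<Gamma>p\<close> and
    \<open>\<Gamma>m\<close> together cover \<open>frontier \<Omega> - \<Gamma>0\<close>.\<close>
  interpret dpg \<Omega> b "\<Sum>i\<in>UNIV. Linf_norm \<Omega> (\<lambda>x. b x $ i)" \<Gamma>0 \<Gamma>p \<Gamma>m c \<Omega>h
    using \<Gamma>0 \<Gamma>p \<Gamma>m c me B_inv B_star_inv by unfold_locales (auto simp: outflow_part_def)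
  show ?thesis
    using boundedly_invertible_Bh
    unfolding C\<^sub>B_def CB_def m_def norm_B_inv_def norm_B_star_inv_def U_def V_def Bh_def by blast
qed

end
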